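(* Let $\phi$ be a Drinfeld $A$-module of rank $r$ and $\psi$ the associated Drinfeld $\tilde{\mathbb{A}}$-module. Then in $\mathbb{F}_q(z_1,\dots,z_n,t)((\theta^{-1}))$, \[L(\psi,\tilde{\mathbb{A}}):=\prod_f\frac{[\tilde{\mathbb{A}}/f\tilde{\mathbb{A}}]_{\tilde{\mathbb{A}}}}{[\psi(\tilde{\mathbb{A}}/f\tilde{\mathbb{A}})]_{\tilde{\mathbb{A}}}}=\sum_{a\in A_+}\frac{\mu(a)a(z_1)\cdots a(z_n)t^{\deg_\theta(a)}}{a},\] the product running over the irreducible $f\in A_+$.
   Context: $A=\mathbb{F}_q[\theta]$, $A_+$ the monic polynomials. A Drinfeld $A$-module of rank $r$ is $\phi:A\to A\{\tau\}$, $\phi_\theta=\theta+\sum_{i=1}^r\phi_{\theta,i}\tau^i$, $\phi_{\theta,i}\in A$, $\phi_{\theta,r}\ne0$. For irreducible $f\in A_+$ of degree $d$, $r_0$ is the largest $i\ge1$ with $\phi_{\theta,i}\not\equiv0\pmod f$ ($0$ if none). If $r_0\ge1$ let $x^{r_0}+p_{r_0-1}x^{r_0-1}+\dots+p_0\in A[x]$ be the characteristic polynomial of Frobenius $\tau^d$ on the $h$-adic Tate module ($h\ne f$) of the reduction of $\phi$ mod $f$; $p_0=c(f)^{-1}f$, $c(f)\in\mathbb{F}_q^\times$; $D_f(x)=1+c(f)p_1x+c(f)p_2fx^2+\dots+c(f)f^{r_0-1}x^{r_0}$ (coefficient of $x^i$ is $c(f)p_if^{i-1}$, $p_{r_0}=1$);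 if $r_0=0$, $D_f=1$. $\mu:A_+\to A$ is the multiplicative function with $\sum_{i\ge0}\mu(f^i)x^i=D_f(x)^{-1}$. $a(z_k)$ is $a$ with $\theta$ replaced by $z_k$. $\tilde{\mathbb{A}}=\mathbb{F}_q(z_1,\dots,z_n,t)[\theta]$ ($z_i,t$ indeterminates), $\tau$ the $\mathbb{F}_q(z_1,\dots,z_n,t)$-algebra endomorphism with $\tau(\theta)=\theta^q$, $\ell_0(z)=1$, $\ell_i(z)=\prod_{j=0}^{i-1}(z-\theta^{q^j})$; $\psi:\tilde{\mathbb{A}}\to\tilde{\mathbb{A}}\{\tau\}$ is the $\mathbb{F}_q(z_1,\dots,z_n,t)$-algebra homomorphism with $\psi_\theta=\sum_{i=0}^r t^i\ell_i(z_1)\cdots\ell_i(z_n)\phi_{\theta,i}\tau^i$ ($\phi_{\theta,0}=\theta$). $\psi(\tilde{\mathbb{A}}/f\tilde{\mathbb{A}})$ is $\tilde{\mathbb{A}}/f\tilde{\mathbb{A}}$ with $\theta\cdot x=\psi_\theta(x)$. For a field $k$ and a $k[\theta]$-module $M$ finite-dimensional over $k$, $[M]_{k[\theta]}=\det_{k[X]}(X\,\mathrm{Id}-\theta\mid M\otimes_kk[X])|_{X=\theta}$. *)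

theory Defs
  imports
    "HOL-Algebra.Algebraic_Closure_Type"
    "HOL-Library.Function_Algebras"
    "HOL-Library.FuncSet"
    "HOL-Library.Cardinality"
    "HOL-Library.Poly_Mapping"
    "HOL-Computational_Algebra.Formal_Laurent_Series"
    "HOL-Computational_Algebra.Polynomial_FPS"
    "HOL-Analysis.Infinite_Sum"
    "Jordan_Normal_Form.Char_Poly"
begin

text \<open>
  Throughout, the finite field \<open>F\<^sub>q\<close> is a type \<open>'a :: {field, finite}\<close> with \<open>q = CARD('a)\<close>, and
  \<open>A = F\<^sub>q[\<theta>]\<close> is \<open>'a poly\<close>.
\<close>

definition monics :: "'a :: field poly set" where
  "monics = {a. lead_coeff a = 1}"

definition monic_primes :: "'a :: field poly set" where
  "monic_primes = {f. lead_coeff f = 1 \<and> irreducible f}"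


subsection \<open>Free modules, matrices of endomorphisms\<close>

text \<open>
  \<open>R\<close> is the set of scalars, acting on \<open>V\<close> by \<open>s\<close>. Coordinate vectors are made unique as functions
  by extensionality outside \<open>{..<m}\<close>.
\<close>

definition free_basis ::
  "'r set \<Rightarrow> ('r \<Rightarrow> 'v \<Rightarrow> 'v :: comm_monoid_add) \<Rightarrow> 'v set \<Rightarrow> nat \<Rightarrow> (nat \<Rightarrow> 'v) \<Rightarrow> bool" where
  "free_basis R s V m b \<longleftrightarrow>
     (\<forall>i<m. b i \<in> V) \<and>
     (\<forall>v\<in>V. \<exists>!c. c \<in> {..<m} \<rightarrow>\<^sub>E R \<and> v = (\<Sum>i<m. s (c i) (b i)))"

definition represents ::
  "'r set \<Rightarrow> ('r \<Rightarrow> 'v \<Rightarrow> 'v :: comm_monoid_add) \<Rightarrow> nat \<Rightarrow> (nat \<Rightarrow> 'v) \<Rightarrow> ('v \<Rightarrow> 'v) \<Rightarrow>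
     (nat \<Rightarrow> nat \<Rightarrow> 'r) \<Rightarrow> bool" where
  "represents R s m b T N \<longleftrightarrow>
     (\<forall>i<m. \<forall>j<m. N i j \<in> R) \<and> (\<forall>j<m. T (b j) = (\<Sum>i<m. s (N i j) (b i)))"

text \<open>
  \<open>[M]\<close> for a \<open>k[\<theta>]\<close>-module \<open>M\<close> of finite dimension over \<open>k\<close>: the underlying space is \<open>V\<close>, with
  scalar multiplication \<open>s\<close>, and \<open>\<theta>\<close> acts by \<open>T\<close>. The value is a polynomial over \<open>k\<close>; the
  substitution \<open>X = \<theta>\<close> amounts to calling its variable \<open>\<theta>\<close>.
\<close>

definition module_det ::
  "('k :: field \<Rightarrow> 'v \<Rightarrow> 'v :: comm_monoid_add) \<Rightarrow> 'v set \<Rightarrow> ('v \<Rightarrow> 'v) \<Rightarrow> 'k poly" where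
  "module_det s V T =
     (THE p. \<exists>m b N. free_basis UNIV s V m b \<and> represents UNIV s m b T N \<and>
                     p = char_poly (mat m m (\<lambda>(i, j). N i j)))"


subsection \<open>Drinfeld modules and their reductions\<close>

text \<open>
  A Drinfeld \<open>A\<close>-module is determined by \<open>\<phi>\<^sub>\<theta> \<in> A{\<tau>}\<close>, which is stored as a polynomial in \<open>\<tau>\<close> with
  coefficients in \<open>A\<close> (only the additive structure of \<open>'a poly poly\<close> is used, since \<open>\<tau>\<close> does
  not commute with \<open>A\<close>).
\<close>

definition drinfeld_module :: "nat \<Rightarrow> 'a :: {field, finite} poly poly \<Rightarrow> bool" where
  "drinfeld_module r \<phi> \<longleftrightarrow> 1 \<le> r \<and> degree \<phi> = r \<and> coeff \<phi> 0 = [:0, 1:]"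

definition reduction_rank :: "'a :: {field, finite} poly poly \<Rightarrow> 'a poly \<Rightarrow> nat" where
  "reduction_rank \<phi> f = Max (insert 0 {i. 1 \<le> i \<and> \<not> f dvd coeff \<phi> i})"

text \<open>
  The algebraic closure of \<open>A/f\<close> is the algebraic closure of \<open>F\<^sub>q\<close>, in which \<open>A/f\<close> is embedded by
  sending \<open>\<theta>\<close> to a chosen root of \<open>f\<close>.
\<close>

definition red_root :: "'a :: {field, finite} poly \<Rightarrow> 'a alg_closure" where
  "red_root f = (SOME \<zeta>. poly (map_poly to_ac f) \<zeta> = 0)"

definition red :: "'a :: {field, finite} poly \<Rightarrow> 'a poly \<Rightarrow> 'a alg_closure" where
  "red f a = poly (map_poly to_ac a) (red_root f)"

definition red_theta ::
  "'a :: {field, finite} poly poly \<Rightarrow> 'a poly \<Rightarrow> 'a alg_closure \<Rightarrow> 'a alg_closure" where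
  "red_theta \<phi> f x = (\<Sum>i\<le>degree \<phi>. red f (coeff \<phi> i) * x ^ (CARD('a) ^ i))"

text \<open>The action of \<open>\<phi>\<^sub>a\<close> modulo \<open>f\<close>, for an arbitrary \<open>a \<in> A\<close>.\<close>

definition red_act ::
  "'a :: {field, finite} poly poly \<Rightarrow> 'a poly \<Rightarrow> 'a poly \<Rightarrow> 'a alg_closure \<Rightarrow> 'a alg_closure" where
  "red_act \<phi> f a x = (\<Sum>j\<le>degree a. to_ac (coeff a j) * (red_theta \<phi> f ^^ j) x)"


subsection \<open>The Tate module and the characteristic polynomial of Frobenius\<close>

text \<open>\<open>A\<^sub>h\<close> as the inverse limit of the \<open>A/h\<^sup>k\<close>, each class being given by its reduced representative.\<close>

definition adic_integers :: "'a :: field poly \<Rightarrow> (nat \<Rightarrow> 'a poly) set" where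
  "adic_integers h = {a. \<forall>k. a k = a (Suc k) mod h ^ k}"

definition tate_module ::
  "'a :: {field, finite} poly poly \<Rightarrow> 'a poly \<Rightarrow> 'a poly \<Rightarrow> (nat \<Rightarrow> 'a alg_closure) set" where
  "tate_module \<phi> f h =
     {x. \<forall>k. red_act \<phi> f (h ^ k) (x k) = 0 \<and> red_act \<phi> f h (x (Suc k)) = x k}"

definition tate_scale ::
  "'a :: {field, finite} poly poly \<Rightarrow> 'a poly \<Rightarrow> (nat \<Rightarrow> 'a poly) \<Rightarrow>
     (nat \<Rightarrow> 'a alg_closure) \<Rightarrow> (nat \<Rightarrow> 'a alg_closure)" where
  "tate_scale \<phi> f a x = (\<lambda>k. red_act \<phi> f (a k) (x k))"

definition tate_frob ::
  "'a :: {field, finite} poly \<Rightarrow> (nat \<Rightarrow> 'a alg_closure) \<Rightarrow> (nat \<Rightarrow> 'a alg_closure)" where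
  "tate_frob f x = (\<lambda>k. x k ^ (CARD('a) ^ degree f))"

text \<open>
  \<open>P \<in> A[x]\<close> is the characteristic polynomial of \<open>\<tau>\<^sup>d\<close> on the \<open>h\<close>-adic Tate module. The matrix \<open>N\<close>
  has entries in \<open>A\<^sub>h\<close>; the ring \<open>A\<^sub>h[x]\<close> embeds into the product of the \<open>(A/h\<^sup>k)[x]\<close>, and the
  determinant is computed there level by level.
\<close>

definition is_frob_charpoly ::
  "'a :: {field, finite} poly poly \<Rightarrow> 'a poly \<Rightarrow> 'a poly \<Rightarrow> 'a poly poly \<Rightarrow> bool" where
  "is_frob_charpoly \<phi> f h P \<longleftrightarrow>
     (\<exists>m b N. free_basis (adic_integers h) (tate_scale \<phi> f) (tate_module \<phi> f h) m b \<and>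
        represents (adic_integers h) (tate_scale \<phi> f) m b (tate_frob f) N \<and>
        (\<forall>k l. h ^ k dvd coeff (char_poly (mat m m (\<lambda>(i, j). N i j k)) - P) l))"

text \<open>It does not depend on the choice of the prime \<open>h \<noteq> f\<close>.\<close>

definition frob_charpoly ::
  "'a :: {field, finite} poly poly \<Rightarrow> 'a poly \<Rightarrow> 'a poly poly" where
  "frob_charpoly \<phi> f = (THE P. \<forall>h\<in>monic_primes - {f}. is_frob_charpoly \<phi> f h P)"

definition frob_const :: "'a :: {field, finite} poly poly \<Rightarrow> 'a poly \<Rightarrow> 'a" where
  "frob_const \<phi> f =
     (THE c. c \<noteq> 0 \<and> coeff (frob_charpoly \<phi> f) 0 = smult (inverse c) f)"

definition D_poly :: "'a :: {field, finite} poly poly \<Rightarrow> 'a poly \<Rightarrow> 'a poly poly" where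
  "D_poly \<phi> f =
     1 + (\<Sum>i=1..reduction_rank \<phi> f.
            monom (smult (frob_const \<phi> f) (coeff (frob_charpoly \<phi> f) i) * f ^ (i - 1)) i)"

text \<open>This determines \<open>\<mu>\<close> on monic polynomials, the only place where it is used.\<close>

definition is_mu :: "'a :: {field, finite} poly poly \<Rightarrow> ('a poly \<Rightarrow> 'a poly) \<Rightarrow> bool" where
  "is_mu \<phi> \<mu> \<longleftrightarrow>
     \<mu> 1 = 1 \<and>
     (\<forall>a\<in>monics. \<forall>b\<in>monics. coprime a b \<longrightarrow> \<mu> (a * b) = \<mu> a * \<mu> b) \<and>
     (\<forall>f\<in>monic_primes. Abs_fps (\<lambda>i. \<mu> (f ^ i)) * fps_of_poly (D_poly \<phi> f) = 1)"


subsection \<open>The field of rational functions and the module \<open>\<psi>\<close>\<close>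

text \<open>
  Rational functions over \<open>F\<^sub>q\<close> in indeterminates indexed by the type \<open>'v\<close>. With \<open>v\<close> a bijection
  from \<open>{0..n}\<close> onto \<open>'v\<close>, this is \<open>F\<^sub>q(z\<^sub>1,\<dots>,z\<^sub>n,t)\<close>, where \<open>z\<^sub>k\<close> is the indeterminate \<open>v k\<close> for
  \<open>1 \<le> k \<le> n\<close> and \<open>t\<close> is the indeterminate \<open>v 0\<close>.
\<close>

type_synonym ('a, 'v) ratfun = "(('v \<Rightarrow>\<^sub>0 nat) \<Rightarrow>\<^sub>0 'a) fract"

definition rf_const :: "'a :: field \<Rightarrow> ('a, 'v :: linorder) ratfun" where
  "rf_const c = to_fract (Poly_Mapping.single 0 c)"

definition rf_var :: "'v :: linorder \<Rightarrow> ('a :: field, 'v) ratfun" where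
  "rf_var w = to_fract (Poly_Mapping.single (Poly_Mapping.single w 1) 1)"

definition A_emb :: "'a :: field poly \<Rightarrow> ('a, 'v :: linorder) ratfun poly" where
  "A_emb a = map_poly rf_const a"

definition A_eval :: "'a :: field poly \<Rightarrow> ('a, 'v :: linorder) ratfun \<Rightarrow> ('a, 'v) ratfun" where
  "A_eval a z = poly (A_emb a) z"

definition tau ::
  "('a :: {field, finite}, 'v :: linorder) ratfun poly \<Rightarrow> ('a, 'v) ratfun poly" where
  "tau x = pcompose x (monom 1 (CARD('a)))"

definition ell ::
  "nat \<Rightarrow> ('a :: {field, finite}, 'v :: linorder) ratfun \<Rightarrow> ('a, 'v) ratfun poly" where
  "ell i z = (\<Prod>j<i. [:z:] - monom 1 (CARD('a) ^ j))"

definition psi_theta ::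
  "'a :: {field, finite} poly poly \<Rightarrow> nat \<Rightarrow> (nat \<Rightarrow> 'v :: linorder) \<Rightarrow>
     ('a, 'v) ratfun poly \<Rightarrow> ('a, 'v) ratfun poly" where
  "psi_theta \<phi> n v x =
     (\<Sum>i\<le>degree \<phi>. [:rf_var (v 0) ^ i:] * (\<Prod>k=1..n. ell i (rf_var (v k))) *
        A_emb (coeff \<phi> i) * (tau ^^ i) x)"

text \<open>The quotient by \<open>f\<close>, each class being given by its remainder modulo \<open>f\<close>.\<close>

definition quot_space ::
  "'a :: {field, finite} poly \<Rightarrow> ('a, 'v :: linorder) ratfun poly set" where
  "quot_space f = range (\<lambda>x. x mod A_emb f)"

definition det_quot ::
  "'a :: {field, finite} poly \<Rightarrow> ('a, 'v :: linorder) ratfun poly" where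
  "det_quot f = module_det smult (quot_space f) (\<lambda>x. ([:0, 1:] * x) mod A_emb f)"

definition det_psi_quot ::
  "'a :: {field, finite} poly poly \<Rightarrow> nat \<Rightarrow> (nat \<Rightarrow> 'v :: linorder) \<Rightarrow> 'a poly \<Rightarrow>
     ('a, 'v) ratfun poly" where
  "det_psi_quot \<phi> n v f =
     module_det smult (quot_space f) (\<lambda>x. psi_theta \<phi> n v x mod A_emb f)"


subsection \<open>The L-series\<close>

text \<open>
  \<open>k((\<theta>\<^sup>-\<^sup>1))\<close> is \<open>'k fls\<close> with uniformizer \<open>fls_X = \<theta>\<^sup>-\<^sup>1\<close>, and its topology is the \<open>\<theta>\<^sup>-\<^sup>1\<close>-adic one.
\<close>

definition theta_emb :: "'k :: field poly \<Rightarrow> 'k fls" where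
  "theta_emb p = poly (map_poly fls_const p) fls_X_inv"

definition local_factor ::
  "'a :: {field, finite} poly poly \<Rightarrow> nat \<Rightarrow> (nat \<Rightarrow> 'v :: linorder) \<Rightarrow> 'a poly \<Rightarrow>
     ('a, 'v) ratfun fls" where
  "local_factor \<phi> n v f = theta_emb (det_quot f) / theta_emb (det_psi_quot \<phi> n v f)"

definition L_psi ::
  "'a :: {field, finite} poly poly \<Rightarrow> nat \<Rightarrow> (nat \<Rightarrow> 'v :: linorder) \<Rightarrow> ('a, 'v) ratfun fls" where
  "L_psi \<phi> n v =
     Lim (finite_subsets_at_top monic_primes) (\<lambda>F. \<Prod>f\<in>F. local_factor \<phi> n v f)"

end

theory Submission
  imports Defs
begin

text \<open>
  Fix \<open>f\<close> of degree \<open>d\<close>, with roots \<open>\<theta>\<^sub>i = \<zeta>\<^bsup>q^i\<^esup>\<close> for \<open>i < d\<close>. Modulo \<open>f\<close>, \<open>\<psi>\<^sub>\<theta>\<close> is \<open>\<phi>\<^sub>\<theta>\<close> with \<open>\<tau>\<close> replaced by a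
  semilinear operator \<open>\<sigma>\<close> such that \<open>\<sigma>\<^sup>d\<close> is the scalar \<open>Z = f(z\<^sub>1) \<dots> f(z\<^sub>n) t\<^sup>d\<close>. In the coordinates
  \<open>g \<mapsto> g(\<theta>\<^sub>i)\<close>, the operator \<open>X - \<psi>\<^sub>\<theta>\<close> is, up to a diagonal change of basis, the cyclic \<open>d \<times> d\<close> matrix
  of the recurrence \<open>X y\<^sub>i = \<Sum>\<^sub>s \<phi>\<^sub>s(\<theta>\<^sub>i) y\<^sub>i\<^sub>+\<^sub>s\<close> on sequences with \<open>y\<^sub>i\<^sub>+\<^sub>d = Z y\<^sub>i\<close>.

  Replace \<open>Z\<close> by an indeterminate \<open>x\<close>. A basis of the \<open>h\<close>-adic Tate module yields, modulo each \<open>h\<^sup>k\<close>, a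
  full set of \<open>r\<^sub>0\<close> solutions of the same recurrence, on which a shift by \<open>d\<close> acts through the matrix of
  Frobenius. Computing the determinant of the recurrence together with its periodicity conditions
  in two ways shows that the cyclic determinant is \<open>c(f)\<close> times the characteristic polynomial \<open>P\<close> of
  Frobenius; setting \<open>x = 0\<close> gives the constant \<open>c(f)\<close>. Hence \<open>[\<psi>(A/f)] = c(f) P(Z) = f D\<^sub>f(Z/f)\<close>, and
  the local factor is \<open>\<Sum>\<^sub>i \<mu>(f\<^sup>i) (Z/f)\<^sup>i\<close>.

  Giving \<open>X\<close> weight \<open>r\<close> and \<open>x\<close> weight \<open>d\<close>, the cyclic determinant has weight at most \<open>r d\<close>. This bounds
  \<open>deg \<mu>(a)\<close> by \<open>(1 - 1/r) deg a\<close>, so that the term of \<open>a\<close> in the series has valuation at least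
  \<open>deg a / r\<close> and the Euler product can be expanded.
\<close>

subsection \<open>Determinants of periodic recurrences\<close>

text \<open>A torsion point is not an eigenvector of \<open>\<phi>\<^sub>\<theta>\<close>. But
  applying the quotient of \<open>H(X) - H(\<phi>\<^sub>\<theta>)\<close> by
  \<open>X - \<phi>\<^sub>\<theta>\<close> to a point killed by \<open>H\<close> gives a polynomial
  in \<open>X\<close> on which, modulo \<open>H(X)\<close>, the module acts by multiplication by
  \<open>X\<close>, and whose Frobenius twists solve the recurrence. The price is that every
  identity holds only modulo \<open>h ^ k\<close> and carries the determinant of the solution matrix
  as a factor. Counting torsion shows that this factor is coprime to \<open>h\<close>, so it
  cancels; letting \<open>k\<close> grow turns the congruences into an equality. That equality no
  longer mentions \<open>h\<close>, which is what makes the Frobenius polynomial exist over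
  \<open>A\<close>, be unique and be the same for all \<open>h\<close>. A second obstacle is that
  the Tate module lives over the closure of \<open>F_q\<close>, and the coordinates for \<psi> over
  the closure of \<open>F_q(z_1, ..., z_n, t)\<close>. Both determinants are specialisations of one
  determinant in which \<theta> is free, so knowledge modulo \<open>f\<close> passes from one field
  to the other. Signs and leading coefficients met on the way are carried symbolically until the
  constant term fixes the normalisation.\<close>

lemma det_cong_dvd:
  fixes A B :: "'r :: comm_ring_1 mat"
  assumes A: "A \<in> carrier_mat n n" and B: "B \<in> carrier_mat n n"
    and cong: "\<And>i j. i < n \<Longrightarrow> j < n \<Longrightarrow> m dvd A $$ (i, j) - B $$ (i, j)"
  shows "m dvd det A - det B"
proof -
  have prod_cong: "m dvd (\<Prod>i\<in>I. f i) - (\<Prod>i\<in>I. g i)"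
    if "finite I" "\<And>i. i \<in> I \<Longrightarrow> m dvd f i - g i" for I :: "nat set" and f g :: "nat \<Rightarrow> 'r"
    using that
  proof (induction I rule: finite_induct)
    case (insert x I)
    have "(\<Prod>i\<in>insert x I. f i) - (\<Prod>i\<in>insert x I. g i)
        = (f x - g x) * prod f I + g x * (prod f I - prod g I)"
      using insert by (simp add: algebra_simps)
    then show ?case using insert by (metis dvd_add dvd_mult dvd_mult2 insertCI)
  qed simp
  have "det A - det B = (\<Sum>p\<in>{p. p permutes {0..<n}}. signof p *
      ((\<Prod>i = 0..<n. A $$ (i, p i)) - (\<Prod>i = 0..<n. B $$ (i, p i))))"
    unfolding det_def'[OF A] det_def'[OF B] by (simp add: sum_subtractf right_diff_distrib)
  moreover have "m dvd \<dots>"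
    by (intro dvd_sum dvd_mult prod_cong) (auto intro!: cong dest: permutes_in_image)
  ultimately show ?thesis by simp
qed

text \<open>
  The operator \<open>y \<mapsto> (\<Sum>\<^sub>s a\<^sub>i\<^sub>s y\<^sub>i\<^sub>+\<^sub>s)\<^sub>i\<close> on sequences with \<open>y\<^sub>i\<^sub>+\<^sub>d = x y\<^sub>i\<close>.
\<close>

definition cyc_mat :: "nat \<Rightarrow> nat \<Rightarrow> (nat \<Rightarrow> nat \<Rightarrow> 'r) \<Rightarrow> 'r \<Rightarrow> 'r :: comm_ring_1 mat" where
  "cyc_mat d r a x =
     mat d d (\<lambda>(i, j). \<Sum>s\<le>r. if (i + s) mod d = j then a i s * x ^ ((i + s) div d) else 0)"

lemma cyc_mat_carrier [simp]: "cyc_mat d r a x \<in> carrier_mat d d"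
  by (simp add: cyc_mat_def)

lemma (in comm_ring_hom) map_mat_cyc_mat:
  "map_mat hom (cyc_mat d r a x) = cyc_mat d r (\<lambda>i s. hom (a i s)) (hom x)"
  by (rule eq_matI) (auto simp: cyc_mat_def hom_sum hom_power hom_mult intro!: sum.cong)

text \<open>
  The same equations before the unknowns \<open>y\<^sub>d, \<dots>, y\<^sub>d\<^sub>+\<^sub>r\<^sub>-\<^sub>1\<close> are eliminated: the first \<open>d\<close> rows are the
  recurrence and the others the periodicity condition.
\<close>

definition floquet_mat :: "nat \<Rightarrow> nat \<Rightarrow> (nat \<Rightarrow> nat \<Rightarrow> 'r) \<Rightarrow> 'r \<Rightarrow> 'r :: comm_ring_1 mat" where
  "floquet_mat d r a x =
     mat (d + r) (d + r) (\<lambda>(i, c).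
       if i < d then (if i \<le> c \<and> c \<le> i + r then a i (c - i) else 0)
       else (if c = i - d then x else 0) - (if c = i then 1 else 0))"

lemma floquet_carrier [simp]: "floquet_mat d r a x \<in> carrier_mat (d + r) (d + r)"
  by (simp add: floquet_mat_def)

lemma floquet_upper:
  assumes "i < d"
  shows "(\<Sum>c = 0..<d + r. floquet_mat d r a x $$ (i, c) * g c) = (\<Sum>s\<le>r. a i s * g (i + s))"
proof -
  have "(\<Sum>c = 0..<d + r. floquet_mat d r a x $$ (i, c) * g c) =
        (\<Sum>c\<in>{i..i + r}. a i (c - i) * g c)"
    using assms by (intro sum.mono_neutral_cong_right) (auto simp: floquet_mat_def)
  also have "\<dots> = (\<Sum>s\<le>r. a i s * g (i + s))"
    by (rule sum.reindex_bij_witness[of _ "\<lambda>s. i + s" "\<lambda>c. c - i"]) auto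
  finally show ?thesis .
qed

lemma floquet_lower:
  assumes "j < r"
  shows "(\<Sum>c = 0..<d + r. floquet_mat d r a x $$ (d + j, c) * g c) = x * g j - g (d + j)"
proof -
  have "(\<Sum>c = 0..<d + r. floquet_mat d r a x $$ (d + j, c) * g c) =
        (\<Sum>c = 0..<d + r. (if c = j then x * g c else 0) - (if c = d + j then g c else 0))"
    using assms by (intro sum.cong) (auto simp: floquet_mat_def algebra_simps)
  also have "\<dots> = x * g j - g (d + j)"
    using assms by (simp add: sum_subtractf)
  finally show ?thesis .
qed

lemma floquet_mult_index:
  assumes "i < d + r" "j < d + r" "Q \<in> carrier_mat (d + r) (d + r)"
  shows "(floquet_mat d r a x * Q) $$ (i, j) =
           (\<Sum>c = 0..<d + r. floquet_mat d r a x $$ (i, c) * Q $$ (c, j))"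
  using assms by (auto simp: scalar_prod_def floquet_mat_def intro!: sum.cong)

text \<open>Column operations substitute \<open>x ^ (c div d)\<close> times the unknown
  \<open>c mod d\<close> for each unknown \<open>c\<close>. They are unimodular, annihilate the
  periodicity rows in the first \<open>d\<close> columns and leave the cyclic matrix above; the
  remaining diagonal block is lower triangular with -1 on its diagonal, whence the sign.\<close>

lemma det_floquet_fold:
  fixes x :: "'r :: idom"
  assumes d: "d > 0"
  shows "det (floquet_mat d r a x) = (-1) ^ r * det (cyc_mat d r a x)"
proof -
  let ?M = "floquet_mat d r a x"
  define F where "F c j = (if c mod d = j then x ^ (c div d) else 0)" for c j
  define Q where "Q = four_block_mat (1\<^sub>m d) (0\<^sub>m d r) (mat r d (\<lambda>(i, j). F (d + i) j)) (1\<^sub>m r)"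
  have Q: "Q \<in> carrier_mat (d + r) (d + r)" by (simp add: Q_def)
  have detQ: "det Q = 1"
    unfolding Q_def by (subst det_four_block_mat_upper_right_zero[of _ d _ r]) auto
  have Qij: "Q $$ (c, j) = (if j < d then F c j else if c = j then 1 else 0)"
    if "c < d + r" "j < d + r" for c j
  proof (cases "c < d")
    case False
    then obtain k where "c = d + k" using le_iff_add not_less by blast
    then show ?thesis using that d by (auto simp: Q_def F_def)
  qed (use that d in \<open>auto simp: Q_def F_def\<close>)
  define AR where "AR = mat d r (\<lambda>(i, j). ?M $$ (i, d + j))"
  define BR where "BR = mat r r (\<lambda>(i, j). ?M $$ (d + i, d + j))"
  have right: "(?M * Q) $$ (i, j) = ?M $$ (i, j)" if "i < d + r" "d \<le> j" "j < d + r" for i j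
  proof -
    have "(?M * Q) $$ (i, j) = (\<Sum>c = 0..<d + r. if c = j then ?M $$ (i, c) else 0)"
      unfolding floquet_mult_index[OF that(1,3) Q] using that by (intro sum.cong) (auto simp: Qij)
    then show ?thesis using that by simp
  qed
  have "?M * Q = four_block_mat (cyc_mat d r a x) AR (0\<^sub>m r d) BR"
  proof (rule eq_matI)
    fix i j
    assume "i < dim_row (four_block_mat (cyc_mat d r a x) AR (0\<^sub>m r d) BR)"
      and "j < dim_col (four_block_mat (cyc_mat d r a x) AR (0\<^sub>m r d) BR)"
    then have i: "i < d + r" and j: "j < d + r" by (auto simp: AR_def BR_def cyc_mat_def)
    show "(?M * Q) $$ (i, j) = four_block_mat (cyc_mat d r a x) AR (0\<^sub>m r d) BR $$ (i, j)"
    proof (cases "j < d")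
      case False
      then show ?thesis using i j by (simp add: right AR_def BR_def cyc_mat_def)
    next
      case True
      have eq: "(?M * Q) $$ (i, j) = (\<Sum>c = 0..<d + r. ?M $$ (i, c) * F c j)"
        unfolding floquet_mult_index[OF i j Q] using True j by (intro sum.cong) (auto simp: Qij)
      show ?thesis
      proof (cases "i < d")
        case i': True
        have "(?M * Q) $$ (i, j) = (\<Sum>s\<le>r. a i s * F (i + s) j)"
          unfolding eq floquet_upper[OF i'] ..
        also have "\<dots> = cyc_mat d r a x $$ (i, j)"
          using i' True by (auto simp: cyc_mat_def F_def intro!: sum.cong)
        finally show ?thesis using i' True i j by (simp add: cyc_mat_def AR_def BR_def)
      next
        case i': False
        then obtain k where k: "i = d + k" "k < r" using i by (metis le_iff_add not_less nat_add_left_cancel_less)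
        have "(?M * Q) $$ (i, j) = x * F k j - F (d + k) j"
          unfolding eq by (simp only: k(1) floquet_lower[OF k(2)])
        also have "\<dots> = 0" using d by (simp add: F_def)
        finally show ?thesis using i' True i j by (simp add: cyc_mat_def AR_def BR_def)
      qed
    qed
  qed (auto simp: AR_def BR_def Q_def floquet_mat_def cyc_mat_def)
  then have "det ?M * det Q = det (cyc_mat d r a x) * det BR"
    by (subst det_mult[OF floquet_carrier Q, symmetric], simp,
        subst det_four_block_mat_lower_left_zero[of _ d _ r]) (auto simp: AR_def BR_def)
  moreover have "det BR = (-1) ^ r"
  proof -
    have "det BR = prod_list (diag_mat BR)"
      using d by (intro det_lower_triangular[of r]) (auto simp: BR_def floquet_mat_def)
    also have "diag_mat BR = replicate r (-1)"
      using d by (auto simp: diag_mat_def BR_def floquet_mat_def intro!: nth_equalityI)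
    finally show ?thesis by simp
  qed
  ultimately show ?thesis using detQ by (simp add: mult.commute)
qed

text \<open>Puts the \<open>r\<close> periodicity rows above the \<open>d\<close> recurrence rows,
  so that the product with a completed solution matrix becomes block triangular.\<close>

definition rot_perm :: "nat \<Rightarrow> nat \<Rightarrow> nat \<Rightarrow> nat" where
  "rot_perm d r i = (if i < r then d + i else if i < d + r then i - r else i)"

lemma rot_perm_permutes: "rot_perm d r permutes {0..<d + r}"
proof (rule bij_imp_permutes)
  show "bij_betw (rot_perm d r) {0..<d + r} {0..<d + r}"
    by (rule bij_betw_byWitness[where f' = "\<lambda>i. if i < d then i + r else i - d"])
       (auto simp: rot_perm_def)
qed (auto simp: rot_perm_def)

text \<open>
  \<open>W\<close> is a matrix of \<open>r\<close> solutions (modulo \<open>m\<close>) of the recurrence with coefficients \<open>a\<close>, and shifting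
  by one period \<open>d\<close> multiplies it by \<open>N\<close>: this is Floquet theory for a difference equation.
\<close>

lemma floquet_det:
  fixes m x :: "'r :: idom"
  assumes d: "d > 0"
    and rec: "\<And>i l. i < d \<Longrightarrow> l < r \<Longrightarrow> m dvd (\<Sum>s\<le>r. a i s * W (i + s) l)"
    and mono: "\<And>i l. i < r \<Longrightarrow> l < r \<Longrightarrow> m dvd W (d + i) l - (\<Sum>j = 0..<r. W i j * N j l)"
  shows "m dvd det (mat r r (\<lambda>(i, j). W i j)) *
     (signof (rot_perm d r) * (-1) ^ r * det (cyc_mat d r a x) -
      (\<Prod>i = 0..<d. a i r) * det (mat r r (\<lambda>(i, j). (if i = j then x else 0) - N i j)))"
proof -
  let ?M = "floquet_mat d r a x" and ?p = "rot_perm d r"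
  define M' where "M' = mat (d + r) (d + r) (\<lambda>(i, j). ?M $$ (?p i, j))"
  have M': "M' \<in> carrier_mat (d + r) (d + r)" by (simp add: M'_def)
  have detM': "det M' = signof ?p * det ?M"
    unfolding M'_def by (rule det_permute_rows[OF floquet_carrier rot_perm_permutes])
  define Wt where "Wt = mat r r (\<lambda>(i, j). W i j)"
  define K where "K = mat r r (\<lambda>(i, j). (if i = j then x else 0) - N i j)"
  have WK: "Wt \<in> carrier_mat r r" "K \<in> carrier_mat r r" by (auto simp: Wt_def K_def)
  \<comment> \<open>The columns of solutions are completed by the last \<open>d\<close> unit
    vectors. The determinant stays \<open>det Wt\<close>, and modulo \<open>m\<close> the product
    with \<open>M'\<close> is block triangular: the monodromy defect \<open>Wt * K\<close> above, a
    triangular block with diagonal \<open>a i r\<close> below.\<close>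
  define Q where "Q = four_block_mat Wt (0\<^sub>m r d) (mat d r (\<lambda>(i, j). W (r + i) j)) (1\<^sub>m d)"
  have Q: "Q \<in> carrier_mat (d + r) (d + r)" using WK by (auto simp: Q_def add.commute)
  have detQ: "det Q = det Wt"
    unfolding Q_def using WK by (subst det_four_block_mat_upper_right_zero[of _ r _ d]) auto
  have Qij: "Q $$ (c, j) = (if j < r then W c j else if c = j then 1 else 0)"
    if "c < d + r" "j < d + r" for c j
    using that WK by (auto simp: Q_def Wt_def)
  define BR where "BR = mat r d (\<lambda>(i, j). ?M $$ (d + i, r + j))"
  define AR where "AR = mat d d (\<lambda>(i, j). ?M $$ (i, r + j))"
  define T where "T = four_block_mat (Wt * K) BR (0\<^sub>m d r) AR"
  have T: "T \<in> carrier_mat (d + r) (d + r)"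
    using WK by (auto simp: T_def BR_def AR_def add.commute)
  have detAR: "det AR = (\<Prod>i = 0..<d. a i r)"
  proof -
    have "det AR = prod_list (diag_mat AR)"
      by (intro det_lower_triangular[of d]) (auto simp: AR_def floquet_mat_def)
    also have "\<dots> = (\<Prod>i = 0..<d. a i r)"
      by (auto simp: prod_list_diag_prod AR_def floquet_mat_def intro!: prod.cong)
    finally show ?thesis .
  qed
  have detT: "det T = det Wt * det K * (\<Prod>i = 0..<d. a i r)"
    unfolding T_def using WK
    by (subst det_four_block_mat_lower_left_zero[of _ r _ d])
       (auto simp: BR_def detAR det_mult AR_def[symmetric], auto simp: AR_def)
  have entry: "(M' * Q) $$ (i, j) = (\<Sum>c = 0..<d + r. ?M $$ (?p i, c) * Q $$ (c, j))"
    if "i < d + r" "j < d + r" for i j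
    using that Q by (auto simp: scalar_prod_def M'_def intro!: sum.cong)
  have "m dvd det (M' * Q) - det T"
  proof (rule det_cong_dvd[OF _ T])
    fix i j assume i: "i < d + r" and j: "j < d + r"
    show "m dvd (M' * Q) $$ (i, j) - T $$ (i, j)"
    proof (cases "j < r")
      case False
      have "(M' * Q) $$ (i, j) = (\<Sum>c = 0..<d + r. if c = j then ?M $$ (?p i, c) else 0)"
        unfolding entry[OF i j] using False j by (intro sum.cong) (auto simp: Qij)
      also have "\<dots> = ?M $$ (?p i, j)" using j by simp
      also have "\<dots> = T $$ (i, j)"
        using i j False WK by (auto simp: T_def BR_def AR_def rot_perm_def)
      finally show ?thesis by simp
    next
      case True
      have eq: "(M' * Q) $$ (i, j) = (\<Sum>c = 0..<d + r. ?M $$ (?p i, c) * W c j)"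
        unfolding entry[OF i j] using True j by (intro sum.cong) (auto simp: Qij)
      show ?thesis
      proof (cases "i < r")
        case i': True
        have 1: "(M' * Q) $$ (i, j) = x * W i j - W (d + i) j"
          unfolding eq using i' by (simp add: rot_perm_def floquet_lower)
        have "T $$ (i, j) = (Wt * K) $$ (i, j)"
          using i' True i j WK by (simp add: T_def)
        also have "\<dots> = (\<Sum>k = 0..<r. W i k * ((if k = j then x else 0) - N k j))"
          using i' True by (auto simp: scalar_prod_def Wt_def K_def intro!: sum.cong)
        also have "\<dots> = (\<Sum>k = 0..<r. (if k = j then x * W i k else 0) - W i k * N k j)"
          by (intro sum.cong) (auto simp: algebra_simps)
        also have "\<dots> = x * W i j - (\<Sum>k = 0..<r. W i k * N k j)"
          using True by (simp add: sum_subtractf)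
        finally have "(M' * Q) $$ (i, j) - T $$ (i, j) =
            - (W (d + i) j - (\<Sum>k = 0..<r. W i k * N k j))"
          unfolding 1 by simp
        then show ?thesis using mono[OF i' True] by (metis dvd_minus_iff)
      next
        case i': False
        then have "(M' * Q) $$ (i, j) = (\<Sum>s\<le>r. a (i - r) s * W (i - r + s) j)"
          unfolding eq using i by (simp add: rot_perm_def floquet_upper)
        moreover have "T $$ (i, j) = 0"
          using i' True i j WK by (auto simp: T_def AR_def)
        ultimately show ?thesis using rec[of "i - r" j] i i' True by simp
      qed
    qed
  qed (use M' Q in auto)
  moreover have "det (M' * Q) = signof ?p * (-1) ^ r * det (cyc_mat d r a x) * det Wt"
    by (simp add: det_mult[OF M' Q] detM' detQ det_floquet_fold[OF d])
  ultimately show ?thesis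
    unfolding detT Wt_def[symmetric] K_def[symmetric] by (simp add: algebra_simps)
qed

subsection \<open>Roots of a prime in an extension field\<close>

lemma power_card_eq:
  fixes x :: "'a :: {field, finite}"
  shows "x ^ CARD('a) = x"
proof (cases "x = 0")
  case False
  have "bij_betw ((*) x) (UNIV - {0}) (UNIV - {0})"
    using False by (intro bij_betwI[where g = "(*) (inverse x)"]) (auto simp: field_simps)
  then have "(\<Prod>y\<in>UNIV - {0}. x * y) = \<Prod>(UNIV - {0})"
    by (rule prod.reindex_bij_betw)
  then have "x ^ (CARD('a) - 1) * \<Prod>(UNIV - {0 :: 'a}) = \<Prod>(UNIV - {0})"
    by (simp add: prod.distrib)
  moreover have "\<Prod>(UNIV - {0 :: 'a}) \<noteq> 0" by (simp add: prod_zero_iff)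
  ultimately have "x ^ (CARD('a) - 1) = 1" by simp
  then show ?thesis
    using power_Suc[of x "CARD('a) - 1"] zero_less_card_finite[where 'a = 'a] by simp
qed (simp add: power_0_left)

lemma card_field_gt_1: "CARD('a :: {field, finite}) > 1"
proof -
  have "card {0, 1 :: 'a} \<le> CARD('a)" by (intro card_mono) auto
  then show ?thesis by simp
qed

text \<open>The polynomial \<open>(X + 1)\<^sup>q - X\<^sup>q - 1\<close> has degree less than \<open>q\<close> and vanishes on \<open>F\<^sub>q\<close>.\<close>

lemma binomial_card_eq_0:
  assumes "0 < i" "i < CARD('a :: {field, finite})"
  shows "of_nat (CARD('a) choose i) = (0 :: 'a)"
proof -
  let ?q = "CARD('a)"
  define p :: "'a poly" where "p = (\<Sum>i\<in>{0<..<?q}. monom (of_nat (?q choose i)) i)"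
  have coeff: "coeff p j = (if j \<in> {0<..<?q} then of_nat (?q choose j) else 0)" for j
    by (simp add: p_def coeff_sum)
  have "poly p x = 0" for x
  proof -
    have "x + 1 = (x + 1) ^ ?q" by (rule power_card_eq[symmetric])
    also have "\<dots> = (\<Sum>k\<le>?q. of_nat (?q choose k) * x ^ k)" by (simp add: binomial_ring)
    also have "{..?q} = insert 0 (insert ?q {0<..<?q})" by auto
    also have "(\<Sum>k\<in>\<dots>. of_nat (?q choose k) * x ^ k) = 1 + x ^ ?q + poly p x"
      using card_field_gt_1[where 'a = 'a] by (simp add: p_def poly_sum poly_monom)
    finally show ?thesis by (simp add: power_card_eq)
  qed
  then have "{x. poly p x = 0} = UNIV" by auto
  moreover have "degree p < ?q"
    using card_field_gt_1[where 'a = 'a]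
    by (intro le_less_trans[OF degree_le[of "?q - 1"]]) (auto simp: coeff)
  ultimately have "p = 0" using card_poly_roots_bound[of p] by force
  then show ?thesis using coeff[of i] assms by simp
qed

text \<open>A coefficient condition rather than a degree bound, so that the zero polynomial always
  belongs and is the only element for \<open>n = 0\<close>.\<close>

definition polys_below :: "nat \<Rightarrow> 'a :: zero poly set" where
  "polys_below n = {a. \<forall>i\<ge>n. coeff a i = 0}"

lemma polys_below_iff_mod:
  fixes H :: "'a :: field poly"
  assumes "H \<noteq> 0"
  shows "a \<in> polys_below (degree H) \<longleftrightarrow> a mod H = a"
proof
  assume a: "a \<in> polys_below (degree H)"
  show "a mod H = a"
  proof (cases "a = 0")
    case False
    then have "degree a < degree H"
      using a unfolding polys_below_def by (metis (mono_tags) leading_coeff_0_iff mem_Collect_eq not_less)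
    then show ?thesis by (rule mod_poly_less)
  qed simp
next
  assume "a mod H = a"
  then show "a \<in> polys_below (degree H)"
    using degree_mod_less[OF assms, of a] by (auto simp: polys_below_def coeff_eq_0)
qed

lemma card_polys_below: "card (polys_below n :: 'a :: {field, finite} poly set) = CARD('a) ^ n"
proof -
  have "bij_betw Poly {xs :: 'a list. set xs \<subseteq> UNIV \<and> length xs = n} (polys_below n)"
  proof (rule bij_betwI[where g = "\<lambda>p. map (coeff p) [0..<n]"])
    show "Poly \<in> {xs :: 'a list. set xs \<subseteq> UNIV \<and> length xs = n} \<rightarrow> polys_below n"
      by (auto simp: polys_below_def nth_default_def)
    show "Poly (map (coeff p) [0..<n]) = p" if "p \<in> polys_below n" for p :: "'a poly"
      using that by (intro poly_eqI) (auto simp: polys_below_def nth_default_def)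
  qed (auto simp: nth_default_def intro!: nth_equalityI)
  then show ?thesis using card_lists_length_eq[of "UNIV :: 'a set" n] bij_betw_same_card by fastforce
qed

lemma finite_polys_below [simp]: "finite (polys_below n :: 'a :: {field, finite} poly set)"
  using card_polys_below[where 'a = 'a, of n] by (intro card_ge_0_finite) simp

text \<open>A nonzero element of least degree in the ideal generated by \<open>f\<close> and
  \<open>a\<close> divides both of them. By irreducibility it is a unit or an associate of
  \<open>f\<close>, and the latter would make \<open>f\<close> divide \<open>a\<close>.\<close>

lemma poly_bezout_irreducible:
  fixes f a :: "'a :: field poly"
  assumes f: "irreducible f" and a: "\<not> f dvd a"
  obtains u v where "u * f + v * a = 1"
proof -
  define I where "I = {u * f + v * a | u v. True}"
  define P where "P g \<longleftrightarrow> g \<in> I \<and> g \<noteq> 0" for g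
  have "f = 1 * f + 0 * a" by simp
  then have fI: "f \<in> I" unfolding I_def by blast
  have "a = 0 * f + 1 * a" by simp
  then have aI: "a \<in> I" unfolding I_def by blast
  have "P f" using fI f by (auto simp: P_def)
  then obtain g where g: "P g" "\<And>g'. P g' \<Longrightarrow> degree g \<le> degree g'"
    using exists_least_iff[of "\<lambda>n. \<exists>g. P g \<and> degree g = n"] by (metis not_less)
  have dvdI: "g dvd b" if b: "b \<in> I" for b
  proof (rule ccontr)
    assume "\<not> g dvd b"
    then have nz: "b mod g \<noteq> 0" by (simp add: mod_eq_0_iff_dvd)
    obtain u v u' v' where "b = u * f + v * a" "g = u' * f + v' * a"
      using b g by (auto simp: I_def P_def)
    then have "b mod g = (u - b div g * u') * f + (v - b div g * v') * a"
      by (simp add: algebra_simps flip: minus_div_mult_eq_mod)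
    then have "P (b mod g)" using nz by (auto simp: P_def I_def)
    then have "degree g \<le> degree (b mod g)" by (rule g(2))
    then show False using degree_mod_less[of g b] g nz by (auto simp: P_def)
  qed
  obtain k where k: "f = g * k" using dvdI[OF fI] by (elim dvdE)
  have "g dvd 1"
  proof (rule ccontr)
    assume "\<not> g dvd 1"
    then have "k dvd 1" using irreducibleD[OF f k] by blast
    then have "f dvd g" using k by (metis dvd_mult_unit_iff dvd_refl mult.commute)
    then show False using dvdI[OF aI] a dvd_trans by blast
  qed
  then obtain w where w: "1 = g * w" by (elim dvdE)
  obtain u v where "g = u * f + v * a" using g by (auto simp: I_def P_def)
  then have "(w * u) * f + (w * v) * a = 1" using w by (simp add: algebra_simps)
  then show ?thesis by (rule that)
qed

lemma monic_primes_degree: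
  fixes f :: "'a :: field poly"
  assumes "f \<in> monic_primes"
  shows "degree f > 0"
proof (rule ccontr)
  assume "\<not> degree f > 0"
  then obtain c where "f = [:c:]" by (metis degree_eq_zeroE gr0I)
  then have "f = 1" using assms by (simp add: monic_primes_def one_pCons)
  then show False using assms by (simp add: monic_primes_def)
qed

lemma card_roots_le_degree:
  fixes p :: "'a :: idom poly"
  assumes "p \<noteq> 0" "\<And>x. x \<in> A \<Longrightarrow> poly p x = 0"
  shows "card A \<le> degree p"
proof -
  have "card A \<le> card {x. poly p x = 0}"
    using assms by (intro card_mono poly_roots_finite) auto
  also have "\<dots> \<le> degree p" by (rule card_poly_roots_bound[OF assms(1)])
  finally show ?thesis .
qed

section \<open>Extension fields of the finite field and the conjugates of a root\<close>

locale fq_ext = field_hom e for e :: "'a :: {field, finite} \<Rightarrow> 'b :: field"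
begin

sublocale mp: map_poly_inj_idom_hom e ..

definition ev :: "'b \<Rightarrow> 'a poly \<Rightarrow> 'b" where
  "ev \<zeta> p = poly (map_poly e p) \<zeta>"

lemma of_nat_binomial: "0 < i \<Longrightarrow> i < CARD('a) \<Longrightarrow> of_nat (CARD('a) choose i) = (0 :: 'b)"
  using binomial_card_eq_0[where 'a = 'a, of i] hom_of_nat[of "CARD('a) choose i"] by simp

lemma of_nat_q: "of_nat CARD('a) = (0 :: 'b)"
  using of_nat_binomial[of 1] card_field_gt_1[where 'a = 'a] by simp

lemma add_power_q: "(x + y :: 'b) ^ CARD('a) = x ^ CARD('a) + y ^ CARD('a)"
proof -
  have "(x + y) ^ CARD('a) = (\<Sum>k\<le>CARD('a). of_nat (CARD('a) choose k) * x ^ k * y ^ (CARD('a) - k))"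
    by (rule binomial_ring)
  also have "{..CARD('a)} = insert 0 (insert CARD('a) {0<..<CARD('a)})" by auto
  also have "(\<Sum>k\<in>\<dots>. of_nat (CARD('a) choose k) * x ^ k * y ^ (CARD('a) - k)) = y ^ CARD('a) + x ^ CARD('a)"
    using card_field_gt_1[where 'a = 'a] by (simp add: of_nat_binomial)
  finally show ?thesis by simp
qed

lemma add_power_qi: "(x + y :: 'b) ^ (CARD('a) ^ i) = x ^ (CARD('a) ^ i) + y ^ (CARD('a) ^ i)"
proof (induction i)
  case (Suc i)
  then show ?case by (simp only: power_Suc2 power_mult add_power_q)
qed simp

lemma sum_power_qi: "(\<Sum>x\<in>A. f x :: 'b) ^ (CARD('a) ^ i) = (\<Sum>x\<in>A. f x ^ (CARD('a) ^ i))"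
  by (induction A rule: infinite_finite_induct) (auto simp: add_power_qi power_0_left)

lemma minus_power_qi: "(- x :: 'b) ^ (CARD('a) ^ i) = - (x ^ (CARD('a) ^ i))"
  using add_power_qi[of x "- x" i] by (simp add: power_0_left add_eq_0_iff)

lemma diff_power_qi: "(x - y :: 'b) ^ (CARD('a) ^ i) = x ^ (CARD('a) ^ i) - y ^ (CARD('a) ^ i)"
  using add_power_qi[of x "- y" i] by (simp add: minus_power_qi)

lemma inj_power_qi: "(x :: 'b) ^ (CARD('a) ^ i) = y ^ (CARD('a) ^ i) \<Longrightarrow> x = y"
  using diff_power_qi[of x y i] by simp

lemma e_power_qi: "e a ^ (CARD('a) ^ i) = e a"
proof (induction i)
  case (Suc i)
  have "e a ^ (CARD('a) ^ Suc i) = (e a ^ (CARD('a) ^ i)) ^ CARD('a)" by (simp only: power_Suc2 power_mult)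
  then show ?case using Suc by (metis hom_power power_card_eq)
qed simp

lemma ev_0 [simp]: "ev \<zeta> 0 = 0" and ev_1 [simp]: "ev \<zeta> 1 = 1"
  and ev_add [simp]: "ev \<zeta> (a + b) = ev \<zeta> a + ev \<zeta> b"
  and ev_diff [simp]: "ev \<zeta> (a - b) = ev \<zeta> a - ev \<zeta> b"
  and ev_mult [simp]: "ev \<zeta> (a * b) = ev \<zeta> a * ev \<zeta> b"
  and ev_power [simp]: "ev \<zeta> (a ^ n) = ev \<zeta> a ^ n"
  by (simp_all add: ev_def hom_distribs)

lemma ev_const [simp]: "ev \<zeta> [:c:] = e c"
  by (simp add: ev_def map_poly_pCons_hom)

lemma ev_hom: "comm_ring_hom (ev \<zeta>)"
  by unfold_locales (simp_all)

lemma ev_altdef: "ev \<zeta> p = (\<Sum>i\<le>degree p. e (coeff p i) * \<zeta> ^ i)"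
  by (simp add: ev_def poly_altdef)

lemma ev_power_qi: "ev \<zeta> p ^ (CARD('a) ^ i) = ev (\<zeta> ^ (CARD('a) ^ i)) p"
  by (simp add: ev_altdef sum_power_qi power_mult_distrib e_power_qi flip: power_mult)
     (simp add: mult.commute)

end

text \<open>Instantiated twice: with the closure of \<open>F_q\<close>, where the Tate module lives,
  and with the closure of the rational function field, where the coordinates on the quotient by
  \<open>f\<close> take their values.\<close>

locale fq_ext_root = fq_ext e for e :: "'a :: {field, finite} \<Rightarrow> 'b :: field" +
  fixes f :: "'a poly" and \<zeta> :: 'b
  assumes f: "f \<in> monic_primes" and root: "ev \<zeta> f = 0"
begin

definition "d = degree f"

lemma f_irred: "irreducible f" and f_monic: "lead_coeff f = 1" and f_nz: "f \<noteq> 0"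
  using f by (auto simp: monic_primes_def)

lemma d_pos: "d > 0"
  using monic_primes_degree[OF f] by (simp add: d_def)

lemma ev_eq_0_iff: "ev \<zeta> a = 0 \<longleftrightarrow> f dvd a"
proof
  assume a: "ev \<zeta> a = 0"
  show "f dvd a"
  proof (rule ccontr)
    assume "\<not> f dvd a"
    then obtain u v where "u * f + v * a = 1"
      using poly_bezout_irreducible[OF f_irred] by blast
    then have "ev \<zeta> (u * f + v * a) = 1" by simp
    then show False using a root by simp
  qed
qed (auto simp: root)

definition th :: "nat \<Rightarrow> 'b" where "th i = \<zeta> ^ (CARD('a) ^ i)"

lemma ev_th: "ev (th i) a = ev \<zeta> a ^ (CARD('a) ^ i)"
  by (simp add: th_def ev_power_qi)

lemma ev_th_eq_0_iff: "ev (th i) a = 0 \<longleftrightarrow> f dvd a"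
  by (simp add: ev_th ev_eq_0_iff)

lemma th_add: "th (i + j) = th i ^ (CARD('a) ^ j)"
  by (simp add: th_def power_add power_mult)

text \<open>Otherwise the \<open>q ^ d\<close> values at \<open>\<zeta>\<close> of polynomials of
  degree below \<open>d\<close> would all be roots of \<open>X ^ (q ^ m) - X\<close>, whose degree
  is smaller.\<close>

lemma th_neq:
  assumes "0 < m" "m < d"
  shows "th m \<noteq> \<zeta>"
proof
  assume eq: "th m = \<zeta>"
  define p :: "'b poly" where "p = monom 1 (CARD('a) ^ m) - monom 1 1"
  have qm: "1 < CARD('a) ^ m" using assms card_field_gt_1[where 'a = 'a] by (intro one_less_power) auto
  then have degp: "degree p = CARD('a) ^ m"
    by (simp add: p_def degree_monom_eq diff_conv_add_uminus degree_add_eq_left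
          del: add_uminus_conv_diff)
  have inj: "inj_on (ev \<zeta>) (polys_below d)"
  proof (rule inj_onI)
    fix a b :: "'a poly" assume ab: "a \<in> polys_below d" "b \<in> polys_below d" "ev \<zeta> a = ev \<zeta> b"
    then have "f dvd a - b" by (simp flip: ev_eq_0_iff)
    then have "a mod f = b mod f" by (simp add: mod_eq_dvd_iff)
    then show "a = b" using ab polys_below_iff_mod[OF f_nz] by (simp add: d_def)
  qed
  have "p \<noteq> 0" using degp qm by auto
  then have "card (ev \<zeta> ` polys_below d) \<le> degree p"
  proof (rule card_roots_le_degree)
    fix y assume "y \<in> ev \<zeta> ` polys_below d"
    then obtain a where y: "y = ev \<zeta> a" by auto
    have "y ^ (CARD('a) ^ m) = y" unfolding y ev_power_qi using eq by (simp add: th_def)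
    then show "poly p y = 0" by (simp add: p_def poly_monom)
  qed
  then have "card (ev \<zeta> ` polys_below d) \<le> CARD('a) ^ m" unfolding degp .
  then have "CARD('a) ^ d \<le> CARD('a) ^ m" by (simp add: card_image[OF inj] card_polys_below)
  then show False using assms card_field_gt_1[where 'a = 'a] by simp
qed

lemma inj_th: "inj_on th {..<d}"
proof (rule linorder_inj_onI)
  fix i j assume ij: "i < j" "i \<in> {..<d}" "j \<in> {..<d}"
  show "th i \<noteq> th j"
  proof
    assume "th i = th j"
    moreover have "th j = th (j - i) ^ (CARD('a) ^ i)"
      using th_add[of "j - i" i] ij by simp
    ultimately have "\<zeta> ^ (CARD('a) ^ i) = th (j - i) ^ (CARD('a) ^ i)"
      by (simp only: th_def)
    then have "\<zeta> = th (j - i)" by (rule inj_power_qi)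
    moreover have "j - i < d" "0 < j - i" using ij by auto
    ultimately show False using th_neq by metis
  qed
qed auto

text \<open>Both sides are monic of degree \<open>d\<close> and vanish at the \<open>d\<close>
  distinct points \<open>th i\<close>, so their difference has too many roots for its
  degree.\<close>

lemma f_eq_prod: "map_poly e f = (\<Prod>i<d. [:- th i, 1:])"
proof -
  let ?P = "\<Prod>i<d. [:- th i, 1:]"
  have degP: "degree ?P = d" by (subst degree_prod_eq_sum_degree) auto
  have leadP: "lead_coeff ?P = 1" by (simp add: lead_coeff_prod)
  have degF: "degree (map_poly e f) = d" by (simp add: d_def)
  have "map_poly e f - ?P = 0"
  proof (rule ccontr)
    assume nz: "map_poly e f - ?P \<noteq> 0"
    have "card (th ` {..<d}) \<le> degree (map_poly e f - ?P)"
    proof (rule card_roots_le_degree[OF nz])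
      fix x assume "x \<in> th ` {..<d}"
      then obtain i where i: "i < d" "x = th i" by auto
      have "ev (th i) f = 0" by (simp add: ev_th_eq_0_iff)
      moreover have "poly ?P x = 0" using i by (auto simp: poly_prod intro!: bexI[of _ i])
      ultimately show "poly (map_poly e f - ?P) x = 0"
        unfolding ev_def i(2) poly_diff by (simp only: diff_self)
    qed
    then have "d \<le> degree (map_poly e f - ?P)"
      unfolding card_image[OF inj_th] card_lessThan .
    moreover have "degree (map_poly e f - ?P) \<le> d"
      using degP degF by (intro degree_diff_le) linarith+
    moreover have "coeff (map_poly e f - ?P) d = 0"
      using leadP f_monic unfolding degP by (simp add: d_def)
    ultimately have "lead_coeff (map_poly e f - ?P) = 0" by (metis le_antisym)
    then show False using nz by (simp only: leading_coeff_0_iff)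
  qed
  then show ?thesis by (simp only: right_minus_eq)
qed

text \<open>\<open>th d\<close> is a root of \<open>f\<close>, hence equals some \<open>th i\<close>
  with \<open>i < d\<close>; for \<open>i > 0\<close>, cancelling \<open>q ^ i\<close>-th powers
  would give \<open>th (d - i) = \<zeta>\<close>, against \<open>th_neq\<close>. This closes the
  cycle of conjugates.\<close>

lemma th_d: "th d = \<zeta>"
proof -
  have "ev (th d) f = 0" by (simp add: ev_th_eq_0_iff)
  then have "(\<Prod>i<d. th d - th i) = 0" by (simp add: ev_def f_eq_prod poly_prod)
  then obtain i where i: "i < d" "th d = th i" by auto
  show ?thesis
  proof (cases "i = 0")
    case False
    have "th d = th (d - i) ^ (CARD('a) ^ i)"
      using th_add[of "d - i" i] i by simp
    then have "th (d - i) ^ (CARD('a) ^ i) = \<zeta> ^ (CARD('a) ^ i)"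
      using i(2) by (simp only: th_def[of i])
    then have "th (d - i) = \<zeta>" by (rule inj_power_qi)
    then show ?thesis using th_neq[of "d - i"] i False by simp
  qed (use i in \<open>simp add: th_def\<close>)
qed

lemma th_mod: "th (i mod d) = th i"
proof (induction i rule: less_induct)
  case (less i)
  show ?case
  proof (cases "i < d")
    case False
    then have "th (i mod d) = th ((i - d) mod d)" by (simp add: le_mod_geq)
    also have "\<dots> = th (i - d)" using False d_pos by (intro less) auto
    also have "\<dots> = th (d + (i - d))" unfolding th_add th_d by (simp add: th_def)
    finally show ?thesis using False by simp
  qed simp
qed

end

subsection \<open>The reduction of a Drinfeld module\<close>

lemma reduction_rank_max:
  assumes "reduction_rank \<phi> f < s"
  shows "f dvd coeff \<phi> s"
proof (rule ccontr)
  assume "\<not> f dvd coeff \<phi> s"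
  then have "s \<in> insert 0 {i. 1 \<le> i \<and> \<not> f dvd coeff \<phi> i}" using assms by auto
  moreover have "finite {i. 1 \<le> i \<and> \<not> f dvd coeff \<phi> i}"
    by (rule finite_subset[of _ "{..degree \<phi>}"]) (auto intro!: le_degree)
  ultimately have "s \<le> reduction_rank \<phi> f" unfolding reduction_rank_def by (intro Max_ge) auto
  then show False using assms by simp
qed

lemma reduction_rank_attained:
  assumes "1 \<le> reduction_rank \<phi> f"
  shows "\<not> f dvd coeff \<phi> (reduction_rank \<phi> f)"
proof -
  have "finite {i. 1 \<le> i \<and> \<not> f dvd coeff \<phi> i}"
    by (rule finite_subset[of _ "{..degree \<phi>}"]) (auto intro!: le_degree)
  then have "reduction_rank \<phi> f \<in> insert 0 {i. 1 \<le> i \<and> \<not> f dvd coeff \<phi> i}"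
    unfolding reduction_rank_def by (intro Max_in) auto
  then show ?thesis using assms by auto
qed

lemma reduction_rank_le_degree: "reduction_rank \<phi> f \<le> degree \<phi>"
  using reduction_rank_attained[of \<phi> f] le_degree[of \<phi> "reduction_rank \<phi> f"]
  by (cases "reduction_rank \<phi> f") (fastforce)+

lemma degree_sum_dominant:
  assumes "finite I" "k \<in> I" "\<And>i. i \<in> I \<Longrightarrow> i \<noteq> k \<Longrightarrow> degree (p i) < degree (p k)"
  shows "degree (\<Sum>i\<in>I. p i) = degree (p k)"
proof (cases "I = {k}")
  case False
  then obtain l where "l \<in> I" "l \<noteq> k" using assms(2) by auto
  then have "0 < degree (p k)" using assms(3) by fastforce
  then have "degree (\<Sum>i\<in>I - {k}. p i) < degree (p k)"
    using assms by (intro degree_sum_less) auto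
  then show ?thesis using assms by (simp add: sum.remove degree_add_eq_left)
qed simp

text \<open>A root of multiplicity two or more is also a root of the derivative, so the multiset of
  roots is a set.\<close>

lemma card_roots_separable:
  fixes p :: "'a :: alg_closed_field poly"
  assumes "p \<noteq> 0" and sep: "\<And>x. poly p x = 0 \<Longrightarrow> poly (pderiv p) x \<noteq> 0"
  shows "card {x. poly p x = 0} = degree p"
proof -
  obtain A where A: "size A = degree p" "p = smult (lead_coeff p) (\<Prod>x\<in>#A. [:- x, 1:])"
    using alg_closed_imp_factorization[OF assms(1)] by blast
  have "count A x \<le> 1" for x
  proof (rule ccontr)
    assume "\<not> count A x \<le> 1"
    then have "x \<in># A" "x \<in># A - {#x#}" by (auto simp: in_diff_count not_le simp flip: count_greater_zero_iff)
    then obtain B where B: "A = add_mset x (add_mset x B)" by (metis insert_DiffM)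
    define g where "g = smult (lead_coeff p) (\<Prod>x\<in>#B. [:- x, 1:])"
    have "p = [:- x, 1:] * ([:- x, 1:] * g)"
      by (subst A(2)) (simp only: B g_def image_mset_add_mset prod_mset.add_mset mult_smult_right)
    then have "poly p x = 0" "poly (pderiv p) x = 0"
      by (simp_all add: pderiv_mult del: mult_pCons_left)
    then show False using sep by blast
  qed
  then have "count A x = count (mset_set (set_mset A)) x" for x
    by (cases "x \<in># A") (auto simp: count_mset_set' not_in_iff le_antisym Suc_leI)
  then have "A = mset_set (set_mset A)" by (rule multiset_eqI)
  then have "size A = card (set_mset A)" by (metis size_mset_set)
  moreover have "{x. poly p x = 0} = set_mset A"
    using assms(1) by (subst A(2)) (auto simp: poly_prod_mset prod_mset_zero_iff)
  ultimately show ?thesis using A by simp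
qed

lemma red_root: "f \<in> monic_primes \<Longrightarrow> poly (map_poly to_ac f) (red_root f) = 0"
  unfolding red_root_def
proof (rule someI_ex, rule alg_closed_imp_poly_has_root)
  assume "f \<in> monic_primes"
  then show "0 < degree (map_poly to_ac f)" by (simp add: degree_map_poly monic_primes_degree)
qed

lemma comm_ring_homD:
  assumes "comm_ring_hom h"
  shows "h (a + b) = h a + h b" "h (a - b) = h a - h b" "h (a * b) = h a * h b"
    "h (\<Sum>j\<in>A. g j) = (\<Sum>j\<in>A. h (g j))" "h 0 = 0" "h 1 = 1"
proof -
  interpret comm_ring_hom h by (rule assms)
  show "h (a + b) = h a + h b" "h (a - b) = h a - h b" "h (a * b) = h a * h b"
    "h (\<Sum>j\<in>A. g j) = (\<Sum>j\<in>A. h (g j))" "h 0 = 0" "h 1 = 1"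
    by (simp_all add: hom_distribs)
qed

lemma comm_ring_hom_map_poly:
  assumes "comm_ring_hom h"
  shows "comm_ring_hom (map_poly h)"
proof -
  interpret comm_ring_hom h by (rule assms)
  interpret m: map_poly_comm_ring_hom h ..
  show ?thesis by (rule m.comm_ring_hom_axioms)
qed

context fq_ext
begin

text \<open>
  On sequences \<open>y\<^sub>i = \<tau>\<^sup>i y\<close>, the \<open>i\<close>-th Frobenius twist of \<open>(X - \<phi>\<^sub>\<theta>) y = 0\<close> is the recurrence with
  coefficients \<open>tw \<zeta> \<phi> i s\<close>.
\<close>

definition tw :: "'b \<Rightarrow> 'a poly poly \<Rightarrow> nat \<Rightarrow> nat \<Rightarrow> 'b poly" where
  "tw \<zeta> \<phi> i s = (if s = 0 then [:0, 1:] else 0) - [:ev (\<zeta> ^ (CARD('a) ^ i)) (coeff \<phi> s):]"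

text \<open>The inner polynomial variable is \<open>X\<close>, the outer one \<open>x\<close>.
  Coefficient \<open>n\<close> of the determinant is the polynomial in \<open>X\<close> that
  multiplies \<open>x ^ n\<close>, to be compared with the coefficient of the Frobenius polynomial
  after renaming \<open>\<theta>\<close> to \<open>X\<close>.\<close>

definition cmat :: "'b \<Rightarrow> 'a poly poly \<Rightarrow> nat \<Rightarrow> nat \<Rightarrow> 'b poly poly mat" where
  "cmat \<zeta> \<phi> d r = cyc_mat d r (\<lambda>i s. [:tw \<zeta> \<phi> i s:]) [:0, 1:]"

text \<open>A Frobenius twist of the coefficients that leaves \<open>X\<close> alone; in particular
  it fixes the moduli \<open>H(X)\<close>, whose coefficients lie in \<open>F_q\<close>.\<close>

definition fr :: "nat \<Rightarrow> 'b poly \<Rightarrow> 'b poly" where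
  "fr i = map_poly (\<lambda>x. x ^ (CARD('a) ^ i))"

lemma power_hom: "comm_ring_hom (\<lambda>x :: 'b. x ^ (CARD('a) ^ i))"
  by unfold_locales (simp_all add: add_power_qi power_mult_distrib power_0_left)

lemma fr_hom: "comm_ring_hom (fr i)"
  unfolding fr_def by (rule comm_ring_hom_map_poly[OF power_hom])

lemmas fr_add = comm_ring_homD(1)[OF fr_hom]
  and fr_diff = comm_ring_homD(2)[OF fr_hom]
  and fr_mult = comm_ring_homD(3)[OF fr_hom]
  and fr_sum = comm_ring_homD(4)[OF fr_hom]
  and fr_0 [simp] = comm_ring_homD(5)[OF fr_hom]

lemma coeff_fr: "coeff (fr i p) n = coeff p n ^ (CARD('a) ^ i)"
  by (simp add: fr_def coeff_map_poly power_0_left)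

lemma fr_smult: "fr i (smult k p) = smult (k ^ (CARD('a) ^ i)) (fr i p)"
  by (rule poly_eqI) (simp add: coeff_fr power_mult_distrib)

lemma fr_e [simp]: "fr i (map_poly e p) = map_poly e p"
  by (rule poly_eqI) (simp add: coeff_fr e_power_qi)

lemma fr_X [simp]: "fr i [:0, 1:] = [:0, 1:]"
  using fr_e[of i "[:0, 1:]"] by (simp add: map_poly_pCons_hom)

lemma fr_fr: "fr i (fr j p) = fr (i + j) p"
  by (rule poly_eqI) (simp add: coeff_fr power_add mult.commute flip: power_mult)

lemma fr_dvd: "a dvd b \<Longrightarrow> fr i a dvd fr i b"
  by (auto simp: dvd_def fr_mult)

end

text \<open>Positive reduced rank only; rank zero involves no Frobenius polynomial and is settled
  directly in \<open>frobenius_data\<close>.\<close>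

locale drinfeld_red =
  fq_ext_root "to_ac :: 'a :: {field, finite} \<Rightarrow> 'a alg_closure" f "red_root f"
  for f :: "'a :: {field, finite} poly" +
  fixes \<phi> :: "'a poly poly"
  assumes phi_0: "coeff \<phi> 0 = [:0, 1:]" and rank_pos: "1 \<le> reduction_rank \<phi> f"
begin

abbreviation "\<zeta> \<equiv> red_root f"
abbreviation "act \<equiv> red_act \<phi> f"
abbreviation "T \<equiv> red_theta \<phi> f"

definition "r = reduction_rank \<phi> f"

definition c :: "nat \<Rightarrow> 'a alg_closure" where "c s = ev \<zeta> (coeff \<phi> s)"

lemma r_pos: "r > 0" using rank_pos by (simp add: r_def)

lemma c_0: "c 0 = \<zeta>"
  by (simp add: c_def phi_0 ev_def map_poly_pCons_hom)

lemma c_r: "c r \<noteq> 0"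
  using reduction_rank_attained[OF rank_pos] by (simp add: c_def r_def ev_eq_0_iff)

lemma T_eq: "T x = (\<Sum>s\<le>r. c s * x ^ (CARD('a) ^ s))"
proof -
  have "T x = (\<Sum>s\<le>degree \<phi>. c s * x ^ (CARD('a) ^ s))"
    by (simp add: red_theta_def red_def c_def ev_def)
  also have "\<dots> = (\<Sum>s\<le>r. c s * x ^ (CARD('a) ^ s))"
    using reduction_rank_le_degree[of \<phi> f]
    by (intro sum.mono_neutral_right)
       (auto simp: r_def c_def ev_eq_0_iff intro!: reduction_rank_max)
  finally show ?thesis .
qed

lemma T_add: "T (x + y) = T x + T y"
  by (simp add: T_eq add_power_qi ring_distribs sum.distrib)

lemma T_scale: "T (to_ac k * x) = to_ac k * T x"
  by (simp add: T_eq power_mult_distrib e_power_qi sum_distrib_left mult_ac)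

lemma T_0 [simp]: "T 0 = 0"
  using T_scale[of 0 0] by simp

lemma T_sum: "T (\<Sum>i\<in>A. g i) = (\<Sum>i\<in>A. T (g i))"
  by (induction A rule: infinite_finite_induct) (simp_all add: T_add)

lemma Tn_add: "(T ^^ j) (x + y) = (T ^^ j) x + (T ^^ j) y"
  by (induction j) (simp_all add: T_add)

lemma Tn_scale: "(T ^^ j) (to_ac k * x) = to_ac k * (T ^^ j) x"
  by (induction j) (simp_all add: T_scale)

lemma act_altdef:
  assumes "degree a \<le> n"
  shows "act a x = (\<Sum>j\<le>n. to_ac (coeff a j) * (T ^^ j) x)"
  unfolding red_act_def using assms
  by (intro sum.mono_neutral_left) (auto simp: coeff_eq_0)

lemma act_0 [simp]: "act 0 x = 0"
  by (simp add: red_act_def)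

lemma act_pCons: "act (pCons k a) x = to_ac k * x + act a (T x)"
  by (subst act_altdef[of _ "Suc (degree a)"])
     (simp_all add: degree_pCons_le sum.atMost_Suc_shift red_act_def funpow_swap1 del: sum.atMost_Suc)

lemma act_1 [simp]: "act 1 x = x"
  by (simp add: one_pCons act_pCons)

lemma act_add_right: "act a (x + y) = act a x + act a y"
  by (simp add: red_act_def Tn_add ring_distribs sum.distrib)

lemma act_scale_right: "act a (to_ac k * x) = to_ac k * act a x"
  by (simp add: red_act_def Tn_scale sum_distrib_left mult.left_commute)

lemma act_0_right [simp]: "act a 0 = 0"
  using act_scale_right[of a 0 0] by simp

lemma act_sum_right: "act a (\<Sum>i\<in>A. g i) = (\<Sum>i\<in>A. act a (g i))"
  by (induction A rule: infinite_finite_induct) (simp_all add: act_add_right)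

lemma act_add: "act (a + b) x = act a x + act b x"
  by (simp add: act_altdef[of _ "max (degree a) (degree b)"] degree_add_le_max ring_distribs
      sum.distrib)

lemma act_smult: "act (smult k a) x = to_ac k * act a x"
  by (simp add: act_altdef[of "smult k a" "degree a"] red_act_def sum_distrib_left mult_ac)

lemma act_uminus: "act (- a) x = - act a x"
  using act_smult[of "-1" a x] by simp

lemma act_diff: "act (a - b) x = act a x - act b x"
  using act_add[of a "- b" x] by (simp add: act_uminus)

lemma act_uminus_right: "act a (- x) = - act a x"
  using act_scale_right[of a "-1" x] by simp

lemma act_T: "act a (T x) = T (act a x)"
  by (simp add: red_act_def T_sum T_scale funpow_swap1)

lemma act_mult: "act (a * b) x = act a (act b x)"
proof (induction a arbitrary: x)
  case (pCons k a)
  show ?case using pCons(2)[of "T x"]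
    by (simp add: act_add act_smult act_pCons act_T)
qed simp

lemma act_commute: "act a (act b x) = act b (act a x)"
  by (metis act_mult mult.commute)

lemma act_mod:
  assumes "act H x = 0"
  shows "act (a mod H) x = act a x"
proof -
  have "act a x = act (a div H * H + a mod H) x" by simp
  then show ?thesis using assms unfolding act_add act_mult by simp
qed

lemma act_dvd: "H dvd a \<Longrightarrow> act H x = 0 \<Longrightarrow> act a x = 0"
  using act_mod[of H x a] by simp

text \<open>The reduced coefficients lie in the field generated by \<open>\<zeta>\<close>, which the
  \<open>q ^ d\<close>-th power map fixes elementwise. Frobenius is thus an endomorphism of the
  reduction.\<close>

lemma T_power: "T (x ^ (CARD('a) ^ d)) = T x ^ (CARD('a) ^ d)"
proof -
  have "c s ^ (CARD('a) ^ d) = c s" for s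
    using th_d by (simp add: c_def ev_power_qi th_def)
  then show ?thesis
    by (simp add: T_eq sum_power_qi power_mult_distrib mult.commute flip: power_mult)
qed

lemma Tn_power: "(T ^^ j) (x ^ (CARD('a) ^ d)) = ((T ^^ j) x) ^ (CARD('a) ^ d)"
  by (induction j) (simp_all add: T_power)

lemma act_power: "act a (x ^ (CARD('a) ^ d)) = act a x ^ (CARD('a) ^ d)"
  by (simp add: red_act_def Tn_power sum_power_qi power_mult_distrib e_power_qi)


section \<open>Torsion points as roots of separable additive polynomials\<close>

definition TP :: "'a alg_closure poly" where
  "TP = (\<Sum>s\<le>r. monom (c s) (CARD('a) ^ s))"

primrec TH :: "nat \<Rightarrow> 'a alg_closure poly" where
  "TH 0 = [:0, 1:]"
| "TH (Suc j) = pcompose TP (TH j)"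

lemma poly_TH: "poly (TH j) x = (T ^^ j) x"
  by (induction j) (simp_all add: poly_pcompose TP_def poly_sum poly_monom T_eq)

lemma degree_TP: "degree TP = CARD('a) ^ r"
proof -
  have "degree TP = degree (monom (c r) (CARD('a) ^ r))"
    unfolding TP_def
  proof (rule degree_sum_dominant)
    fix i assume i: "i \<in> {..r}" "i \<noteq> r"
    have "degree (monom (c i) (CARD('a) ^ i)) \<le> CARD('a) ^ i" by (rule degree_monom_le)
    also have "\<dots> < CARD('a) ^ r"
      using i card_field_gt_1[where 'a = 'a] by (intro power_strict_increasing) auto
    also have "\<dots> = degree (monom (c r) (CARD('a) ^ r))" by (simp add: degree_monom_eq c_r)
    finally show "degree (monom (c i) (CARD('a) ^ i)) < degree (monom (c r) (CARD('a) ^ r))" .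
  qed auto
  then show ?thesis by (simp add: degree_monom_eq c_r)
qed

lemma degree_TH: "degree (TH j) = CARD('a) ^ (r * j)"
  by (induction j) (simp_all add: degree_pcompose degree_TP power_add)

text \<open>Since \<open>q = 0\<close> in the field, every monomial of exponent \<open>q ^ s\<close>
  with \<open>s > 0\<close> has derivative zero.\<close>

lemma pderiv_TP: "pderiv TP = [:\<zeta>:]"
proof -
  have "pderiv TP = (\<Sum>s\<le>r. if s = 0 then [:\<zeta>:] else 0)"
    unfolding TP_def higher_pderiv_sum[of 1, simplified]
    by (intro sum.cong) (auto simp: pderiv_monom c_0 monom_0 of_nat_q power_0_left)
  then show ?thesis by simp
qed

lemma pderiv_TH: "pderiv (TH j) = [:\<zeta> ^ j:]"
  by (induction j) (simp_all add: pderiv_pcompose pderiv_TP pcompose_const pderiv_pCons)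

definition PH :: "'a poly \<Rightarrow> 'a alg_closure poly" where
  "PH H = (\<Sum>j\<le>degree H. smult (to_ac (coeff H j)) (TH j))"

lemma poly_PH: "poly (PH H) x = act H x"
  by (simp add: PH_def poly_sum poly_TH red_act_def)

lemma degree_PH:
  assumes "H \<noteq> 0"
  shows "degree (PH H) = CARD('a) ^ (r * degree H)"
proof -
  have "degree (PH H) = degree (smult (to_ac (coeff H (degree H))) (TH (degree H)))"
    unfolding PH_def
  proof (rule degree_sum_dominant)
    fix i assume i: "i \<in> {..degree H}" "i \<noteq> degree H"
    have "degree (smult (to_ac (coeff H i)) (TH i)) \<le> CARD('a) ^ (r * i)"
      using degree_smult_le[of _ "TH i"] by (simp add: degree_TH)
    also have "\<dots> < CARD('a) ^ (r * degree H)"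
      using i r_pos card_field_gt_1[where 'a = 'a] by (intro power_strict_increasing) auto
    also have "\<dots> = degree (smult (to_ac (coeff H (degree H))) (TH (degree H)))"
      using assms by (simp add: degree_TH)
    finally show "degree (smult (to_ac (coeff H i)) (TH i)) <
      degree (smult (to_ac (coeff H (degree H))) (TH (degree H)))" .
  qed auto
  then show ?thesis using assms by (simp add: degree_TH)
qed

lemma pderiv_PH: "pderiv (PH H) = [:ev \<zeta> H:]"
  unfolding PH_def higher_pderiv_sum[of 1, simplified]
  by (simp add: pderiv_smult pderiv_TH ev_altdef sum_to_poly)

definition tor :: "'a poly \<Rightarrow> 'a alg_closure set" where
  "tor H = {x. act H x = 0}"

text \<open>The derivative of \<open>PH H\<close> is the constant \<open>H(\<zeta>)\<close>, nonzero
  because \<open>f\<close> does not divide \<open>H\<close>; hence all roots of this polynomial of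
  degree \<open>q ^ (r * degree H)\<close> are simple.\<close>

lemma card_tor:
  assumes "H \<noteq> 0" "\<not> f dvd H"
  shows "card (tor H) = CARD('a) ^ (r * degree H)"
proof -
  have "PH H \<noteq> 0" using degree_PH[OF assms(1)] by auto
  then have "card {x. poly (PH H) x = 0} = degree (PH H)"
    using assms by (intro card_roots_separable) (auto simp: pderiv_PH ev_eq_0_iff)
  then show ?thesis by (simp add: poly_PH tor_def degree_PH assms)
qed

lemma finite_tor: "H \<noteq> 0 \<Longrightarrow> \<not> f dvd H \<Longrightarrow> finite (tor H)"
  using card_tor[of H] by (intro card_ge_0_finite) simp

lemma act_surj:
  assumes "H \<noteq> 0"
  obtains y where "act H y = x"
proof -
  have "degree (PH H - [:x:]) = CARD('a) ^ (r * degree H)"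
    using degree_PH[OF assms] 
    by (simp add: diff_conv_add_uminus degree_add_eq_left del: add_uminus_conv_diff)
  then obtain y where "poly (PH H - [:x:]) y = 0"
    using alg_closed_imp_poly_has_root[of "PH H - [:x:]"] by auto
  then show ?thesis using that[of y] by (simp add: poly_PH)
qed

end

section \<open>Generating functions of torsion points\<close>

context drinfeld_red
begin

abbreviation "tp \<equiv> map_poly (to_ac :: 'a \<Rightarrow> 'a alg_closure)"

text \<open>The polynomial part of \<open>H / X ^ j\<close>. In the quotient of
  \<open>H(X) - H(Y)\<close> by \<open>X - Y\<close>, the power \<open>Y ^ j\<close> has coefficient
  \<open>Sh H (Suc j)\<close>.\<close>

definition Sh :: "'a poly \<Rightarrow> nat \<Rightarrow> 'a alg_closure poly" where
  "Sh H j = tp (poly_shift j H)"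

lemma coeff_Sh: "coeff (Sh H j) i = to_ac (coeff H (i + j))"
  by (simp add: Sh_def coeff_poly_shift coeff_map_poly)

lemma Sh_0: "Sh H 0 = tp H"
  by (rule poly_eqI) (simp add: coeff_Sh coeff_map_poly)

lemma X_Sh: "[:0, 1:] * Sh H (Suc j) = Sh H j - [:to_ac (coeff H j):]"
  by (rule poly_eqI) (auto simp: coeff_Sh coeff_pCons split: nat.splits)

lemma Sh_degree: "Sh H (degree H) = [:to_ac (lead_coeff H):]"
  by (rule poly_eqI) (auto simp: coeff_Sh coeff_pCons coeff_eq_0 split: nat.splits)

text \<open>
  This is \<open>(H(X) - H(\<phi>\<^sub>\<theta>)) / (X - \<phi>\<^sub>\<theta>)\<close> applied to \<open>x\<close>. For \<open>x\<close> in the \<open>H\<close>-torsion, dividing it by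
  \<open>H(X)\<close> gives an analogue of Anderson's generating function.
\<close>

definition gpol :: "'a poly \<Rightarrow> 'a alg_closure \<Rightarrow> 'a alg_closure poly" where
  "gpol H x = (\<Sum>j<degree H. smult ((T ^^ j) x) (Sh H (Suc j)))"

lemma gpol_add: "gpol H (x + y) = gpol H x + gpol H y"
  by (simp add: gpol_def Tn_add smult_add_left sum.distrib)

lemma gpol_scale: "gpol H (to_ac k * x) = smult (to_ac k) (gpol H x)"
  by (simp add: gpol_def Tn_scale smult_sum2)

lemma gpol_0 [simp]: "gpol H 0 = 0"
  using gpol_scale[of H 0 0] by simp

lemma gpol_sum: "gpol H (\<Sum>i\<in>A. g i) = (\<Sum>i\<in>A. gpol H (g i))"
  by (induction A rule: infinite_finite_induct) (simp_all add: gpol_add)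

text \<open>With \<open>Q\<close> the quotient of \<open>H(X) - H(Y)\<close> by
  \<open>X - Y\<close>, this is \<open>X Q - Y Q = H(X) - H(Y)\<close> with \<open>Y\<close> acting
  as \<open>T\<close>; by \<open>X_Sh\<close> the sum telescopes.\<close>

lemma gpol_T: "[:0, 1:] * gpol H x - gpol H (T x) = smult x (tp H) - [:act H x:]"
proof -
  let ?D = "degree H" and ?u = "\<lambda>j. smult ((T ^^ j) x) (Sh H j)"
  let ?k = "\<lambda>j. [:to_ac (coeff H j) * (T ^^ j) x:]"
  have "[:0, 1:] * gpol H x = (\<Sum>j<?D. ?u j - ?k j)"
    unfolding gpol_def sum_distrib_left mult_smult_right X_Sh smult_diff_right
    by (simp add: mult.commute)
  moreover have "gpol H (T x) = (\<Sum>j<?D. ?u (Suc j))"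
    by (simp add: gpol_def funpow_swap1)
  ultimately have "[:0, 1:] * gpol H x - gpol H (T x) = (\<Sum>j<?D. ?u j - ?u (Suc j)) - (\<Sum>j<?D. ?k j)"
    by (simp add: sum_subtractf)
  also have "\<dots> = ?u 0 - ?u ?D - (\<Sum>j<?D. ?k j)"
    by (subst sum_lessThan_telescope'[of ?u ?D]) simp
  also have "?u ?D = ?k ?D" by (simp add: Sh_degree mult.commute)
  also have "?u 0 - ?k ?D - (\<Sum>j<?D. ?k j) = ?u 0 - (\<Sum>j\<le>?D. ?k j)"
    by (simp add: lessThan_Suc_atMost[symmetric])
  also have "(\<Sum>j\<le>?D. ?k j) = [:act H x:]"
    by (simp add: red_act_def sum_to_poly)
  finally show ?thesis by (simp add: Sh_0)
qed

lemma fr_Sh [simp]: "fr i (Sh H j) = Sh H j"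
  by (simp add: Sh_def)

text \<open>\<open>T\<close> is a combination of Frobenius powers and the polynomials
  \<open>Sh H j\<close> are fixed by every twist, so expanding the outer \<open>T\<close> gives
  twists of the whole generating function. Combined with \<open>gpol_T\<close> on torsion it becomes
  the recurrence modulo \<open>H(X)\<close>.\<close>

lemma gpol_recurrence: "gpol H (T x) = (\<Sum>s\<le>r. smult (c s) (fr s (gpol H x)))"
proof -
  have "gpol H (T x) = (\<Sum>j<degree H. smult (T ((T ^^ j) x)) (Sh H (Suc j)))"
    by (simp add: gpol_def funpow_swap1)
  also have "\<dots> = (\<Sum>j<degree H. \<Sum>s\<le>r. smult (c s * ((T ^^ j) x) ^ (CARD('a) ^ s)) (Sh H (Suc j)))"
    by (simp add: T_eq smult_sum)
  also have "\<dots> = (\<Sum>s\<le>r. smult (c s) (fr s (gpol H x)))"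
    by (subst sum.swap) (simp add: gpol_def fr_sum fr_smult smult_sum2)
  finally show ?thesis .
qed

text \<open>The full period \<open>d\<close> matters here: \<open>T\<close> commutes with the
  \<open>q ^ d\<close>-th power, so moving one period along the solution amounts to applying
  Frobenius to the point.\<close>

lemma gpol_power: "gpol H (x ^ (CARD('a) ^ d)) = fr d (gpol H x)"
  by (simp add: gpol_def fr_sum fr_smult Tn_power)

lemma tor_T: "x \<in> tor H \<Longrightarrow> T x \<in> tor H"
  by (simp add: tor_def act_T)

text \<open>On \<open>H\<close>-torsion and modulo \<open>H(X)\<close> the generating function is
  linear over \<open>A\<close>, with \<open>a\<close> acting as \<open>a(X)\<close>. For
  \<open>\<theta>\<close> this is \<open>gpol_T\<close>, and the induction builds \<open>a\<close>
  from there.\<close>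

lemma gpol_act:
  assumes "x \<in> tor H"
  shows "tp H dvd tp a * gpol H x - gpol H (act a x)"
  using assms
proof (induction a arbitrary: x)
  case (pCons k a)
  have 1: "tp H dvd tp a * gpol H (T x) - gpol H (act a (T x))"
    by (rule pCons(2)[OF tor_T[OF pCons(3)]])
  have "[:0, 1:] * gpol H x - gpol H (T x) = smult x (tp H)"
    using gpol_T[of H x] pCons(3) by (simp add: tor_def)
  then have 2: "tp H dvd tp a * ([:0, 1:] * gpol H x - gpol H (T x))"
    by (simp add: dvd_smult)
  have 3: "tp (pCons k a) = [:to_ac k:] + [:0, 1:] * tp a"
    by (simp add: map_poly_pCons_hom)
  have "tp (pCons k a) * gpol H x - gpol H (act (pCons k a) x) =
      tp a * ([:0, 1:] * gpol H x - gpol H (T x)) + (tp a * gpol H (T x) - gpol H (act a (T x)))"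
    unfolding 3 act_pCons gpol_add gpol_scale by (simp add: algebra_simps)
  then show ?case using dvd_add[OF 2 1] by simp
qed simp

lemma tw_eq: "tw \<zeta> \<phi> i s = (if s = 0 then [:0, 1:] else 0) - [:c s ^ (CARD('a) ^ i):]"
  by (simp add: tw_def c_def ev_power_qi)

lemma sum_tw:
  "(\<Sum>s\<le>r. tw \<zeta> \<phi> i s * g s) = [:0, 1:] * g 0 - (\<Sum>s\<le>r. smult (c s ^ (CARD('a) ^ i)) (g s))"
proof -
  have "(\<Sum>s\<le>r. tw \<zeta> \<phi> i s * g s) =
    (\<Sum>s\<le>r. (if s = 0 then [:0, 1:] * g s else 0) - smult (c s ^ (CARD('a) ^ i)) (g s))"
    by (intro sum.cong) (auto simp: tw_eq algebra_simps)
  then show ?thesis by (simp add: sum_subtractf)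
qed

lemma torsion_recurrence:
  assumes "x \<in> tor H"
  shows "tp H dvd (\<Sum>s\<le>r. tw \<zeta> \<phi> i s * fr (i + s) (gpol H x))"
proof -
  have "tp H dvd [:0, 1:] * gpol H x - gpol H (T x)"
    using gpol_T[of H x] assms by (simp add: tor_def dvd_smult)
  then have "fr i (tp H) dvd fr i ([:0, 1:] * gpol H x - (\<Sum>s\<le>r. smult (c s) (fr s (gpol H x))))"
    unfolding gpol_recurrence by (rule fr_dvd)
  then show ?thesis
    by (simp only: sum_tw fr_e fr_diff fr_mult fr_X fr_sum fr_smult fr_fr add_0_right)
qed

definition gmat :: "'a poly \<Rightarrow> (nat \<Rightarrow> 'a alg_closure) \<Rightarrow> 'a alg_closure poly mat" where
  "gmat H b = mat r r (\<lambda>(i, l). fr i (gpol H (b l)))"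

text \<open>
  A linear dependency between the rows at a root of \<open>H\<close> would be a \<open>q\<close>-polynomial of degree less
  than \<open>q\<^bsup>r deg H\<^esup>\<close> vanishing on the whole \<open>H\<close>-torsion.
\<close>

lemma det_gmat_nonzero:
  assumes H: "lead_coeff H = 1" "\<not> f dvd H"
    and b: "\<And>l. l < r \<Longrightarrow> b l \<in> tor H"
    and gen: "\<And>x. x \<in> tor H \<Longrightarrow> \<exists>a. x = (\<Sum>l<r. act (a l) (b l))"
    and \<eta>: "poly (tp H) \<eta> = 0"
  shows "poly (det (gmat H b)) \<eta> \<noteq> 0"
proof
  assume det0: "poly (det (gmat H b)) \<eta> = 0"
  define D where "D = degree H"
  have Dpos: "D > 0"
  proof (rule ccontr)
    assume "\<not> D > 0"
    then obtain k where "H = [:k:]" by (metis D_def degree_eq_zeroE gr0I)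
    then show False using H \<eta> by (simp add: map_poly_pCons_hom)
  qed
  define W where "W = map_mat (\<lambda>p. poly p \<eta>) (gmat H b)"
  have W: "W \<in> carrier_mat r r" by (simp add: W_def gmat_def)
  have "det W = 0" unfolding W_def
    by (subst comm_ring_hom.hom_det[OF poly_hom.comm_ring_hom_axioms]) (rule det0)
  then have "det (transpose_mat W) = 0" using det_transpose[OF W] by simp
  then obtain w where w: "w \<in> carrier_vec r" "w \<noteq> 0\<^sub>v r" "transpose_mat W *\<^sub>v w = 0\<^sub>v r"
    using det_0_iff_vec_prod_zero_field[of "transpose_mat W" r] W by auto
  have dep: "(\<Sum>i<r. w $ i * poly (fr i (gpol H (b l))) \<eta>) = 0" if "l < r" for l
  proof -
    have "(transpose_mat W *\<^sub>v w) $ l = (\<Sum>i<r. w $ i * poly (fr i (gpol H (b l))) \<eta>)"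
      using that w(1) W by (auto simp: scalar_prod_def W_def gmat_def atLeast0LessThan intro!: sum.cong)
    then show ?thesis unfolding w(3) using that by simp
  qed
  \<comment> \<open>At \<open>\<eta>\<close> the action of \<open>a\<close> on a torsion point
    multiplies all twists of its generating function by the same factor \<open>a(\<eta>)\<close>; a
    dependency that holds at the generators therefore holds on the whole torsion.\<close>
  have vanish: "(\<Sum>i<r. w $ i * poly (fr i (gpol H x)) \<eta>) = 0" if x: "x \<in> tor H" for x
  proof -
    obtain a where a: "x = (\<Sum>l<r. act (a l) (b l))" using gen[OF x] by blast
    have lin: "poly (fr i (gpol H (act (a l) (b l)))) \<eta> = poly (tp (a l)) \<eta> * poly (fr i (gpol H (b l))) \<eta>"
      if "l < r" for i l
    proof -
      have "fr i (tp H) dvd fr i (tp (a l) * gpol H (b l) - gpol H (act (a l) (b l)))"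
        by (intro fr_dvd gpol_act b that)
      then have "tp H dvd tp (a l) * fr i (gpol H (b l)) - fr i (gpol H (act (a l) (b l)))"
        by (simp add: fr_diff fr_mult)
      then have "poly (tp (a l) * fr i (gpol H (b l)) - fr i (gpol H (act (a l) (b l)))) \<eta> = 0"
        by (metis \<eta> dvdE mult_zero_left poly_mult)
      then show ?thesis by simp
    qed
    have "(\<Sum>i<r. w $ i * poly (fr i (gpol H x)) \<eta>) =
        (\<Sum>i<r. \<Sum>l<r. poly (tp (a l)) \<eta> * (w $ i * poly (fr i (gpol H (b l))) \<eta>))"
      by (simp add: a gpol_sum fr_sum poly_sum lin sum_distrib_left mult_ac)
    also have "\<dots> = (\<Sum>l<r. poly (tp (a l)) \<eta> * (\<Sum>i<r. w $ i * poly (fr i (gpol H (b l))) \<eta>))"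
      by (subst sum.swap) (simp add: sum_distrib_left)
    also have "\<dots> = 0" by (simp add: dep)
    finally show ?thesis .
  qed
  define cf where "cf i j = w $ i * poly (Sh H (Suc j)) \<eta>" for i j
  \<comment> \<open>The dependency as a polynomial in the torsion point; its summand for
    \<open>(i, j)\<close> has degree \<open>q ^ (r * j + i)\<close> whenever its coefficient is
    nonzero.\<close>
  define G where "G = (\<Sum>(i, j)\<in>{..<r} \<times> {..<D}. smult (cf i j) (TH j ^ (CARD('a) ^ i)))"
  have polyG: "poly G x = (\<Sum>i<r. w $ i * poly (fr i (gpol H x)) \<eta>)" for x
    unfolding G_def sum.cartesian_product[symmetric] gpol_def fr_sum fr_smult fr_Sh D_def
    by (simp add: poly_sum poly_TH sum_distrib_left cf_def mult_ac)
  have degt': "degree (smult (cf i j) (TH j ^ (CARD('a) ^ i))) = CARD('a) ^ (r * j + i)"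
    if "cf i j \<noteq> 0" for i j
  proof -
    have "TH j \<noteq> 0" using degree_TH[of j] by auto
    then show ?thesis using that by (simp add: degree_power_eq degree_TH power_add)
  qed
  then have degt: "degree (smult (cf i j) (TH j ^ (CARD('a) ^ i))) \<le> CARD('a) ^ (r * j + i)" for i j
    by (cases "cf i j = 0") auto
  have bound: "r * j + i < r * D" if "i < r" "j < D" for i j
  proof -
    have "r * j + i < r * Suc j" using that by simp
    also have "\<dots> \<le> r * D" using that by (intro mult_le_mono) auto
    finally show ?thesis .
  qed
  have "{i. i < r \<and> w $ i \<noteq> 0} \<noteq> {}"
    using w(1,2) by auto
  \<comment> \<open>As \<open>i < r\<close>, the exponents \<open>r * j + i\<close> are ordered by
    \<open>j\<close> first and \<open>i\<close> second. The top is reached at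
    \<open>j = D - 1\<close>, where \<open>Sh H D = 1\<close> because \<open>H\<close> is monic, and
    at the largest \<open>i\<close> with \<open>w $ i\<close> nonzero.\<close>
  define i0 where "i0 = Max {i. i < r \<and> w $ i \<noteq> 0}"
  have "i0 \<in> {i. i < r \<and> w $ i \<noteq> 0}"
    unfolding i0_def by (intro Max_in) (use \<open>_ \<noteq> {}\<close> in auto)
  then have i0: "i0 < r" "w $ i0 \<noteq> 0" by auto
  have i0_max: "i \<le> i0" if "i < r" "w $ i \<noteq> 0" for i
    unfolding i0_def using that by (intro Max_ge) auto
  have "Sh H D = 1" using Sh_degree[of H] H by (simp add: D_def one_pCons)
  then have cf0: "cf i0 (D - 1) \<noteq> 0" using i0 Dpos by (simp add: cf_def)
  have "degree G = degree (smult (cf i0 (D - 1)) (TH (D - 1) ^ (CARD('a) ^ i0)))"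
    unfolding G_def
  proof (rule trans[OF degree_sum_dominant[where k = "(i0, D - 1)"]])
    fix ij assume ij: "ij \<in> {..<r} \<times> {..<D}" "ij \<noteq> (i0, D - 1)"
    obtain i j where eq: "ij = (i, j)" by (cases ij)
    have i: "i < r" "j < D" using ij eq by auto
    show "degree (case ij of (i, j) \<Rightarrow> smult (cf i j) (TH j ^ (CARD('a) ^ i))) <
        degree (case (i0, D - 1) of (i, j) \<Rightarrow> smult (cf i j) (TH j ^ (CARD('a) ^ i)))"
    proof (cases "cf i j = 0")
      case True
      then show ?thesis unfolding eq prod.case degt'[OF cf0] by simp
    next
      case False
      then have wi: "i \<le> i0" using i0_max i by (simp add: cf_def)
      have "r * j + i < r * (D - 1) + i0"
      proof (cases "j = D - 1")
        case True
        then show ?thesis using ij wi eq by auto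
      next
        case False
        then have "j < D - 1" using i by simp
        then have "r * Suc j \<le> r * (D - 1)" by (intro mult_le_mono) auto
        moreover have "r * j + i < r * Suc j" using i by simp
        ultimately have "r * j + i < r * (D - 1)" by simp
        then show ?thesis by simp
      qed
      then have "CARD('a) ^ (r * j + i) < CARD('a) ^ (r * (D - 1) + i0)"
        using card_field_gt_1[where 'a = 'a] by (intro power_strict_increasing) auto
      then show ?thesis unfolding eq prod.case degt'[OF cf0] by (rule le_less_trans[OF degt])
    qed
  qed (use i0 Dpos in auto)
  then have degG: "degree G = CARD('a) ^ (r * (D - 1) + i0)" unfolding degt'[OF cf0] .
  then have "G \<noteq> 0" by auto
  have "card (tor H) \<le> degree G"
    using vanish polyG by (intro card_roots_le_degree[OF \<open>G \<noteq> 0\<close>]) auto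
  also have "\<dots> < CARD('a) ^ (r * D)"
    unfolding degG using bound[of i0 "D - 1"] i0 Dpos card_field_gt_1[where 'a = 'a]
    by (intro power_strict_increasing) auto
  also have "\<dots> = card (tor H)" using H by (subst card_tor) (auto simp: D_def)
  finally show False by simp
qed

end

subsection \<open>The Tate module\<close>

text \<open>Roots of \<open>p\<close> are split off one at a time; each must be a root of
  \<open>y\<close>. This is what removes the determinant of the solution matrix.\<close>

lemma dvd_mult_cancel_no_common_root:
  fixes p u y :: "'a :: alg_closed_field poly"
  assumes "p \<noteq> 0" "\<And>x. poly p x = 0 \<Longrightarrow> poly u x \<noteq> 0" "p dvd u * y"
  shows "p dvd y"
  using assms
proof (induction "degree p" arbitrary: p y)
  case 0
  then show ?case by (metis is_unit_iff_degree unit_imp_dvd)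
next
  case (Suc n)
  obtain x where x: "poly p x = 0" using alg_closed_imp_poly_has_root[of p] Suc(2) by auto
  then obtain p' where p': "p = [:- x, 1:] * p'" by (metis dvdE poly_eq_0_iff_dvd)
  have nz: "p' \<noteq> 0" using Suc(3) p' by auto
  have deg: "degree p' = n" using Suc(2) nz unfolding p' by (subst (asm) degree_mult_eq) auto
  have "poly (u * y) x = 0" using Suc(5) x by (metis dvd_def mult_zero_left poly_mult)
  then have "poly y x = 0" using Suc(4)[OF x] by simp
  then obtain y' where y': "y = [:- x, 1:] * y'" by (metis dvdE poly_eq_0_iff_dvd)
  have "[:- x, 1:] * p' dvd [:- x, 1:] * (u * y')"
    using Suc(5) unfolding p' y' by (metis mult.left_commute)
  then have "p' dvd u * y'" by (simp only: dvd_mult_cancel_left) auto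
  moreover have "poly u t \<noteq> 0" if "poly p' t = 0" for t
    using Suc(4)[of t] that p' by simp
  ultimately have "p' dvd y'" using Suc(1)[of p' y'] deg nz by auto
  then show ?case unfolding p' y' by (rule mult_dvd_mono[OF dvd_refl])
qed

lemma const_hom: "comm_ring_hom (\<lambda>a :: 'a :: comm_ring_1. [:a:])"
  by unfold_locales (simp_all add: one_pCons)

lemma sum_fun_apply: "(\<Sum>i\<in>A. F i) k = (\<Sum>i\<in>A. F i k)"
  by (induction A rule: infinite_finite_induct) simp_all

lemma prod_const_poly: "(\<Prod>i\<in>A. [:g i:]) = [:\<Prod>i\<in>A. g i:]"
  by (induction A rule: infinite_finite_induct) (simp_all add: one_pCons mult.commute)

lemma monic_primes_dvd_imp_eq:
  fixes f g :: "'a :: field poly"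
  assumes "f \<in> monic_primes" "g \<in> monic_primes" "f dvd g"
  shows "f = g"
proof -
  obtain u where u: "g = f * u" using assms(3) by (elim dvdE)
  have "\<not> f dvd 1" "irreducible g" using assms by (auto simp: monic_primes_def)
  then have "u dvd 1" using irreducibleD[OF _ u] by blast
  then obtain k where k: "u = [:k:]" by (metis is_unit_iff_degree degree_eq_zeroE dvd_0_left_iff zero_neq_one)
  then have "k = 1" using u assms by (auto simp: monic_primes_def lead_coeff_mult)
  then show ?thesis using u k by simp
qed

section \<open>The Floquet determinant of a generating family of torsion points\<close>

context drinfeld_red
begin

lemma tp_hom: "comm_ring_hom tp"
  by (rule comm_ring_hom_map_poly[OF comm_ring_hom_axioms])

text \<open>The sign produced by the row rotation and by the elimination of the extra unknowns in
  \<open>floquet_det\<close>.\<close>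

definition eps :: "'a alg_closure poly poly" where
  "eps = signof (rot_perm d r) * (-1) ^ r"

text \<open>Up to sign the norm of the leading coefficient \<open>c r\<close> from the field
  generated by \<open>\<zeta>\<close> to \<open>F_q\<close>; it arises as the product of the top
  coefficients of the recurrence over one period.\<close>

definition kap :: "'a alg_closure" where
  "kap = (\<Prod>i = 0..<d. - (c r ^ (CARD('a) ^ i)))"

lemma kap_nz: "kap \<noteq> 0"
  using c_r by (auto simp: kap_def)

text \<open>\<open>floquet_det\<close> is applied to the twists of the generating functions of the
  points \<open>b l\<close>: torsion supplies the recurrence, and \<open>gpol_act\<close> turns the
  matrix of Frobenius into a monodromy matrix over \<open>F_q[X]\<close>. The factor
  \<open>det (gmat H b)\<close> has no root in common with \<open>H\<close>, so it cancels.\<close>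

lemma charpoly_cong:
  assumes H: "lead_coeff H = 1" "\<not> f dvd H"
    and b: "\<And>l. l < r \<Longrightarrow> b l \<in> tor H"
    and gen: "\<And>x. x \<in> tor H \<Longrightarrow> \<exists>a. x = (\<Sum>l<r. act (a l) (b l))"
    and N: "\<And>l. l < r \<Longrightarrow> b l ^ (CARD('a) ^ d) = (\<Sum>j<r. act (N j l) (b j))"
  shows "tp H dvd coeff (eps * det (cmat \<zeta> \<phi> d r) - [:[:kap:]:] *
           map_poly tp (char_poly (mat r r (\<lambda>(i, j). N i j)))) n"
proof -
  let ?W = "\<lambda>i l. [:fr i (gpol H (b l)):]" and ?N = "\<lambda>j l. [:tp (N j l):]"
  let ?M = "mat r r (\<lambda>(i, j). N i j)"
  interpret ch: comm_ring_hom "\<lambda>a :: 'a alg_closure poly. [:a:]" by (rule const_hom)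
  have const_dvd: "[:p:] dvd [:u:]" if "p dvd u" for p u :: "'a alg_closure poly"
  proof -
    from that obtain k where "u = p * k" by (elim dvdE)
    then have "[:u:] = [:p:] * [:k:]" by simp
    then show ?thesis by (rule dvdI)
  qed
  have "[:tp H:] dvd det (mat r r (\<lambda>(i, j). ?W i j)) * (eps * det (cmat \<zeta> \<phi> d r) -
      (\<Prod>i = 0..<d. [:tw \<zeta> \<phi> i r:]) * det (mat r r (\<lambda>(i, j). (if i = j then [:0, 1:] else 0) - ?N i j)))"
    unfolding eps_def cmat_def
  proof (rule floquet_det[OF d_pos])
    fix i l assume "l < r"
    have "[:tp H:] dvd [:\<Sum>s\<le>r. tw \<zeta> \<phi> i s * fr (i + s) (gpol H (b l)):]"
      by (intro const_dvd torsion_recurrence b \<open>l < r\<close>)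
    also have "\<dots> = (\<Sum>s\<le>r. [:tw \<zeta> \<phi> i s:] * ?W (i + s) l)"
      by (simp add: sum_to_poly mult.commute)
    finally show "[:tp H:] dvd (\<Sum>s\<le>r. [:tw \<zeta> \<phi> i s:] * ?W (i + s) l)" .
  next
    fix i l assume il: "i < r" "l < r"
    have "tp H dvd (\<Sum>j<r. tp (N j l) * gpol H (b j) - gpol H (act (N j l) (b j)))"
      by (intro dvd_sum gpol_act b) auto
    also have "\<dots> = (\<Sum>j<r. tp (N j l) * gpol H (b j)) - fr d (gpol H (b l))"
      by (simp add: N[OF il(2)] gpol_sum sum_subtractf flip: gpol_power)
    finally have "fr i (tp H) dvd fr i ((\<Sum>j<r. tp (N j l) * gpol H (b j)) - fr d (gpol H (b l)))"
      by (rule fr_dvd)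
    then have "tp H dvd (\<Sum>j<r. tp (N j l) * fr i (gpol H (b j))) - fr (d + i) (gpol H (b l))"
      by (simp add: fr_diff fr_sum fr_mult fr_fr add.commute)
    then have "tp H dvd fr (d + i) (gpol H (b l)) - (\<Sum>j<r. tp (N j l) * fr i (gpol H (b j)))"
      by (subst dvd_diff_commute)
    then have "[:tp H:] dvd [:fr (d + i) (gpol H (b l)) - (\<Sum>j<r. tp (N j l) * fr i (gpol H (b j))):]"
      by (rule const_dvd)
    also have "\<dots> = ?W (d + i) l - (\<Sum>j = 0..<r. ?W i j * ?N j l)"
      by (simp add: sum_to_poly atLeast0LessThan mult.commute)
    finally show "[:tp H:] dvd ?W (d + i) l - (\<Sum>j = 0..<r. ?W i j * ?N j l)" .
  qed
  also have "mat r r (\<lambda>(i, j). ?W i j) = map_mat (\<lambda>a. [:a:]) (gmat H b)"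
    by (rule eq_matI) (auto simp: gmat_def)
  also have "det \<dots> = [:det (gmat H b):]" by (rule ch.hom_det)
  also have "(\<Prod>i = 0..<d. [:tw \<zeta> \<phi> i r:]) = [:[:kap:]:]"
    using r_pos by (simp add: prod_const_poly tw_eq kap_def)
  also have "mat r r (\<lambda>(i, j). (if i = j then [:0, 1:] else 0) - ?N i j) =
      char_poly_matrix (map_mat tp ?M)"
    by (rule eq_matI) (auto simp: char_poly_matrix_def)
  also have "det \<dots> = map_poly tp (char_poly ?M)"
    using comm_ring_hom.char_poly_hom[OF tp_hom, of ?M r] by (simp add: char_poly_def)
  finally have "[:tp H:] dvd [:det (gmat H b):] *
      (eps * det (cmat \<zeta> \<phi> d r) - [:[:kap:]:] * map_poly tp (char_poly ?M))" .
  \<comment> \<open>The modulus and the first factor are constant in \<open>x\<close>, so the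
    divisibility can be read off coefficient by coefficient.\<close>
  then have "tp H dvd det (gmat H b) *
      coeff (eps * det (cmat \<zeta> \<phi> d r) - [:[:kap:]:] * map_poly tp (char_poly ?M)) n"
    by (simp add: const_poly_dvd_iff)
  then show ?thesis
  proof (rule dvd_mult_cancel_no_common_root[rotated 2])
    show "poly (det (gmat H b)) x \<noteq> 0" if "poly (tp H) x = 0" for x
      by (rule det_gmat_nonzero[OF H b gen that])
    show "tp H \<noteq> 0" using H by auto
  qed
qed

end

section \<open>Bases of the Tate module\<close>

locale drinfeld_tate = drinfeld_red f \<phi>
  for f :: "'a :: {field, finite} poly" and \<phi> +
  fixes h :: "'a poly"
  assumes h: "h \<in> monic_primes" and h_neq: "h \<noteq> f"
begin

lemma h_nz: "h \<noteq> 0" and h_irred: "irreducible h" and h_lead: "lead_coeff h = 1"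
  using h by (auto simp: monic_primes_def)

lemma h_deg: "degree h > 0" by (rule monic_primes_degree[OF h])

lemma hk_nz: "h ^ k \<noteq> 0" using h_nz by simp

lemma hk_deg: "degree (h ^ k) = k * degree h" using h_nz by (simp add: degree_power_eq)

lemma hk_lead: "lead_coeff (h ^ k) = 1" using h_lead by (simp add: lead_coeff_power)

lemma hk_dvd: "\<not> f dvd h ^ k"
proof
  assume "f dvd h ^ k"
  then have "ev \<zeta> h = 0" by (simp flip: ev_eq_0_iff)
  then have "f dvd h" by (simp add: ev_eq_0_iff)
  then show False using monic_primes_dvd_imp_eq[OF f h] h_neq by simp
qed

lemma card_tor_hk: "card (tor (h ^ k)) = CARD('a) ^ (r * (k * degree h))"
  using card_tor[OF hk_nz hk_dvd] by (simp add: hk_deg)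

lemma tor_act: "x \<in> tor H \<Longrightarrow> act a x \<in> tor H"
  by (simp add: tor_def act_commute[of H])

lemma tor_sum: "(\<And>i. i \<in> A \<Longrightarrow> g i \<in> tor H) \<Longrightarrow> (\<Sum>i\<in>A. g i) \<in> tor H"
  by (simp add: tor_def act_sum_right)

definition "Tate = tate_module \<phi> f h"

lemma Tate_iff: "x \<in> Tate \<longleftrightarrow> (\<forall>k. x k \<in> tor (h ^ k) \<and> act h (x (Suc k)) = x k)"
  by (simp add: Tate_def tate_module_def tor_def)

lemma Tate_tor: "x \<in> Tate \<Longrightarrow> x k \<in> tor (h ^ k)"
  by (simp add: Tate_iff)

lemma Tate_shift: "x \<in> Tate \<Longrightarrow> act (h ^ n) (x (k + n)) = x k"
proof (induction n)
  case (Suc n)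
  then have "act h (x (Suc (k + n))) = x (k + n)" by (simp add: Tate_iff)
  then show ?case using Suc by (simp add: act_commute[of h] act_mult)
qed simp

text \<open>Levels above \<open>k\<close> come from successive division by \<open>h\<close>,
  possible in an algebraically closed field; levels below \<open>k\<close> are multiples of
  \<open>x\<close>.\<close>

lemma Tate_lift:
  assumes x: "x \<in> tor (h ^ k)"
  obtains y where "y \<in> Tate" "y k = x"
proof -
  define z where "z = rec_nat x (\<lambda>_ u. SOME w. act h w = u)"
  have z0: "z 0 = x" and zS: "act h (z (Suc n)) = z n" for n
  proof -
    show "z 0 = x" by (simp add: z_def)
    have "\<exists>w. act h w = z n" using act_surj[OF h_nz] by metis
    then have "act h (SOME w. act h w = z n) = z n" by (rule someI_ex)
    then show "act h (z (Suc n)) = z n" by (simp add: z_def)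
  qed
  have zn: "z n \<in> tor (h ^ (k + n))" for n
  proof (induction n)
    case (Suc n)
    have "act (h ^ (k + Suc n)) (z (Suc n)) = act (h ^ (k + n)) (act h (z (Suc n)))"
      by (metis act_mult add_Suc_right power_Suc2)
    then show ?case using Suc by (simp add: zS tor_def)
  qed (use x z0 in simp)
  define y where "y l = (if l \<le> k then act (h ^ (k - l)) x else z (l - k))" for l
  have "y \<in> Tate"
    unfolding Tate_iff
  proof (intro allI conjI)
    fix l
    show "y l \<in> tor (h ^ l)"
    proof (cases "l \<le> k")
      case True
      then have "h ^ l * h ^ (k - l) = h ^ k" by (simp flip: power_add)
      then show ?thesis using True x by (simp add: y_def tor_def flip: act_mult)
    next
      case False
      then show ?thesis using zn[of "l - k"] by (simp add: y_def)
    qed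
    show "act h (y (Suc l)) = y l"
    proof (cases "Suc l \<le> k")
      case True
      then have "h * h ^ (k - Suc l) = h ^ (k - l)" by (metis Suc_diff_Suc Suc_le_lessD power_Suc)
      then show ?thesis using True by (simp add: y_def flip: act_mult)
    next
      case False
      then have "Suc l - k = Suc (l - k)" by simp
      then show ?thesis using False zS[of "l - k"] z0 by (auto simp: y_def le_Suc_eq)
    qed
  qed
  then show ?thesis using that[of y] by (simp add: y_def)
qed

lemma adic_iff: "a \<in> adic_integers h \<longleftrightarrow> (\<forall>k. a k = a (Suc k) mod h ^ k)"
  by (simp add: adic_integers_def)

lemma adic_mod:
  assumes "a \<in> adic_integers h"
  shows "a k mod h ^ k = a k"
  using assms by (metis adic_iff mod_mod_trivial)

lemma adic_of_poly: "(\<lambda>k. p mod h ^ k) \<in> adic_integers h"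
  by (simp add: adic_iff mod_mod_cancel le_imp_power_dvd)

lemma act_mod_tor: "x \<in> tor H \<Longrightarrow> act (a mod H) x = act a x"
  by (simp add: tor_def act_mod)

lemma Tate_sum_scale:
  assumes a: "\<And>i. i < m \<Longrightarrow> a i \<in> adic_integers h" and b: "\<And>i. i < m \<Longrightarrow> b i \<in> Tate"
  shows "(\<Sum>i<m. tate_scale \<phi> f (a i) (b i)) \<in> Tate"
  unfolding Tate_iff sum_fun_apply tate_scale_def
proof (intro allI conjI)
  fix k
  show "(\<Sum>i<m. act (a i k) (b i k)) \<in> tor (h ^ k)"
    by (intro tor_sum tor_act Tate_tor b) auto
  have "act h (act (a i (Suc k)) (b i (Suc k))) = act (a i k) (b i k)" if i: "i < m" for i
  proof -
    have "act h (b i (Suc k)) = b i k" using b[OF i] by (simp add: Tate_iff)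
    then have "act h (act (a i (Suc k)) (b i (Suc k))) = act (a i (Suc k)) (b i k)"
      by (subst act_commute) simp
    also have "\<dots> = act (a i (Suc k) mod h ^ k) (b i k)"
      by (rule act_mod_tor[OF Tate_tor[OF b[OF i]], symmetric])
    also have "a i (Suc k) mod h ^ k = a i k" using a[OF i] unfolding adic_iff by metis
    finally show ?thesis .
  qed
  then show "act h (\<Sum>i<m. act (a i (Suc k)) (b i (Suc k))) = (\<Sum>i<m. act (a i k) (b i k))"
    by (simp add: act_sum_right)
qed

lemma Tate_frob:
  assumes "x \<in> Tate"
  shows "tate_frob f x \<in> Tate"
  using assms unfolding Tate_iff tor_def tate_frob_def
  by (simp add: act_power d_def[symmetric] power_0_left)

text \<open>Comparing the number of reduced coefficient vectors with the number of torsion points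
  takes the place of dimension counts over \<open>A / H\<close>.\<close>

definition resv :: "nat \<Rightarrow> 'a poly \<Rightarrow> (nat \<Rightarrow> 'a poly) set" where
  "resv m H = {..<m} \<rightarrow>\<^sub>E polys_below (degree H)"

lemma card_resv: "card (resv m H) = CARD('a) ^ (degree H * m)"
  by (simp add: resv_def card_funcsetE card_polys_below power_mult)

lemma finite_resv: "finite (resv m H)"
  by (simp add: resv_def finite_PiE)

lemma inj_on_resv:
  assumes H: "H \<noteq> 0"
    and indep: "\<And>e i. (\<Sum>i<m. act (e i) (b i)) = 0 \<Longrightarrow> i < m \<Longrightarrow> H dvd e i"
  shows "inj_on (\<lambda>a. \<Sum>i<m. act (a i) (b i)) (resv m H)"
proof (rule inj_onI)
  fix a a'
  assume aa: "a \<in> resv m H" "a' \<in> resv m H" "(\<Sum>i<m. act (a i) (b i)) = (\<Sum>i<m. act (a' i) (b i))"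
  then have "(\<Sum>i<m. act (a i - a' i) (b i)) = 0" by (simp add: act_diff sum_subtractf)
  then have "H dvd a i - a' i" if "i < m" for i by (rule indep[OF _ that])
  then have "a i mod H = a' i mod H" if "i < m" for i using that by (simp add: mod_eq_dvd_iff)
  then have "a i = a' i" if "i < m" for i
    using that aa polys_below_iff_mod[OF H] by (auto simp: resv_def PiE_iff)
  then show "a = a'" using aa unfolding resv_def by (intro PiE_ext) auto
qed

lemma basis_generates:
  assumes fb: "free_basis (adic_integers h) (tate_scale \<phi> f) (tate_module \<phi> f h) m b"
    and x: "x \<in> tor (h ^ k)"
  shows "\<exists>a\<in>resv m (h ^ k). x = (\<Sum>i<m. act (a i) (b i k))"
proof -
  obtain y where y: "y \<in> Tate" "y k = x" using Tate_lift[OF x] .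
  obtain a where a: "a \<in> {..<m} \<rightarrow>\<^sub>E adic_integers h" "y = (\<Sum>i<m. tate_scale \<phi> f (a i) (b i))"
    using fb y(1) unfolding free_basis_def Tate_def by blast
  have "x = (\<Sum>i<m. act (a i k) (b i k))"
    unfolding y(2)[symmetric] by (subst a(2)) (simp add: sum_fun_apply tate_scale_def)
  also have "\<dots> = (\<Sum>i<m. act (restrict (\<lambda>i. a i k) {..<m} i) (b i k))" by simp
  finally show ?thesis
    using a(1) by (intro bexI[of _ "restrict (\<lambda>i. a i k) {..<m}"])
      (auto simp: resv_def polys_below_iff_mod[OF hk_nz] PiE_iff intro!: adic_mod)
qed

text \<open>If the combination \<open>y\<close> with coefficients \<open>e\<close> vanishes at level
  1, moving its levels down by one gives a Tate element \<open>y'\<close> with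
  \<open>y = h y'\<close>. Uniqueness of coordinates identifies those of \<open>y\<close> with
  \<open>h\<close> times those of \<open>y'\<close>, so \<open>e i\<close> vanishes modulo
  \<open>h\<close>.\<close>

lemma basis_independent:
  assumes fb: "free_basis (adic_integers h) (tate_scale \<phi> f) (tate_module \<phi> f h) m b"
    and e: "(\<Sum>i<m. act (e i) (b i 1)) = 0" and i: "i < m"
  shows "h dvd e i"
proof -
  have b: "b i \<in> Tate" if "i < m" for i using fb that by (simp add: free_basis_def Tate_def)
  define y where "y = (\<Sum>i<m. tate_scale \<phi> f (\<lambda>k. e i mod h ^ k) (b i))"
  have yT: "y \<in> Tate" unfolding y_def by (intro Tate_sum_scale adic_of_poly b)
  have y_eq: "y k = (\<Sum>i<m. act (e i) (b i k))" for k
    unfolding y_def sum_fun_apply tate_scale_def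
    by (intro sum.cong refl act_mod_tor Tate_tor b) auto
  define y' where "y' l = y (Suc l)" for l
  have "y' \<in> Tate"
    unfolding Tate_iff
  proof (intro allI conjI)
    fix l
    have "act (h ^ l) (y (1 + l)) = y 1" by (rule Tate_shift[OF yT])
    then show "y' l \<in> tor (h ^ l)" using e by (simp add: y'_def tor_def y_eq)
    show "act h (y' (Suc l)) = y' l" using yT by (simp add: y'_def Tate_iff)
  qed
  then obtain a where a: "a \<in> {..<m} \<rightarrow>\<^sub>E adic_integers h" "y' = (\<Sum>i<m. tate_scale \<phi> f (a i) (b i))"
    using fb unfolding free_basis_def Tate_def by blast
  define C1 where "C1 = restrict (\<lambda>i k. e i mod h ^ k) {..<m}"
  define C2 where "C2 = restrict (\<lambda>i k. (h * a i k) mod h ^ k) {..<m}"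
  have adic2: "(\<lambda>k. (h * a i k) mod h ^ k) \<in> adic_integers h" if "i < m" for i
    unfolding adic_iff
  proof
    fix k
    have "a i \<in> adic_integers h" using a(1) that by auto
    then have "a i k = a i (Suc k) mod h ^ k" unfolding adic_iff by blast
    then show "h * a i k mod h ^ k = h * a i (Suc k) mod h ^ Suc k mod h ^ k"
      by (simp only: mod_mod_cancel le_imp_power_dvd mod_mult_right_eq le_SucI order_refl)
  qed
  have C: "C1 \<in> {..<m} \<rightarrow>\<^sub>E adic_integers h" "C2 \<in> {..<m} \<rightarrow>\<^sub>E adic_integers h"
    using adic2 adic_of_poly by (auto simp: C1_def C2_def)
  have "y = (\<Sum>i<m. tate_scale \<phi> f (C1 i) (b i))" by (simp add: y_def C1_def)
  moreover have "y = (\<Sum>i<m. tate_scale \<phi> f (C2 i) (b i))"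
  proof
    fix k
    have "y k = act h (y' k)" using yT by (simp add: y'_def Tate_iff)
    also have "\<dots> = (\<Sum>i<m. act (h * a i k) (b i k))"
      by (simp add: a(2) sum_fun_apply tate_scale_def act_sum_right act_mult)
    also have "\<dots> = (\<Sum>i<m. tate_scale \<phi> f (C2 i) (b i)) k"
      unfolding sum_fun_apply tate_scale_def C2_def
      by (intro sum.cong refl) (simp add: act_mod_tor[OF Tate_tor[OF b]])
    finally show "y k = (\<Sum>i<m. tate_scale \<phi> f (C2 i) (b i)) k" .
  qed
  ultimately have "C1 = C2" using fb yT C unfolding free_basis_def Tate_def by blast
  then have "C1 i 1 = C2 i 1" by simp
  then have "e i mod h = 0" using i by (simp add: C1_def C2_def)
  then show ?thesis by (simp add: mod_eq_0_iff_dvd)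
qed

text \<open>At level 1 a basis puts the \<open>q ^ (degree h * m)\<close> reduced coefficient
  vectors in bijection with the \<open>q ^ (r * degree h)\<close> points of the
  \<open>h\<close>-torsion.\<close>

lemma basis_size:
  assumes fb: "free_basis (adic_integers h) (tate_scale \<phi> f) (tate_module \<phi> f h) m b"
  shows "m = r"
proof -
  let ?L = "\<lambda>a. \<Sum>i<m. act (a i) (b i 1)"
  have b: "b i \<in> Tate" if "i < m" for i using fb that by (simp add: free_basis_def Tate_def)
  have inj: "inj_on ?L (resv m h)"
    by (rule inj_on_resv[OF h_nz]) (rule basis_independent[OF fb])
  have "?L ` resv m h = tor h"
  proof
    show "?L ` resv m h \<subseteq> tor h"
      using Tate_tor[OF b, of _ 1] by (auto intro!: tor_sum tor_act)
    show "tor h \<subseteq> ?L ` resv m h"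
      using basis_generates[OF fb, of _ 1] by auto
  qed
  then have "card (resv m h) = card (tor h)" using card_image[OF inj] by simp
  then have "CARD('a) ^ (degree h * m) = CARD('a) ^ (r * degree h)"
    using card_tor_hk[of 1] by (simp add: card_resv)
  then have "degree h * m = r * degree h" using card_field_gt_1[where 'a = 'a] by simp
  then show ?thesis using h_deg by simp
qed

text \<open>For \<open>m < r\<close> the span of \<open>m\<close> points has fewer elements than the
  \<open>h\<close>-torsion, so a point \<open>x\<close> outside it can be adjoined. In a relation
  its coefficient is divisible by \<open>h\<close>: otherwise it would be invertible modulo
  \<open>h\<close>, and \<open>x\<close> would lie in the span.\<close>

lemma independent_torsion:
  assumes "m \<le> r"
  shows "\<exists>b. (\<forall>i<m. b i \<in> tor h) \<and> (\<forall>a. (\<Sum>i<m. act (a i) (b i)) = 0 \<longrightarrow> (\<forall>i<m. h dvd a i))"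
  using assms
proof (induction m)
  case (Suc m)
  then obtain b where b: "\<And>i. i < m \<Longrightarrow> b i \<in> tor h"
    "\<And>a i. (\<Sum>i<m. act (a i) (b i)) = 0 \<Longrightarrow> i < m \<Longrightarrow> h dvd a i" by auto
  let ?S = "(\<lambda>a. \<Sum>i<m. act (a i) (b i)) ` resv m h"
  have "card ?S \<le> CARD('a) ^ (degree h * m)"
    using card_image_le[OF finite_resv] by (metis card_resv)
  also have "\<dots> < CARD('a) ^ (degree h * r)"
    using Suc(2) h_deg card_field_gt_1[where 'a = 'a] by (intro power_strict_increasing) auto
  also have "\<dots> = card (tor h)" using card_tor_hk[of 1] by (simp add: mult.commute)
  finally have less: "card ?S < card (tor h)" .
  have "\<not> tor h \<subseteq> ?S"
  proof
    assume "tor h \<subseteq> ?S"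
    then have "card (tor h) \<le> card ?S" by (intro card_mono finite_imageI finite_resv)
    then show False using less by simp
  qed
  then obtain x where x: "x \<in> tor h" "x \<notin> ?S" by auto
  define b' where "b' = b(m := x)"
  show ?case
  proof (intro exI[of _ b'] conjI allI impI)
    show "b' i \<in> tor h" if "i < Suc m" for i using that b(1) x by (auto simp: b'_def)
    fix a i assume a: "(\<Sum>i<Suc m. act (a i) (b' i)) = 0" and i: "i < Suc m"
    have sum: "(\<Sum>i<m. act (a i) (b i)) + act (a m) x = 0"
      using a by (simp add: b'_def)
    have hm: "h dvd a m"
    proof (rule ccontr)
      assume "\<not> h dvd a m"
      then obtain u v where uv: "u * h + v * a m = 1"
        using poly_bezout_irreducible[OF h_irred] by blast
      have "x = act (u * h + v * a m) x" unfolding uv by simp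
      also have "\<dots> = act v (act (a m) x)"
        using x(1) unfolding act_add act_mult by (simp add: tor_def)
      also have "act (a m) x = - (\<Sum>i<m. act (a i) (b i))"
        using sum by (simp add: eq_neg_iff_add_eq_0 add.commute)
      also have "act v \<dots> = (\<Sum>i<m. act (- v * a i) (b i))"
        unfolding act_mult act_uminus by (simp add: act_uminus_right act_sum_right sum_negf)
      also have "\<dots> = (\<Sum>i<m. act (restrict (\<lambda>i. (- v * a i) mod h) {..<m} i) (b i))"
      proof (intro sum.cong refl)
        fix i assume i: "i \<in> {..<m}"
        then have "act ((- v * a i) mod h) (b i) = act (- v * a i) (b i)"
          by (intro act_mod_tor b) simp
        then show "act (- v * a i) (b i) = act (restrict (\<lambda>i. (- v * a i) mod h) {..<m} i) (b i)"
          by (simp only: restrict_apply' i)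
      qed
      finally have x_eq: "x = (\<Sum>i<m. act (restrict (\<lambda>i. (- v * a i) mod h) {..<m} i) (b i))" .
      have "restrict (\<lambda>i. (- v * a i) mod h) {..<m} \<in> resv m h"
        unfolding resv_def by (simp add: restrict_PiE_iff polys_below_iff_mod[OF h_nz])
      then have "x \<in> ?S"
        by (rule image_eqI[where x = "restrict (\<lambda>i. (- v * a i) mod h) {..<m}", rotated]) (rule x_eq)
      then show False using x by simp
    qed
    then have "act (a m) x = 0" using x(1) act_dvd[of h "a m" x] by (simp only: tor_def mem_Collect_eq)
    then have "(\<Sum>i<m. act (a i) (b i)) = 0" using sum by simp
    then show "h dvd a i" using b(2) hm i by (cases "i = m") auto
  qed
qed auto

text \<open>Independent \<open>h\<close>-torsion points are lifted arbitrarily to the Tate module.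
  Independence propagates from level 1 to every level, the torsion count makes each coordinate map
  bijective, and uniqueness makes the coordinates at different levels fit together.\<close>

lemma Tate_basis_exists:
  obtains b where "free_basis (adic_integers h) (tate_scale \<phi> f) (tate_module \<phi> f h) r b"
proof -
  obtain b1 where b1: "\<And>i. i < r \<Longrightarrow> b1 i \<in> tor h"
    "\<And>a i. (\<Sum>i<r. act (a i) (b1 i)) = 0 \<Longrightarrow> i < r \<Longrightarrow> h dvd a i"
    using independent_torsion[of r] by auto
  have "\<exists>y. y \<in> Tate \<and> y 1 = b1 i" if "i < r" for i
    using Tate_lift[of "b1 i" 1] b1(1)[OF that] by auto
  then obtain b where b: "\<And>i. i < r \<Longrightarrow> b i \<in> Tate" "\<And>i. i < r \<Longrightarrow> b i 1 = b1 i" by metis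
  have indep: "h ^ k dvd a i" if "(\<Sum>i<r. act (a i) (b i k)) = 0" "i < r" for k a i
    using that
  proof (induction k arbitrary: a i)
    case (Suc k)
    have hb: "act h (b i (Suc k)) = b i k" if "i < r" for i using b(1)[OF that] by (simp add: Tate_iff)
    have "act h (\<Sum>i<r. act (a i) (b i (Suc k))) = 0" using Suc by simp
    then have "(\<Sum>i<r. act (a i) (b i k)) = 0"
      by (simp add: act_sum_right act_commute[of h] hb)
    then have "\<forall>i. i < r \<longrightarrow> (\<exists>e. a i = h ^ k * e)" using Suc(1)[of a] by (auto simp: dvd_def)
    then obtain e where e: "\<And>i. i < r \<Longrightarrow> a i = h ^ k * e i" by metis
    \<comment> \<open>With \<open>a i = h ^ k * e i\<close> the relation at level
      \<open>Suc k\<close> collapses to a relation with coefficients \<open>e i\<close> at level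
      1.\<close>
    have "act (h ^ k) (b i (Suc k)) = b1 i" if "i < r" for i
      using Tate_shift[OF b(1)[OF that], of k 1] b(2)[OF that] by simp
    then have "(\<Sum>i<r. act (a i) (b i (Suc k))) = (\<Sum>i<r. act (e i) (b1 i))"
      by (intro sum.cong refl) (simp add: e mult.commute[of "h ^ k"] act_mult)
    then have "h dvd e i" using b1(2)[of e] Suc by simp
    then show ?case using e[OF Suc(3)] by (simp add: mult.commute)
  qed simp
  have bij: "bij_betw (\<lambda>a. \<Sum>i<r. act (a i) (b i k)) (resv r (h ^ k)) (tor (h ^ k))" for k
  proof -
    let ?L = "\<lambda>a. \<Sum>i<r. act (a i) (b i k)"
    have inj: "inj_on ?L (resv r (h ^ k))"
      by (rule inj_on_resv[OF hk_nz]) (rule indep)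
    have sub: "?L ` resv r (h ^ k) \<subseteq> tor (h ^ k)"
      using Tate_tor[OF b(1)] by (auto intro!: tor_sum tor_act)
    have "card (?L ` resv r (h ^ k)) = card (tor (h ^ k))"
      by (simp add: card_image[OF inj] card_resv card_tor_hk hk_deg mult_ac)
    then have "?L ` resv r (h ^ k) = tor (h ^ k)"
      using card_subset_eq[OF finite_tor[OF hk_nz hk_dvd] sub] by simp
    then show ?thesis using inj by (simp add: bij_betw_def)
  qed
  have "\<exists>!a. a \<in> {..<r} \<rightarrow>\<^sub>E adic_integers h \<and> y = (\<Sum>i<r. tate_scale \<phi> f (a i) (b i))"
    if y: "y \<in> Tate" for y
  proof (rule ex_ex1I)
    have "\<exists>a. a \<in> resv r (h ^ k) \<and> y k = (\<Sum>i<r. act (a i) (b i k))" for k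
    proof -
      have "y k \<in> (\<lambda>a. \<Sum>i<r. act (a i) (b i k)) ` resv r (h ^ k)"
        using bij[of k] Tate_tor[OF y, of k] unfolding bij_betw_def by simp
      then show ?thesis by blast
    qed
    then have "\<forall>k. \<exists>a. a \<in> resv r (h ^ k) \<and> y k = (\<Sum>i<r. act (a i) (b i k))" by blast
    from choice[OF this] obtain A where A: "\<And>k. A k \<in> resv r (h ^ k)"
      "\<And>k. y k = (\<Sum>i<r. act (A k i) (b i k))" by blast
    define a where "a = restrict (\<lambda>i k. A k i) {..<r}"
    \<comment> \<open>Multiplying the expansion at level \<open>Suc k\<close> by \<open>h\<close>
      gives an expansion at level \<open>k\<close>, whose reduced coefficients must be
      \<open>A k\<close>.\<close>
    have compat: "A k i = A (Suc k) i mod h ^ k" if "i < r" for i k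
    proof -
      define A' where "A' = restrict (\<lambda>i. A (Suc k) i mod h ^ k) {..<r}"
      have A': "A' \<in> resv r (h ^ k)"
        by (auto simp: A'_def resv_def polys_below_iff_mod[OF hk_nz])
      have "(\<Sum>i<r. act (A' i) (b i k)) = (\<Sum>i<r. act h (act (A (Suc k) i) (b i (Suc k))))"
      proof (intro sum.cong refl)
        fix i assume i: "i \<in> {..<r}"
        then have "act h (b i (Suc k)) = b i k" using b(1) by (simp add: Tate_iff)
        then show "act (A' i) (b i k) = act h (act (A (Suc k) i) (b i (Suc k)))"
          using i by (simp add: A'_def act_mod_tor[OF Tate_tor[OF b(1)]] act_commute[of h])
      qed
      also have "\<dots> = act h (y (Suc k))" by (simp add: A(2) act_sum_right)
      also have "\<dots> = y k" using y by (simp add: Tate_iff)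
      finally have "A' = A k"
        using bij[of k] A' A by (auto simp: bij_betw_def dest: inj_onD)
      then show ?thesis using that by (metis A'_def lessThan_iff restrict_apply')
    qed
    have "a \<in> {..<r} \<rightarrow>\<^sub>E adic_integers h"
    proof
      fix i assume i: "i \<in> {..<r}"
      then have "i < r" by simp
      then have cc: "\<forall>k. A k i = A (Suc k) i mod h ^ k" by (intro allI compat)
      have ai: "a i = (\<lambda>k. A k i)" using i by (simp add: a_def)
      show "a i \<in> adic_integers h" unfolding adic_iff ai by (rule cc)
    qed (simp add: a_def)
    moreover have "y = (\<Sum>i<r. tate_scale \<phi> f (a i) (b i))"
      by (rule ext) (simp add: sum_fun_apply tate_scale_def a_def A(2))
    ultimately show "\<exists>a. a \<in> {..<r} \<rightarrow>\<^sub>E adic_integers h \<and> y = (\<Sum>i<r. tate_scale \<phi> f (a i) (b i))"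
      by blast
  next
    fix a a'
    assume a: "a \<in> {..<r} \<rightarrow>\<^sub>E adic_integers h \<and> y = (\<Sum>i<r. tate_scale \<phi> f (a i) (b i))"
      and a': "a' \<in> {..<r} \<rightarrow>\<^sub>E adic_integers h \<and> y = (\<Sum>i<r. tate_scale \<phi> f (a' i) (b i))"
    have "a i k = a' i k" if i: "i < r" for i k
    proof -
      have "(\<Sum>i<r. tate_scale \<phi> f (a i) (b i)) k = (\<Sum>i<r. tate_scale \<phi> f (a' i) (b i)) k"
        using a a' by simp
      then have "(\<Sum>i<r. act (a i k - a' i k) (b i k)) = 0"
        by (simp add: sum_fun_apply tate_scale_def act_diff sum_subtractf)
      then have "h ^ k dvd a i k - a' i k" by (rule indep[OF _ i])
      then have "a i k mod h ^ k = a' i k mod h ^ k" by (simp add: mod_eq_dvd_iff)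
      moreover have "a i \<in> adic_integers h" "a' i \<in> adic_integers h"
        using a[THEN conjunct1] a'[THEN conjunct1] i by auto
      ultimately show ?thesis by (simp only: adic_mod)
    qed
    then show "a = a'"
      by (intro PiE_ext[OF a[THEN conjunct1] a'[THEN conjunct1]] ext) simp
  qed
  then show ?thesis using that[of b] b(1) by (simp add: free_basis_def Tate_def)
qed

end

subsection \<open>The Frobenius polynomial as a determinant\<close>

text \<open>At \<open>x = 0\<close> no term that wraps around survives, so the matrix is upper
  triangular. For \<open>cmat\<close> the diagonal consists of the \<open>X - th i\<close>, which is
  how \<open>f\<close> becomes the constant term.\<close>

lemma det_cyc_mat_0:
  fixes a :: "nat \<Rightarrow> nat \<Rightarrow> 'r :: idom"
  shows "det (cyc_mat d r a 0) = (\<Prod>i = 0..<d. a i 0)"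
proof -
  have entry: "cyc_mat d r a 0 $$ (i, j) = (\<Sum>s\<le>r. if i + s = j then a i s else 0)"
    if "i < d" "j < d" for i j
  proof -
    have "(if (i + s) mod d = j then a i s * 0 ^ ((i + s) div d) else 0) =
        (if i + s = j then a i s else 0)" for s
      using that by (cases "i + s < d") (auto simp: power_0_left div_eq_0_iff)
    then show ?thesis using that by (simp add: cyc_mat_def)
  qed
  have "det (cyc_mat d r a 0) = prod_list (diag_mat (cyc_mat d r a 0))"
  proof (rule det_upper_triangular[where n = d])
    show "upper_triangular (cyc_mat d r a 0)"
    proof (rule upper_triangularI)
      fix i j assume ij: "j < i" "i < dim_row (cyc_mat d r a 0)"
      then have "i < d" by (simp add: cyc_mat_def)
      then show "cyc_mat d r a 0 $$ (i, j) = 0"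
        using ij entry[of i j] by (auto intro!: sum.neutral)
    qed
  qed simp
  also have "\<dots> = (\<Prod>i = 0..<d. cyc_mat d r a 0 $$ (i, i))"
    by (simp add: prod_list_diag_prod cyc_mat_def)
  also have "\<dots> = (\<Prod>i = 0..<d. a i 0)"
    by (intro prod.cong refl) (simp add: entry sum.delta)
  finally show ?thesis .
qed

text \<open>
  \<open>X\<close> has weight \<open>R\<close> and \<open>x\<close> has weight \<open>d\<close> in \<open>B[X][x]\<close>. Bounding the weight of the cyclic
  determinant yields the analogue of the Riemann hypothesis for the Frobenius polynomial.
\<close>

definition wt_le :: "nat \<Rightarrow> nat \<Rightarrow> 'b :: idom poly poly \<Rightarrow> int \<Rightarrow> bool" where
  "wt_le R d p w \<longleftrightarrow>
     (\<forall>n m. coeff (coeff p n) m \<noteq> 0 \<longrightarrow> int R * int m + int d * int n \<le> w)"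

lemma wt_le_0 [simp]: "wt_le R d 0 w"
  by (simp add: wt_le_def)

lemma wt_le_add: "wt_le R d p w \<Longrightarrow> wt_le R d p' w \<Longrightarrow> wt_le R d (p + p') w"
  unfolding wt_le_def by (metis add_0 coeff_add)

lemma wt_le_uminus: "wt_le R d p w \<Longrightarrow> wt_le R d (- p) w"
  by (simp add: wt_le_def)

lemma wt_le_sum: "(\<And>i. i \<in> A \<Longrightarrow> wt_le R d (g i) w) \<Longrightarrow> wt_le R d (\<Sum>i\<in>A. g i) w"
  by (induction A rule: infinite_finite_induct) (auto intro: wt_le_add)

lemma wt_le_1 [simp]: "wt_le R d 1 0"
  by (auto simp: wt_le_def one_pCons coeff_pCons split: nat.splits)

lemma wt_le_mult:
  assumes "wt_le R d p w" "wt_le R d p' w'"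
  shows "wt_le R d (p * p') (w + w')"
  unfolding wt_le_def
proof (intro allI impI)
  fix n m
  assume nz: "coeff (coeff (p * p') n) m \<noteq> 0"
  have "coeff (coeff (p * p') n) m =
      (\<Sum>i\<le>n. \<Sum>j\<le>m. coeff (coeff p i) j * coeff (coeff p' (n - i)) (m - j))"
    by (simp add: coeff_mult coeff_sum)
  then obtain i where i: "i \<le> n" "(\<Sum>j\<le>m. coeff (coeff p i) j * coeff (coeff p' (n - i)) (m - j)) \<noteq> 0"
    using nz by (metis (no_types, lifting) atMost_iff sum.neutral)
  then obtain j where j: "j \<le> m" "coeff (coeff p i) j * coeff (coeff p' (n - i)) (m - j) \<noteq> 0"
    by (metis (no_types, lifting) atMost_iff sum.neutral)
  then have "int R * int j + int d * int i \<le> w" "int R * int (m - j) + int d * int (n - i) \<le> w'"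
    using assms unfolding wt_le_def by (metis mult_zero_left, metis mult_zero_right)
  then have "int R * (int j + int (m - j)) + int d * (int i + int (n - i)) \<le> w + w'"
    by (simp add: ring_distribs)
  then show "int R * int m + int d * int n \<le> w + w'" using i(1) j(1) by (simp flip: of_nat_add)
qed

lemma wt_le_prod:
  assumes "finite A" "\<And>i. i \<in> A \<Longrightarrow> wt_le R d (g i) (w i)"
  shows "wt_le R d (\<Prod>i\<in>A. g i) (\<Sum>i\<in>A. w i)"
  using assms by (induction A rule: finite_induct) (auto intro!: wt_le_mult)

text \<open>The shifts \<open>i - j\<close> in the entry weights cancel over each permutation. They
  can make a single bound negative, hence integers rather than natural numbers.\<close>

lemma wt_le_det:
  assumes M: "M \<in> carrier_mat d d"
    and wt: "\<And>i j. i < d \<Longrightarrow> j < d \<Longrightarrow> wt_le R d (M $$ (i, j)) (int R + int i - int j)"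
  shows "wt_le R d (det M) (int R * int d)"
  unfolding det_def'[OF M]
proof (intro wt_le_sum)
  fix p assume p: "p \<in> {p. p permutes {0..<d}}"
  have "wt_le R d (\<Prod>i = 0..<d. M $$ (i, p i)) (\<Sum>i = 0..<d. int R + int i - int (p i))"
    using p by (intro wt_le_prod wt) (auto dest: permutes_in_image)
  also have "(\<Sum>i = 0..<d. int R + int i - int (p i)) =
      int R * int d + (\<Sum>i = 0..<d. int i) - (\<Sum>i = 0..<d. int (p i))"
    by (simp add: sum.distrib sum_subtractf mult.commute)
  also have "(\<Sum>i = 0..<d. int (p i)) = (\<Sum>i = 0..<d. int i)"
    using sum.permute[of p "{0..<d}" int] p by simp
  finally have "wt_le R d (\<Prod>i = 0..<d. M $$ (i, p i)) (int R * int d)" by simp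
  then show "wt_le R d (signof p * (\<Prod>i = 0..<d. M $$ (i, p i))) (int R * int d)"
    by (cases p rule: sign_cases) (auto intro: wt_le_uminus)
qed

context fq_ext
begin

text \<open>The term of index \<open>s\<close> in entry \<open>(i, j)\<close> carries
  \<open>x ^ e\<close> with \<open>d * e = i + s - j\<close>, and only \<open>s = 0\<close>
  contributes \<open>X\<close>. As \<open>s \<le> r \<le> R\<close>, its weight is at most
  \<open>R + i - j\<close>.\<close>

lemma wt_le_det_cmat:
  assumes "r \<le> R"
  shows "wt_le R d (det (cmat \<zeta> \<phi> d r)) (int R * int d)"
proof (rule wt_le_det)
  fix i j assume ij: "i < d" "j < d"
  have "wt_le R d (if (i + s) mod d = j then [:tw \<zeta> \<phi> i s:] * [:0, 1:] ^ ((i + s) div d) else 0)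
      (int R + int i - int j)" if s: "s \<le> r" for s
  proof (cases "(i + s) mod d = j")
    case True
    have "i + s = d * ((i + s) div d) + j" using True by (metis mult_div_mod_eq)
    then have eq: "int d * int ((i + s) div d) = int i + int s - int j"
      by (metis add_diff_cancel_right' of_nat_add of_nat_mult)
    have "[:tw \<zeta> \<phi> i s:] * [:0, 1:] ^ ((i + s) div d) = monom (tw \<zeta> \<phi> i s) ((i + s) div d)"
      by (simp add: monom_altdef)
    moreover have "wt_le R d (monom (tw \<zeta> \<phi> i s) ((i + s) div d)) (int R + int i - int j)"
      unfolding wt_le_def
    proof (intro allI impI)
      fix n m assume nz: "coeff (coeff (monom (tw \<zeta> \<phi> i s) ((i + s) div d)) n) m \<noteq> 0"
      then have n: "n = (i + s) div d" and m: "coeff (tw \<zeta> \<phi> i s) m \<noteq> 0"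
        by (auto split: if_splits)
      show "int R * int m + int d * int n \<le> int R + int i - int j"
      proof (cases "s = 0")
        case s0: True
        then have "m \<le> 1" using m by (auto simp: tw_def coeff_pCons split: nat.splits if_splits)
        then have "int R * int m \<le> int R" by (metis mult.right_neutral mult_left_mono of_nat_0_le_iff of_nat_1 of_nat_le_iff)
        then show ?thesis unfolding n eq using s0 by simp
      next
        case False
        then have "m = 0" using m by (auto simp: tw_def coeff_pCons split: nat.splits if_splits)
        then show ?thesis unfolding n using eq s assms by simp
      qed
    qed
    ultimately show ?thesis using True by simp
  qed simp
  then show "wt_le R d (cmat \<zeta> \<phi> d r $$ (i, j)) (int R + int i - int j)"
    using ij by (auto simp: cmat_def cyc_mat_def intro!: wt_le_sum)
qed (simp add: cmat_def)

end

text \<open>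
  The determinant is computed with \<open>\<theta>\<close> as an indeterminate; its value at a root of \<open>f\<close> then only
  depends on its class modulo \<open>f\<close>.
\<close>

definition gen_tw :: "'a :: {field, finite} poly poly \<Rightarrow> nat \<Rightarrow> nat \<Rightarrow> 'a poly poly" where
  "gen_tw \<phi> i s = (if s = 0 then [:0, 1:] else 0) - [:pcompose (coeff \<phi> s) (monom 1 (CARD('a) ^ i)):]"

definition gen_det :: "'a :: {field, finite} poly poly \<Rightarrow> nat \<Rightarrow> nat \<Rightarrow> 'a poly poly poly" where
  "gen_det \<phi> d r = det (cyc_mat d r (\<lambda>i s. [:gen_tw \<phi> i s:]) [:0, 1:])"

lemma (in fq_ext) ev_pcompose_monom:
  "ev \<zeta> (pcompose a (monom 1 n)) = ev (\<zeta> ^ n) a"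
  by (simp add: ev_def map_poly_pcompose poly_pcompose poly_monom)

lemma (in fq_ext) det_cmat_gen:
  "det (cmat \<zeta> \<phi> d r) = map_poly (map_poly (ev \<zeta>)) (gen_det \<phi> d r)"
proof -
  have 1: "comm_ring_hom (map_poly (ev \<zeta>))" by (rule comm_ring_hom_map_poly[OF ev_hom])
  have 2: "comm_ring_hom (map_poly (map_poly (ev \<zeta>)))" by (rule comm_ring_hom_map_poly[OF 1])
  have 3: "map_poly (ev \<zeta>) (gen_tw \<phi> i s) = tw \<zeta> \<phi> i s" for i s
    by (rule poly_eqI) (auto simp: gen_tw_def tw_def coeff_map_poly coeff_pCons ev_pcompose_monom
        split: nat.splits)
  have 4: "map_poly (map_poly (ev \<zeta>)) [:g:] = [:map_poly (ev \<zeta>) g:]" for g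
    by (rule poly_eqI) (auto simp: coeff_map_poly coeff_pCons split: nat.splits)
  have 5: "map_poly (map_poly (ev \<zeta>)) [:0, 1:] = [:0, 1:]"
    by (rule poly_eqI) (auto simp: coeff_map_poly coeff_pCons map_poly_1' split: nat.splits)
  have "cmat \<zeta> \<phi> d r = map_mat (map_poly (map_poly (ev \<zeta>))) (cyc_mat d r (\<lambda>i s. [:gen_tw \<phi> i s:]) [:0, 1:])"
    unfolding comm_ring_hom.map_mat_cyc_mat[OF 2] cmat_def
    by (simp only: 3 4 5)
  then show ?thesis by (simp add: gen_det_def comm_ring_hom.hom_det[OF 2])
qed

text \<open>Each coefficient of the determinant is the value at the chosen root of a polynomial over
  \<open>F_q\<close> that does not depend on the extension field. Congruence to a constant modulo
  \<open>f\<close> is detected at any root of \<open>f\<close>, so a result over the closure of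
  \<open>F_q\<close> carries over to the closure of the rational function field.\<close>

lemma det_cmat_transfer:
  assumes "fq_ext_root e1 f \<zeta>1" "fq_ext_root e2 f \<zeta>2"
    and a: "\<And>n. coeff (det (fq_ext.cmat e1 \<zeta>1 \<phi> d r)) n = map_poly e1 (a n)"
  shows "coeff (det (fq_ext.cmat e2 \<zeta>2 \<phi> d r)) n = map_poly e2 (a n)"
proof (rule poly_eqI)
  fix m
  interpret E1: fq_ext_root e1 f \<zeta>1 by fact
  interpret E2: fq_ext_root e2 f \<zeta>2 by fact
  let ?g = "coeff (coeff (gen_det \<phi> d r) n) m"
  have "coeff (coeff (det (E1.cmat \<zeta>1 \<phi> d r)) n) m = E1.ev \<zeta>1 ?g"
    by (simp add: E1.det_cmat_gen coeff_map_poly)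
  then have "E1.ev \<zeta>1 (?g - [:coeff (a n) m:]) = 0" by (simp add: a)
  then have "f dvd ?g - [:coeff (a n) m:]" by (simp only: E1.ev_eq_0_iff)
  then have "E2.ev \<zeta>2 (?g - [:coeff (a n) m:]) = 0" by (simp only: E2.ev_eq_0_iff)
  then show "coeff (coeff (det (E2.cmat \<zeta>2 \<phi> d r)) n) m = coeff (map_poly e2 (a n)) m"
    by (simp add: E2.det_cmat_gen coeff_map_poly)
qed

context fq_ext_root
begin

lemma poly_det_cmat_0: 
  assumes "coeff \<phi> 0 = [:0, 1:]"
  shows "coeff (det (cmat \<zeta> \<phi> d r)) 0 = map_poly e f"
proof -
  have "coeff (det (cmat \<zeta> \<phi> d r)) 0 = poly (det (cmat \<zeta> \<phi> d r)) 0" by (simp add: poly_0_coeff_0)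
  also have "\<dots> = det (map_mat (\<lambda>p. poly p 0) (cmat \<zeta> \<phi> d r))"
    by (rule comm_ring_hom.hom_det[OF poly_hom.comm_ring_hom_axioms, symmetric])
  also have "\<dots> = det (cyc_mat d r (tw \<zeta> \<phi>) 0)"
    unfolding cmat_def comm_ring_hom.map_mat_cyc_mat[OF poly_hom.comm_ring_hom_axioms] by simp
  also have "\<dots> = (\<Prod>i = 0..<d. tw \<zeta> \<phi> i 0)" by (rule det_cyc_mat_0)
  also have "\<dots> = (\<Prod>i<d. [:- th i, 1:])"
    by (auto simp: tw_def assms ev_def th_def map_poly_pCons_hom atLeast0LessThan intro!: prod.cong)
  finally show ?thesis by (simp add: f_eq_prod)
qed

end

text \<open>Ensures that the quantifier over primes other than \<open>f\<close> in
  \<open>frob_charpoly\<close> is not vacuous, so that it determines a polynomial.\<close>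

lemma monic_primes_other:
  fixes f :: "'a :: field poly"
  obtains h where "h \<in> monic_primes" "h \<noteq> f"
proof -
  have "[:c, 1:] \<in> monic_primes" for c :: 'a
    by (auto simp: monic_primes_def intro!: irreducible_linear_field_poly)
  moreover have "[:0, 1:] \<noteq> ([:1, 1:] :: 'a poly)" by simp
  ultimately show ?thesis using that by metis
qed

lemma dvd_all_powers_imp_0:
  fixes h y :: "'a :: field poly"
  assumes "degree h > 0" "\<And>k. h ^ k dvd y"
  shows "y = 0"
proof (rule ccontr)
  assume "y \<noteq> 0"
  then have "degree (h ^ Suc (degree y)) \<le> degree y" by (intro dvd_imp_degree_le assms)
  moreover have "h \<noteq> 0" using assms(1) by auto
  then have "degree (h ^ Suc (degree y)) = Suc (degree y) * degree h"
    by (simp add: degree_power_eq del: power_Suc)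
  ultimately have "Suc (degree y) * degree h \<le> degree y" by (simp only:)
  moreover have "Suc (degree y) * 1 \<le> Suc (degree y) * degree h"
    using assms(1) by (intro mult_le_mono) auto
  ultimately show False by simp
qed

section \<open>Independence of the auxiliary prime and the constant c(f)\<close>

context drinfeld_red
begin

lemma eps_cases: "eps = 1 \<or> eps = -1"
  unfolding eps_def by (cases "rot_perm d r" rule: sign_cases; cases "even r") auto

text \<open>A characterisation of the Frobenius polynomial in which the auxiliary prime
  \<open>h\<close> does not occur; the definite description in \<open>frob_charpoly\<close> is
  resolved through it.\<close>

definition frob_eq :: "'a poly poly \<Rightarrow> bool" where
  "frob_eq P \<longleftrightarrow> eps * det (cmat \<zeta> \<phi> d r) = [:[:kap:]:] * map_poly tp P"

end

context drinfeld_tate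
begin

lemma level_cong:
  assumes fb: "free_basis (adic_integers h) (tate_scale \<phi> f) (tate_module \<phi> f h) r b"
    and rep: "represents (adic_integers h) (tate_scale \<phi> f) r b (tate_frob f) N"
  shows "tp (h ^ k) dvd coeff (eps * det (cmat \<zeta> \<phi> d r) - [:[:kap:]:] *
           map_poly tp (char_poly (mat r r (\<lambda>(i, j). N i j k)))) n"
proof (rule charpoly_cong[OF hk_lead hk_dvd])
  have b: "b i \<in> Tate" if "i < r" for i using fb that by (simp add: free_basis_def Tate_def)
  show "b l k \<in> tor (h ^ k)" if "l < r" for l by (rule Tate_tor[OF b[OF that]])
  show "\<exists>a. x = (\<Sum>l<r. act (a l) (b l k))" if "x \<in> tor (h ^ k)" for x
    using basis_generates[OF fb that] by blast
  show "b l k ^ (CARD('a) ^ d) = (\<Sum>j<r. act (N j l k) (b j k))" if "l < r" for l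
  proof -
    have "tate_frob f (b l) = (\<Sum>i<r. tate_scale \<phi> f (N i l) (b i))"
      using rep that by (simp add: represents_def)
    then have "tate_frob f (b l) k = (\<Sum>i<r. tate_scale \<phi> f (N i l) (b i)) k" by simp
    then show ?thesis by (simp add: tate_frob_def sum_fun_apply tate_scale_def d_def)
  qed
qed

lemma represents_exists:
  assumes fb: "free_basis (adic_integers h) (tate_scale \<phi> f) (tate_module \<phi> f h) m b"
  obtains N where "represents (adic_integers h) (tate_scale \<phi> f) m b (tate_frob f) N"
proof -
  have "\<exists>c. c \<in> {..<m} \<rightarrow>\<^sub>E adic_integers h \<and>
      tate_frob f (b j) = (\<Sum>i<m. tate_scale \<phi> f (c i) (b i))" if "j < m" for j
    using fb Tate_frob[of "b j"] that unfolding free_basis_def Tate_def by blast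
  then obtain c where "\<And>j. j < m \<Longrightarrow> c j \<in> {..<m} \<rightarrow>\<^sub>E adic_integers h"
    "\<And>j. j < m \<Longrightarrow> tate_frob f (b j) = (\<Sum>i<m. tate_scale \<phi> f (c j i) (b i))" by metis
  then show ?thesis using that[of "\<lambda>i j. c j i"] by (auto simp: represents_def)
qed

lemma tp_dvd_iff: "tp a dvd tp b \<longleftrightarrow> a dvd b"
proof
  assume "a dvd b"
  then show "tp a dvd tp b" by (auto simp: dvd_def hom_distribs)
qed (rule dvd_map_poly_hom_imp_dvd)

lemma frob_charpoly_cong_iff:
  fixes Q P :: "'a poly poly"
  assumes "tp H dvd coeff (eps * det (cmat \<zeta> \<phi> d r) - [:[:kap:]:] * map_poly tp Q) n"
  shows "H dvd coeff (Q - P) n \<longleftrightarrow> tp H dvd coeff (eps * det (cmat \<zeta> \<phi> d r) - [:[:kap:]:] * map_poly tp P) n"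
proof -
  have "coeff (eps * det (cmat \<zeta> \<phi> d r) - [:[:kap:]:] * map_poly tp P) n =
      coeff (eps * det (cmat \<zeta> \<phi> d r) - [:[:kap:]:] * map_poly tp Q) n + smult kap (tp (coeff (Q - P) n))"
    by (simp add: coeff_map_poly hom_distribs smult_diff_right)
  then have "tp H dvd coeff (eps * det (cmat \<zeta> \<phi> d r) - [:[:kap:]:] * map_poly tp P) n \<longleftrightarrow>
      tp H dvd smult kap (tp (coeff (Q - P) n))"
    using assms by (simp only: dvd_add_right_iff)
  then show ?thesis using kap_nz tp_dvd_iff by (simp add: dvd_smult_iff)
qed

text \<open>In any basis the characteristic polynomial of the matrix of Frobenius satisfies the
  equation modulo every \<open>h ^ k\<close>, by \<open>level_cong\<close>. For a fixed
  \<open>P\<close> these congruences force equality, since a nonzero polynomial is divisible by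
  finitely many powers of \<open>h\<close> only; conversely the equation gives back the
  congruences.\<close>

lemma is_frob_charpoly_iff: "is_frob_charpoly \<phi> f h P \<longleftrightarrow> frob_eq P"
proof
  assume "is_frob_charpoly \<phi> f h P"
  then obtain m b N where fb: "free_basis (adic_integers h) (tate_scale \<phi> f) (tate_module \<phi> f h) m b"
    and rep: "represents (adic_integers h) (tate_scale \<phi> f) m b (tate_frob f) N"
    and cong: "\<And>k l. h ^ k dvd coeff (char_poly (mat m m (\<lambda>(i, j). N i j k)) - P) l"
    unfolding is_frob_charpoly_def by blast
  have m: "m = r" by (rule basis_size[OF fb])
  note fb = fb[unfolded m] and rep = rep[unfolded m] and cong = cong[unfolded m]
  have "coeff (eps * det (cmat \<zeta> \<phi> d r) - [:[:kap:]:] * map_poly tp P) n = 0" for n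
  proof (rule dvd_all_powers_imp_0[of "tp h"])
    show "degree (tp h) > 0" using h_deg by simp
    show "tp h ^ k dvd coeff (eps * det (cmat \<zeta> \<phi> d r) - [:[:kap:]:] * map_poly tp P) n" for k
      using frob_charpoly_cong_iff[OF level_cong[OF fb rep, of k n], of P] cong
      by (simp add: hom_distribs)
  qed
  then have "eps * det (cmat \<zeta> \<phi> d r) - [:[:kap:]:] * map_poly tp P = 0" by (metis leading_coeff_0_iff)
  then show "frob_eq P" by (simp add: frob_eq_def)
next
  assume P: "frob_eq P"
  obtain b where fb: "free_basis (adic_integers h) (tate_scale \<phi> f) (tate_module \<phi> f h) r b"
    by (rule Tate_basis_exists)
  obtain N where rep: "represents (adic_integers h) (tate_scale \<phi> f) r b (tate_frob f) N"
    by (rule represents_exists[OF fb])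
  show "is_frob_charpoly \<phi> f h P"
    unfolding is_frob_charpoly_def
  proof (intro exI conjI allI)
    fix k n
    show "h ^ k dvd coeff (char_poly (mat r r (\<lambda>(i, j). N i j k)) - P) n"
      using frob_charpoly_cong_iff[OF level_cong[OF fb rep, of k n], of P] P
      by (simp add: frob_eq_def)
  qed (fact fb rep)+
qed

text \<open>The point is rationality, as the determinant has coefficients in the closure. Modulo
  \<open>h ^ k\<close> each coefficient in \<open>x\<close> is \<open>kap\<close> times a polynomial
  over \<open>F_q\<close>; once \<open>h ^ k\<close> has large degree, the reduced representative is
  the polynomial itself.\<close>

lemma frob_eq_exists: "\<exists>P. frob_eq P"
proof -
  obtain b where fb: "free_basis (adic_integers h) (tate_scale \<phi> f) (tate_module \<phi> f h) r b"
    by (rule Tate_basis_exists)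
  obtain N where rep: "represents (adic_integers h) (tate_scale \<phi> f) r b (tate_frob f) N"
    by (rule represents_exists[OF fb])
  have rat: "\<exists>a. coeff (eps * det (cmat \<zeta> \<phi> d r)) n = smult kap (tp a)" for n
  proof -
    define y where "y = smult (inverse kap) (coeff (eps * det (cmat \<zeta> \<phi> d r)) n)"
    \<comment> \<open>Large enough for \<open>degree y < degree (h ^ k)\<close>, because
      \<open>degree h > 0\<close>.\<close>
    define k where "k = Suc (degree y)"
    define u where "u = coeff (char_poly (mat r r (\<lambda>(i, j). N i j k))) n"
    have "tp (h ^ k) dvd coeff (eps * det (cmat \<zeta> \<phi> d r)) n - smult kap (tp u)"
      using level_cong[OF fb rep, of k n] by (simp add: u_def coeff_map_poly)
    then have "tp (h ^ k) dvd smult (inverse kap) (coeff (eps * det (cmat \<zeta> \<phi> d r)) n - smult kap (tp u))"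
      by (rule dvd_smult)
    then have "tp (h ^ k) dvd y - tp u" using kap_nz by (simp add: y_def smult_diff_right)
    moreover have "tp (h ^ k) dvd tp u - tp (u mod h ^ k)"
      using tp_dvd_iff[of "h ^ k" "u - u mod h ^ k"] by (simp add: hom_distribs flip: mod_eq_dvd_iff)
    ultimately have "tp (h ^ k) dvd (y - tp u) + (tp u - tp (u mod h ^ k))" by (rule dvd_add)
    then have dvd: "tp (h ^ k) dvd y - tp (u mod h ^ k)" by simp
    have "y - tp (u mod h ^ k) = 0"
    proof (rule ccontr)
      assume nz: "y - tp (u mod h ^ k) \<noteq> 0"
      have "k * 1 \<le> k * degree h" using h_deg by (intro mult_le_mono) auto
      moreover have "degree y < k" by (simp add: k_def)
      ultimately have yk: "degree y < degree (h ^ k)" unfolding hk_deg by linarith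
      have "degree (u mod h ^ k) < degree (h ^ k)"
        using degree_mod_less[OF hk_nz, of u k] yk by auto
      then have "degree (y - tp (u mod h ^ k)) < degree (h ^ k)"
        using yk by (intro degree_diff_less) simp_all
      moreover have "degree (tp (h ^ k)) \<le> degree (y - tp (u mod h ^ k))"
        by (rule dvd_imp_degree_le[OF dvd nz])
      ultimately show False by simp
    qed
    then have "smult kap y = smult kap (tp (u mod h ^ k))" by simp
    then show ?thesis using kap_nz by (auto simp: y_def)
  qed
  then obtain a where a: "\<And>n. coeff (eps * det (cmat \<zeta> \<phi> d r)) n = smult kap (tp (a n))" by metis
  define P where "P = (\<Sum>n\<le>degree (eps * det (cmat \<zeta> \<phi> d r)). monom (a n) n)"
  have "coeff P n = a n" for n
  proof (cases "n \<le> degree (eps * det (cmat \<zeta> \<phi> d r))")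
    case False
    then have "smult kap (tp (a n)) = 0" using a[of n] by (simp add: coeff_eq_0)
    then show ?thesis using False kap_nz by (simp add: P_def coeff_sum)
  qed (simp add: P_def coeff_sum)
  then have "eps * det (cmat \<zeta> \<phi> d r) = [:[:kap:]:] * map_poly tp P"
    by (intro poly_eqI) (simp add: a coeff_map_poly)
  then show ?thesis unfolding frob_eq_def by blast
qed

end

context drinfeld_red
begin

lemma frob_eq_frob_charpoly: "frob_eq (frob_charpoly \<phi> f)"
proof -
  obtain h where h: "h \<in> monic_primes" "h \<noteq> f" by (rule monic_primes_other)
  have tate: "drinfeld_tate f \<phi> h'" if "h' \<in> monic_primes - {f}" for h'
    using that by unfold_locales auto
  obtain P where P: "frob_eq P" using drinfeld_tate.frob_eq_exists[OF tate[of h]] h by auto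
  have "frob_charpoly \<phi> f = P"
    unfolding frob_charpoly_def
  proof (rule the_equality)
    show "\<forall>h\<in>monic_primes - {f}. is_frob_charpoly \<phi> f h P"
      using P drinfeld_tate.is_frob_charpoly_iff[OF tate] by blast
    fix P' assume "\<forall>h\<in>monic_primes - {f}. is_frob_charpoly \<phi> f h P'"
    then have "frob_eq P'" using drinfeld_tate.is_frob_charpoly_iff[OF tate, of h] h by blast
    then have eq: "[:[:kap:]:] * map_poly tp P' = [:[:kap:]:] * map_poly tp P"
      using P by (simp add: frob_eq_def)
    show "P' = P"
    proof (rule poly_eqI)
      fix n
      have "coeff ([:[:kap:]:] * map_poly tp P') n = coeff ([:[:kap:]:] * map_poly tp P) n"
        using eq by simp
      then have "smult kap (tp (coeff P' n)) = smult kap (tp (coeff P n))" by (simp add: coeff_map_poly)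
      then have "smult (inverse kap) (smult kap (tp (coeff P' n))) =
          smult (inverse kap) (smult kap (tp (coeff P n)))" by (rule arg_cong)
      then show "coeff P' n = coeff P n" using kap_nz by simp
    qed
  qed
  then show ?thesis using P by simp
qed

text \<open>\<open>frob_eq\<close> makes the determinant a scalar multiple of the Frobenius
  polynomial, the scalar \<open>k\<close> lying in the closure. The constant coefficient of the
  determinant is the monic \<open>f\<close>; this places \<open>k\<close> in \<open>F_q\<close> and
  identifies it with \<open>c(f)\<close>.\<close>

lemma coeff_det_cmat:
  "coeff (det (cmat \<zeta> \<phi> d r)) n = tp (smult (frob_const \<phi> f) (coeff (frob_charpoly \<phi> f) n))"
proof -
  let ?P = "frob_charpoly \<phi> f"
  obtain k where k: "k \<noteq> 0" "\<And>n. coeff (det (cmat \<zeta> \<phi> d r)) n = smult k (tp (coeff ?P n))"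
  proof -
    have "eps * (eps * det (cmat \<zeta> \<phi> d r)) = eps * ([:[:kap:]:] * map_poly tp ?P)"
      using frob_eq_frob_charpoly by (simp add: frob_eq_def)
    then have "det (cmat \<zeta> \<phi> d r) = eps * ([:[:kap:]:] * map_poly tp ?P)" using eps_cases by auto
    then have "coeff (det (cmat \<zeta> \<phi> d r)) n = smult (if eps = 1 then kap else - kap) (tp (coeff ?P n))" for n
      using eps_cases by (auto simp: coeff_map_poly)
    then show ?thesis using that[of "if eps = 1 then kap else - kap"] kap_nz by auto
  qed
  have p0: "smult k (tp (coeff ?P 0)) = tp f"
    using k(2)[of 0] poly_det_cmat_0[OF phi_0, of r] by simp
  define u where "u = lead_coeff (coeff ?P 0)"
  have "lead_coeff (smult k (tp (coeff ?P 0))) = 1"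
    unfolding p0 using f_monic by simp
  then have ku: "k * to_ac u = 1" using k(1) by (simp add: u_def)
  then have u: "u \<noteq> 0" by auto
  have k_eq: "k = to_ac (inverse u)"
    using ku u by (simp add: inverse_unique mult.commute)
  have "tp (smult (inverse u) (coeff ?P 0)) = tp f"
    using p0 by (simp add: k_eq hom_distribs)
  then have uf: "smult (inverse u) (coeff ?P 0) = f" by simp
  have "coeff ?P 0 = smult u (smult (inverse u) (coeff ?P 0))" using u by simp
  then have P0: "coeff ?P 0 = smult u f" unfolding uf .
  have "frob_const \<phi> f = inverse u"
    unfolding frob_const_def
  proof (rule the_equality)
    show "inverse u \<noteq> 0 \<and> coeff ?P 0 = smult (inverse (inverse u)) f" using u P0 by simp
    fix c' assume c': "c' \<noteq> 0 \<and> coeff ?P 0 = smult (inverse c') f"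
    then have "lead_coeff (smult (inverse c') f) = lead_coeff (smult u f)" using P0 by metis
    then have "inverse c' = u" using f_monic c' u by simp
    then show "c' = inverse u" by auto
  qed
  then show ?thesis using k(2)[of n] by (simp add: k_eq hom_distribs)
qed

end

subsection \<open>The module \<open>\<psi>(A/f)\<close>\<close>

text \<open>If \<open>n > m\<close>, padding \<open>B\<close> with zero rows gives a singular square
  matrix; a vector in its kernel is killed by \<open>B\<close>, contradicting
  \<open>A * B = 1\<close>.\<close>

lemma right_inverse_dim_le:
  fixes A B :: "'k :: field mat"
  assumes A: "A \<in> carrier_mat n m" and B: "B \<in> carrier_mat m n" and AB: "A * B = 1\<^sub>m n"
  shows "n \<le> m"
proof (rule ccontr)
  assume "\<not> n \<le> m"
  define B' where "B' = mat n n (\<lambda>(i, j). if i < m then B $$ (i, j) else 0)"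
  have B': "B' \<in> carrier_mat n n" by (simp add: B'_def)
  have "det (transpose_mat B') = 0"
  proof -
    have "transpose_mat B' *\<^sub>v unit_vec n (n - 1) = 0\<^sub>v n"
    proof (rule eq_vecI)
      fix i assume "i < dim_vec (0\<^sub>v n :: 'k vec)"
      then have i: "i < n" by simp
      then have "(transpose_mat B' *\<^sub>v unit_vec n (n - 1)) $ i = transpose_mat B' $$ (i, n - 1)"
        using B' by simp
      also have "\<dots> = 0" using i \<open>\<not> n \<le> m\<close> by (simp add: B'_def)
      finally show "(transpose_mat B' *\<^sub>v unit_vec n (n - 1)) $ i = 0\<^sub>v n $ i" using i by simp
    qed (simp add: B'_def)
    moreover have "unit_vec n (n - 1) \<noteq> (0\<^sub>v n :: 'k vec)"
      using \<open>\<not> n \<le> m\<close> by (intro unit_vec_nonzero) auto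
    ultimately show ?thesis
      using B' by (subst det_0_iff_vec_prod_zero_field[of _ n]) (auto intro!: exI[of _ "unit_vec n (n - 1)"])
  qed
  then have "det B' = 0" using det_transpose[OF B'] by simp
  then obtain v where v: "v \<in> carrier_vec n" "v \<noteq> 0\<^sub>v n" "B' *\<^sub>v v = 0\<^sub>v n"
    using det_0_iff_vec_prod_zero_field[OF B'] by auto
  have "B *\<^sub>v v = 0\<^sub>v m"
  proof (rule eq_vecI)
    fix i assume "i < dim_vec (0\<^sub>v m :: 'k vec)"
    then have i: "i < m" by simp
    then have "(B *\<^sub>v v) $ i = (B' *\<^sub>v v) $ i"
      using B v(1) \<open>\<not> n \<le> m\<close> by (auto simp: B'_def scalar_prod_def intro!: sum.cong)
    then show "(B *\<^sub>v v) $ i = 0\<^sub>v m $ i" using i v(3) \<open>\<not> n \<le> m\<close> by simp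
  qed (use B in auto)
  then have "A *\<^sub>v (B *\<^sub>v v) = 0\<^sub>v n" using A by (auto intro!: eq_vecI)
  then have "(A * B) *\<^sub>v v = 0\<^sub>v n" using A B v(1) by (simp add: assoc_mult_mat_vec)
  then show False using AB v(1,2) by simp
qed

lemma field_hom_map_poly_inj:
  assumes "field_hom h" and eq: "map_poly h p = map_poly h p'"
  shows "p = p'"
proof (rule poly_eqI)
  interpret field_hom h by fact
  fix n
  have "coeff (map_poly h p) n = coeff (map_poly h p') n" by (simp only: eq)
  then show "coeff p n = coeff p' n" by simp
qed

lemma polys_below_eq_sum:
  fixes g :: "'a :: field poly"
  assumes "g \<in> polys_below n"
  shows "g = (\<Sum>i<n. smult (coeff g i) (monom 1 i))"
  using assms by (intro poly_eqI) (auto simp: coeff_sum polys_below_def smult_monom)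

lemma coeff_sum_monom_below:
  fixes c :: "nat \<Rightarrow> 'a :: field"
  shows "coeff (\<Sum>i<n. smult (c i) (monom 1 i)) j = (if j < n then c j else 0)"
  by (simp add: coeff_sum smult_monom)

text \<open>The coordinates \<open>E\<close> take values in an extension field, so they need not
  come from a basis over \<open>k\<close>; but for every basis the matrix of their values
  intertwines the matrix of \<open>T\<close> with \<open>\<Psi>\<close>. Covering every basis at
  once shows that the definite description is well defined and computes it.\<close>

lemma module_det_coordinates:
  fixes T :: "'k :: field poly \<Rightarrow> 'k poly" and \<iota> :: "'k \<Rightarrow> 'e :: field"
  assumes \<iota>: "field_hom \<iota>"
    and E_sum: "\<And>i (m :: nat) c g. i < d \<Longrightarrow> E i (\<Sum>j<m. smult (c j) (g j)) = (\<Sum>j<m. \<iota> (c j) * E i (g j))"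
    and det: "det (mat d d (\<lambda>(i, j). E i (monom 1 j))) \<noteq> 0"
    and TV: "\<And>g. g \<in> polys_below d \<Longrightarrow> T g \<in> polys_below d"
    and ET: "\<And>i g. i < d \<Longrightarrow> g \<in> polys_below d \<Longrightarrow> E i (T g) = (\<Sum>j<d. \<Psi> $$ (i, j) * E j g)"
    and \<Psi>: "\<Psi> \<in> carrier_mat d d"
  shows "map_poly \<iota> (module_det smult (polys_below d) T) = char_poly \<Psi>"
proof -
  interpret field_hom \<iota> by (rule \<iota>)
  have all: "map_poly \<iota> (char_poly (mat m m (\<lambda>(i, j). N i j))) = char_poly \<Psi>"
    if fb: "free_basis UNIV smult (polys_below d) m b" and rep: "represents UNIV smult m b T N"
    for m b N
  proof -
    have b: "b j \<in> polys_below d" if "j < m" for j using fb that by (simp add: free_basis_def)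
    have ex: "\<exists>c. g = (\<Sum>i<m. smult (c i) (b i))" if "g \<in> polys_below d" for g
      using fb that unfolding free_basis_def by blast
    have unique: "c i = c' i"
      if "(\<Sum>i<m. smult (c i) (b i)) = (\<Sum>i<m. smult (c' i) (b i))" "i < m" for c c' i
    proof -
      have "(\<Sum>i<m. smult (c i) (b i)) \<in> polys_below d"
        using b by (auto simp: polys_below_def coeff_sum)
      then have "\<exists>!u. u \<in> {..<m} \<rightarrow>\<^sub>E UNIV \<and> (\<Sum>i<m. smult (c i) (b i)) = (\<Sum>i<m. smult (u i) (b i))"
        using fb unfolding free_basis_def by blast
      moreover have "(\<Sum>i<m. smult (c i) (b i)) = (\<Sum>i<m. smult (restrict c {..<m} i) (b i))"
        "(\<Sum>i<m. smult (c i) (b i)) = (\<Sum>i<m. smult (restrict c' {..<m} i) (b i))"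
        using that(1) by simp_all
      moreover have "restrict c {..<m} \<in> {..<m} \<rightarrow>\<^sub>E UNIV" "restrict c' {..<m} \<in> {..<m} \<rightarrow>\<^sub>E UNIV"
        by (auto simp: restrict_PiE_iff)
      ultimately have eq: "restrict c {..<m} = restrict c' {..<m}" by blast
      have "restrict c {..<m} i = restrict c' {..<m} i" unfolding eq ..
      then show ?thesis using that(2) by (simp only: restrict_apply' lessThan_iff)
    qed
    have "\<exists>c. monom 1 j = (\<Sum>i<m. smult (c i) (b i))" if "j < d" for j
      by (rule ex) (use that in \<open>simp add: polys_below_def\<close>)
    then have "\<forall>j. \<exists>c. j < d \<longrightarrow> monom 1 j = (\<Sum>i<m. smult (c i) (b i))" by blast
    from choice[OF this] obtain Qt where
      Qt: "\<forall>j. j < d \<longrightarrow> monom 1 j = (\<Sum>i<m. smult (Qt j i) (b i))" ..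
    define Q where "Q i j = Qt j i" for i j
    have Q: "monom 1 j = (\<Sum>i<m. smult (Q i j) (b i))" if "j < d" for j
      using Qt that unfolding Q_def by blast
    \<comment> \<open>\<open>C\<close> and \<open>Q'\<close> pass between the given basis and the
      monomials; being inverse to each other in both orders, they force
      \<open>m = d\<close>.\<close>
    define C where "C = mat d m (\<lambda>(i, j). coeff (b j) i)"
    define Q' where "Q' = mat m d (\<lambda>(i, j). Q i j)"
    have CQ: "C * Q' = 1\<^sub>m d"
    proof (rule eq_matI)
      fix i j assume "i < dim_row (1\<^sub>m d :: 'k mat)" "j < dim_col (1\<^sub>m d :: 'k mat)"
      then have ij: "i < d" "j < d" by auto
      then have "(C * Q') $$ (i, j) = (\<Sum>k<m. coeff (b k) i * Q k j)"
        by (auto simp: C_def Q'_def scalar_prod_def atLeast0LessThan intro!: sum.cong)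
      also have "\<dots> = coeff (monom 1 j) i"
        by (subst Q[OF ij(2)]) (simp add: coeff_sum mult.commute)
      finally show "(C * Q') $$ (i, j) = 1\<^sub>m d $$ (i, j)" using ij by simp
    qed (auto simp: C_def Q'_def)
    have QC: "Q' * C = 1\<^sub>m m"
    proof (rule eq_matI)
      fix i j assume "i < dim_row (1\<^sub>m m :: 'k mat)" "j < dim_col (1\<^sub>m m :: 'k mat)"
      then have ij: "i < m" "j < m" by auto
      have "(\<Sum>k<m. smult (\<Sum>l<d. Q k l * coeff (b j) l) (b k)) =
          (\<Sum>l<d. smult (coeff (b j) l) (\<Sum>k<m. smult (Q k l) (b k)))"
        by (simp add: smult_sum smult_sum2 mult.commute) (rule sum.swap)
      also have "\<dots> = (\<Sum>l<d. smult (coeff (b j) l) (monom 1 l))"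
        by (intro sum.cong refl) (simp add: Q)
      also have "\<dots> = b j" by (rule polys_below_eq_sum[OF b[OF ij(2)], symmetric])
      also have "\<dots> = (\<Sum>k<m. if k = j then b k else 0)"
        using ij by simp
      also have "\<dots> = (\<Sum>k<m. smult (if k = j then 1 else 0) (b k))"
        by (intro sum.cong) auto
      finally have "(\<Sum>l<d. Q i l * coeff (b j) l) = (if i = j then 1 else 0)"
        by (rule unique[OF _ ij(1)])
      then show "(Q' * C) $$ (i, j) = 1\<^sub>m m $$ (i, j)"
        using ij by (simp add: C_def Q'_def scalar_prod_def atLeast0LessThan)
    qed (auto simp: C_def Q'_def)
    have "d \<le> m" by (rule right_inverse_dim_le[OF _ _ CQ]) (auto simp: C_def Q'_def)
    moreover have "m \<le> d" by (rule right_inverse_dim_le[OF _ _ QC]) (auto simp: C_def Q'_def)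
    ultimately have m: "m = d" by simp
    define V where "V = mat d d (\<lambda>(i, j). E i (b j))"
    define S where "S = mat d d (\<lambda>(i, j). E i (monom 1 j))"
    define N' where "N' = mat d d (\<lambda>(i, j). N i j)"
    have car: "V \<in> carrier_mat d d" "S \<in> carrier_mat d d" "N' \<in> carrier_mat d d" "Q' \<in> carrier_mat d d"
      by (auto simp: V_def S_def N'_def Q'_def m)
    have "S = V * map_mat \<iota> Q'"
    proof (rule eq_matI)
      fix i j assume "i < dim_row (V * map_mat \<iota> Q')" "j < dim_col (V * map_mat \<iota> Q')"
      then have ij: "i < d" "j < d" using car by auto
      have "S $$ (i, j) = (\<Sum>k<d. \<iota> (Q k j) * E i (b k))"
        using ij E_sum[of i "\<lambda>k. Q k j" b m] Q[of j] by (simp add: S_def m)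
      also have "\<dots> = (V * map_mat \<iota> Q') $$ (i, j)"
        using ij by (auto simp: V_def Q'_def m scalar_prod_def atLeast0LessThan mult.commute intro!: sum.cong)
      finally show "S $$ (i, j) = (V * map_mat \<iota> Q') $$ (i, j)" .
    qed (use car in auto)
    then have "det S = det V * det (map_mat \<iota> Q')" using car by (simp add: det_mult[of _ d])
    then have detV: "det V \<noteq> 0" using det by (auto simp: S_def)
    have VN: "V * map_mat \<iota> N' = \<Psi> * V"
    proof (rule eq_matI)
      fix i j assume "i < dim_row (\<Psi> * V)" "j < dim_col (\<Psi> * V)"
      then have ij: "i < d" "j < d" using car \<Psi> by auto
      have "(V * map_mat \<iota> N') $$ (i, j) = (\<Sum>k<d. \<iota> (N k j) * E i (b k))"
        using ij by (auto simp: V_def N'_def scalar_prod_def atLeast0LessThan mult.commute intro!: sum.cong)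
      also have "\<dots> = E i (T (b j))"
        using rep ij E_sum[of i "\<lambda>k. N k j" b m] by (simp add: represents_def m)
      also have "\<dots> = (\<Sum>k<d. \<Psi> $$ (i, k) * E k (b j))" using ij b by (intro ET) (auto simp: m)
      also have "\<dots> = (\<Psi> * V) $$ (i, j)"
        using ij \<Psi> by (auto simp: V_def scalar_prod_def atLeast0LessThan intro!: sum.cong)
      finally show "(V * map_mat \<iota> N') $$ (i, j) = (\<Psi> * V) $$ (i, j)" .
    qed (use car \<Psi> in auto)
    obtain U where U: "U \<in> carrier_mat d d" "U * V = 1\<^sub>m d" "V * U = 1\<^sub>m d"
      using det_non_zero_imp_unit[OF car(1) detV] by (auto simp: Units_def ring_mat_simps)
    have "map_mat \<iota> N' = U * (V * map_mat \<iota> N')"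
      using U car by (simp flip: assoc_mult_mat[OF U(1) car(1)])
    also have "\<dots> = U * \<Psi> * V" unfolding VN using U car \<Psi> by (simp add: assoc_mult_mat[OF U(1) \<Psi> car(1)])
    finally have "similar_mat (map_mat \<iota> N') \<Psi>"
      unfolding similar_mat_def similar_mat_wit_def Let_def
      using U car \<Psi> by (intro exI[of _ U] exI[of _ V]) auto
    then have "char_poly (map_mat \<iota> N') = char_poly \<Psi>" by (rule char_poly_similar)
    then show ?thesis using char_poly_hom[OF car(3)] by (simp add: N'_def m)
  qed
  have fb: "free_basis UNIV smult (polys_below d :: 'k poly set) d (\<lambda>i. monom 1 i)"
    unfolding free_basis_def
  proof (intro conjI ballI allI impI)
    fix g :: "'k poly" assume g: "g \<in> polys_below d"
    show "\<exists>!c. c \<in> {..<d} \<rightarrow>\<^sub>E UNIV \<and> g = (\<Sum>i<d. smult (c i) (monom 1 i))"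
    proof (rule ex1I[of _ "restrict (coeff g) {..<d}"])
      show "restrict (coeff g) {..<d} \<in> {..<d} \<rightarrow>\<^sub>E UNIV \<and>
          g = (\<Sum>i<d. smult (restrict (coeff g) {..<d} i) (monom 1 i))"
        using polys_below_eq_sum[OF g] by simp
      fix c assume c: "c \<in> {..<d} \<rightarrow>\<^sub>E UNIV \<and> g = (\<Sum>i<d. smult (c i) (monom 1 i))"
      then have "coeff g j = (if j < d then c j else 0)" for j
        using coeff_sum_monom_below[of c d j] by simp
      then show "c = restrict (coeff g) {..<d}"
        using c by (intro ext) (auto simp: PiE_def extensional_def)
    qed
  qed (simp add: polys_below_def)
  have rep: "represents UNIV smult d (\<lambda>i. monom 1 i) T (\<lambda>i j. coeff (T (monom 1 j)) i)"
    unfolding represents_def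
    by (auto intro!: polys_below_eq_sum TV simp: polys_below_def)
  have inj: "p = p'" if "map_poly \<iota> p = map_poly \<iota> p'" for p p' :: "'k poly"
    using that by (rule field_hom_map_poly_inj[OF \<iota>])
  let ?p = "char_poly (mat d d (\<lambda>(i, j). coeff (T (monom 1 j)) i))"
  have "module_det smult (polys_below d) T = ?p"
    unfolding module_det_def
  proof (rule the_equality)
    show "\<exists>m b N. free_basis UNIV smult (polys_below d) m b \<and> represents UNIV smult m b T N \<and>
        ?p = char_poly (mat m m (\<lambda>(i, j). N i j))"
      using fb rep by blast
    fix p assume "\<exists>m b N. free_basis UNIV smult (polys_below d) m b \<and> represents UNIV smult m b T N \<and>
        p = char_poly (mat m m (\<lambda>(i, j). N i j))"
    then have "map_poly \<iota> p = char_poly \<Psi>" using all by blast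
    then show "p = ?p" using all[OF fb rep] by (intro inj) simp
  qed
  then show ?thesis using all[OF fb rep] by simp
qed

section \<open>Rational functions and evaluation at the indeterminates\<close>

lemma comm_ring_hom_prod:
  assumes "comm_ring_hom h"
  shows "h (\<Prod>j\<in>A. g j) = (\<Prod>j\<in>A. h (g j))"
  by (induction A rule: infinite_finite_induct)
     (simp_all add: comm_ring_homD(3,6)[OF assms])

lemma field_hom_rf_const: "field_hom (rf_const :: 'a :: field \<Rightarrow> ('a, 'v :: linorder) ratfun)"
  by unfold_locales (simp_all add: rf_const_def single_add mult_single flip: to_fract_add to_fract_mult)

lemma field_hom_to_ac: "field_hom (to_ac :: 'a :: field \<Rightarrow> 'a alg_closure)"
  by unfold_locales simp_all

lemma A_eval_eq_to_fract:
  fixes a :: "'a :: field poly" and w :: "'v :: linorder"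
  shows "A_eval a (rf_var w) =
     to_fract (\<Sum>i\<le>degree a. Poly_Mapping.single (Poly_Mapping.single w i) (coeff a i))"
proof -
  interpret rc: field_hom "rf_const :: 'a \<Rightarrow> ('a, 'v) ratfun" by (rule field_hom_rf_const)
  have pow: "(rf_var w :: ('a, 'v) ratfun) ^ i =
      to_fract (Poly_Mapping.single (Poly_Mapping.single w i) 1)" for i
    by (induction i) (simp_all add: rf_var_def mult_single flip: to_fract_mult single_add)
  show ?thesis
    by (simp add: A_eval_def A_emb_def poly_altdef pow rf_const_def mult_single
        flip: to_fract_mult hom_distribs)
qed

text \<open>An indeterminate is transcendental over \<open>F_q\<close>: its power of exponent
  \<open>degree a\<close> occurs with the leading coefficient of \<open>a\<close>.\<close>

lemma A_eval_nonzero: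
  assumes "a \<noteq> 0"
  shows "A_eval a (rf_var w :: ('a :: field, 'v :: linorder) ratfun) \<noteq> 0"
proof -
  let ?p = "\<Sum>i\<le>degree a. Poly_Mapping.single (Poly_Mapping.single w i) (coeff a i)"
  have "Poly_Mapping.single w i = Poly_Mapping.single w j \<longleftrightarrow> i = j" for i j :: nat
    by (metis lookup_single_eq)
  then have "Poly_Mapping.lookup ?p (Poly_Mapping.single w (degree a)) = lead_coeff a"
    by (simp add: lookup_sum lookup_single when_def)
  then have "?p \<noteq> 0" using assms by (metis leading_coeff_0_iff lookup_zero)
  then show ?thesis by (simp only: A_eval_eq_to_fract to_fract_eq_0_iff not_False_eq_True)
qed

lemma rf_var_nonzero: "(rf_var w :: ('a :: field, 'v :: linorder) ratfun) \<noteq> 0"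
  by (simp add: rf_var_def) (metis lookup_single_eq lookup_zero zero_neq_one)

text \<open>\<open>r\<close> will be the reduction rank, so that the recurrence here has the same
  order as the one solved by torsion points.\<close>

locale psi_root =
  fq_ext_root "\<lambda>a. to_ac (rf_const a :: ('a :: {field, finite}, 'v :: linorder) ratfun)" f \<zeta>
  for f :: "'a :: {field, finite} poly" and \<zeta> :: "('a, 'v :: linorder) ratfun alg_closure" +
  fixes \<phi> :: "'a poly poly" and n :: nat and v :: "nat \<Rightarrow> 'v" and r :: nat
  assumes r_le: "r \<le> degree \<phi>" and r_max: "\<And>s. s > r \<Longrightarrow> f dvd coeff \<phi> s"
begin

abbreviation "\<iota> \<equiv> (to_ac :: ('a, 'v) ratfun \<Rightarrow> ('a, 'v) ratfun alg_closure)"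
abbreviation "emb \<equiv> (A_emb :: 'a poly \<Rightarrow> ('a, 'v) ratfun poly)"
abbreviation "zv k \<equiv> (rf_var (v k) :: ('a, 'v) ratfun)"

lemma map_iota_emb: "map_poly \<iota> (emb a) = map_poly (\<lambda>a. \<iota> (rf_const a)) a"
  unfolding A_emb_def
  by (rule poly_eqI) (simp add: coeff_map_poly field_hom.axioms[OF field_hom_rf_const] rf_const_def)

lemma poly_emb: "poly (map_poly \<iota> (emb a)) y = ev y a"
  by (simp add: ev_def map_iota_emb)

lemma degree_emb: "degree (emb a) = degree a"
proof -
  interpret rc: field_hom "rf_const :: 'a \<Rightarrow> ('a, 'v) ratfun" by (rule field_hom_rf_const)
  show ?thesis by (simp add: A_emb_def)
qed

lemma emb_f_nz: "emb f \<noteq> 0"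
  using degree_emb[of f] d_pos by (auto simp: d_def)

lemma quot_space_eq: "(quot_space f :: ('a, 'v) ratfun poly set) = polys_below d"
proof -
  have "x \<in> quot_space f \<longleftrightarrow> x mod emb f = x" for x
    by (auto simp: quot_space_def intro: range_eqI[of _ _ x])
  then show ?thesis
    using polys_below_iff_mod[OF emb_f_nz] by (auto simp: degree_emb d_def)
qed

text \<open>
  With \<open>u\<close> the multiplier of \<open>\<sigma> = t \<ell>\<^sub>1(z\<^sub>1) \<dots> \<ell>\<^sub>1(z\<^sub>n) \<tau>\<close>, one has \<open>\<psi>\<^sub>\<theta> = \<phi>\<^sub>\<theta>(\<sigma>)\<close> modulo \<open>f\<close>. The weights
  \<open>w\<close> turn \<open>\<sigma>\<close> into a shift of sequences with \<open>y\<^sub>i\<^sub>+\<^sub>d = Z y\<^sub>i\<close>.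
\<close>

definition u :: "nat \<Rightarrow> ('a, 'v) ratfun alg_closure" where
  "u j = \<iota> (zv 0) * (\<Prod>k = 1..n. \<iota> (zv k) - th j)"

definition w :: "nat \<Rightarrow> ('a, 'v) ratfun alg_closure" where
  "w i = (\<Prod>j<i. u j)"

definition Z :: "('a, 'v) ratfun" where
  "Z = (\<Prod>k = 1..n. A_eval f (zv k)) * zv 0 ^ d"

lemma iota_A_eval: "\<iota> (A_eval a z) = poly (map_poly (\<lambda>a. \<iota> (rf_const a)) a) (\<iota> z)"
proof -
  interpret ih: field_hom \<iota> by (rule field_hom_to_ac)
  show ?thesis by (simp add: A_eval_def flip: map_iota_emb)
qed

lemma prod_th: "(\<Prod>j<d. y - th j) = poly (map_poly (\<lambda>a. \<iota> (rf_const a)) f) y"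
  by (simp add: f_eq_prod poly_prod)

text \<open>Over a full period the factors \<open>z_k - th j\<close> multiply to
  \<open>f(z_k)\<close>, so the total multiplier lies in the rational function field although single
  multipliers need not.\<close>

lemma w_d: "w d = \<iota> Z"
proof -
  have "w d = \<iota> (zv 0) ^ d * (\<Prod>k = 1..n. \<Prod>j<d. \<iota> (zv k) - th j)"
    unfolding w_def u_def prod.distrib by (simp add: prod.swap[of _ "{..<d}"])
  also have "\<dots> = \<iota> Z" unfolding prod_th by (simp add: Z_def iota_A_eval[symmetric] to_ac_prod)
  finally show ?thesis .
qed

lemma u_nz: "u j \<noteq> 0"
proof -
  have "\<iota> (zv k) - th j \<noteq> 0" for k
  proof
    assume "\<iota> (zv k) - th j = 0"
    then have "\<iota> (zv k) - th (j mod d) = 0" by (simp add: th_mod)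
    moreover have "j mod d < d" using d_pos by simp
    ultimately have "(\<Prod>j<d. \<iota> (zv k) - th j) = 0" by (intro prod_zero) auto
    then have "\<iota> (A_eval f (zv k)) = 0" by (simp add: prod_th iota_A_eval)
    then show False using A_eval_nonzero[OF f_nz, of "v k"] by simp
  qed
  then show ?thesis by (auto simp: u_def rf_var_nonzero)
qed

lemma w_nz: "w i \<noteq> 0"
  by (simp add: w_def u_nz)

lemma w_add: "w (i + s) = w i * (\<Prod>j<s. u (i + j))"
  by (induction s) (simp_all add: w_def mult_ac)

lemma u_mod: "u (d + j) = u j"
  unfolding u_def using th_mod[of "d + j"] th_mod[of j] by simp

lemma w_mod: "w i = \<iota> Z ^ (i div d) * w (i mod d)"
proof (induction i rule: less_induct)
  case (less i)
  show ?case
  proof (cases "i < d")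
    case False
    then have i: "i = d + (i - d)" by simp
    have "w i = w d * w (i - d)"
      by (subst i, subst w_add) (simp add: u_mod w_def)
    also have "w (i - d) = \<iota> Z ^ ((i - d) div d) * w ((i - d) mod d)"
      using False d_pos by (intro less) auto
    finally show ?thesis using False d_pos by (simp add: w_d le_div_geq le_mod_geq)
  qed simp
qed

definition coord :: "nat \<Rightarrow> ('a, 'v) ratfun poly \<Rightarrow> ('a, 'v) ratfun alg_closure" where
  "coord i g = w i * poly (map_poly \<iota> g) (th i)"

lemma map_iota_pCons: "map_poly \<iota> (pCons k p) = pCons (\<iota> k) (map_poly \<iota> p)"
  by (rule poly_eqI) (simp add: coeff_map_poly coeff_pCons split: nat.splits)

lemma poly_iota_hom: "comm_ring_hom (\<lambda>g. poly (map_poly \<iota> g) y)"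
proof -
  interpret ih: field_hom \<iota> by (rule field_hom_to_ac)
  have "comm_ring_hom (map_poly \<iota>)" by (rule comm_ring_hom_map_poly[OF ih.comm_ring_hom_axioms])
  from comm_ring_homD[OF this] show ?thesis by unfold_locales simp_all
qed

lemma poly_iota_smult: "poly (map_poly \<iota> (smult k g)) y = \<iota> k * poly (map_poly \<iota> g) y"
proof -
  interpret ih: field_hom \<iota> by (rule field_hom_to_ac)
  show ?thesis by (simp add: hom_distribs)
qed

lemma coord_sum: "coord i (\<Sum>j<m. smult (k j) (g j)) = (\<Sum>j<m. \<iota> (k j) * coord i (g j))"
  unfolding coord_def comm_ring_homD(4)[OF poly_iota_hom]
  by (simp add: poly_iota_smult sum_distrib_left mult_ac)

lemma poly_mod_f: "poly (map_poly \<iota> (g mod emb f)) (th i) = poly (map_poly \<iota> g) (th i)"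
proof -
  have "poly (map_poly \<iota> g) (th i) =
      poly (map_poly \<iota> (g div emb f)) (th i) * poly (map_poly \<iota> (emb f)) (th i) +
      poly (map_poly \<iota> (g mod emb f)) (th i)"
    unfolding comm_ring_homD(3)[OF poly_iota_hom, symmetric]
      comm_ring_homD(1)[OF poly_iota_hom, symmetric] by simp
  moreover have "poly (map_poly \<iota> (emb f)) (th i) = 0" by (simp add: poly_emb ev_th_eq_0_iff)
  ultimately show ?thesis by simp
qed

text \<open>The weights \<open>w i\<close> are nonzero, so a dependency between the columns would be
  a nonzero polynomial of degree below \<open>d\<close> with the \<open>d\<close> distinct roots
  \<open>th i\<close>.\<close>

lemma det_coord_nonzero: "det (mat d d (\<lambda>(i, j). coord i (monom 1 j))) \<noteq> 0"
proof
  let ?M = "mat d d (\<lambda>(i, j). coord i (monom 1 j))"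
  assume "det ?M = 0"
  then obtain x where x: "x \<in> carrier_vec d" "x \<noteq> 0\<^sub>v d" "?M *\<^sub>v x = 0\<^sub>v d"
    using det_0_iff_vec_prod_zero_field[of ?M d] by auto
  define p where "p = (\<Sum>j<d. monom (x $ j) j)"
  have coeff_p: "coeff p j = (if j < d then x $ j else 0)" for j by (simp add: p_def coeff_sum)
  have "p \<noteq> 0"
  proof
    assume "p = 0"
    then have "x $ j = 0" if "j < d" for j using coeff_p[of j] that by simp
    then show False using x by auto
  qed
  have root: "poly p (th i) = 0" if i: "i < d" for i
  proof -
    have "(?M *\<^sub>v x) $ i = (\<Sum>j<d. w i * th i ^ j * x $ j)"
      using i x(1) by (auto simp: scalar_prod_def coord_def atLeast0LessThan map_poly_monom poly_monom
          intro!: sum.cong)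
    also have "\<dots> = w i * poly p (th i)"
      by (simp add: p_def poly_sum poly_monom sum_distrib_left mult_ac)
    finally show ?thesis using i w_nz unfolding x(3) by simp
  qed
  have "card (th ` {..<d}) \<le> degree p"
    using root by (intro card_roots_le_degree[OF \<open>p \<noteq> 0\<close>]) auto
  also have "\<dots> < d"
    using d_pos by (intro le_less_trans[OF degree_le[of "d - 1"]]) (auto simp: coeff_p)
  finally show False by (simp add: card_image[OF inj_th])
qed

lemma mod_f_polys_below: "g mod emb f \<in> polys_below d"
  using polys_below_iff_mod[OF emb_f_nz, of "g mod emb f"] by (simp add: degree_emb d_def)

text \<open>In these coordinates multiplication by \<open>\<theta>\<close> is diagonal, with the
  roots \<open>th i\<close> of \<open>f\<close> as entries.\<close>

lemma det_quot_eq: "det_quot f = emb f"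
proof -
  let ?\<Psi> = "mat d d (\<lambda>(i, j). if i = j then th i else 0)"
  have "map_poly \<iota> (det_quot f) = char_poly ?\<Psi>"
    unfolding det_quot_def quot_space_eq
  proof (rule module_det_coordinates[OF field_hom_to_ac coord_sum det_coord_nonzero mod_f_polys_below])
    fix i g assume i: "i < d"
    have "coord i (([:0, 1:] * g) mod emb f) = th i * coord i g"
      unfolding coord_def poly_mod_f comm_ring_homD(3)[OF poly_iota_hom] by (simp add: map_iota_pCons)
    also have "\<dots> = (\<Sum>j<d. (if i = j then th i * coord i g else 0))"
      using i by simp
    also have "\<dots> = (\<Sum>j<d. ?\<Psi> $$ (i, j) * coord j g)"
      using i by (intro sum.cong) auto
    finally show "coord i (([:0, 1:] * g) mod emb f) = (\<Sum>j<d. ?\<Psi> $$ (i, j) * coord j g)" .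
  qed simp
  also have "\<dots> = (\<Prod>a\<leftarrow>diag_mat ?\<Psi>. [:- a, 1:])"
    by (rule char_poly_upper_triangular[of _ d]) (auto intro!: upper_triangularI)
  also have "\<dots> = (\<Prod>i\<leftarrow>[0..<d]. [:- th i, 1:])"
    unfolding diag_mat_def map_map by (intro arg_cong[where f = prod_list] map_cong) auto
  also have "\<dots> = (\<Prod>i\<in>set [0..<d]. [:- th i, 1:])"
    by (rule prod.distinct_set_conv_list[symmetric]) simp
  also have "\<dots> = (\<Prod>i<d. [:- th i, 1:])" by (simp add: atLeast0LessThan)
  also have "\<dots> = map_poly \<iota> (emb f)" by (simp add: f_eq_prod map_iota_emb)
  finally show ?thesis
    by (rule field_hom_map_poly_inj[OF field_hom_to_ac])
qed

definition "\<Psi> = cyc_mat d r (\<lambda>i s. ev (th i) (coeff \<phi> s)) (\<iota> Z)"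

lemma poly_tau: "poly (map_poly \<iota> ((tau ^^ s) x)) y = poly (map_poly \<iota> x) (y ^ (CARD('a) ^ s))"
proof (induction s arbitrary: y)
  case (Suc s)
  interpret ih: field_hom \<iota> by (rule field_hom_to_ac)
  have "poly (map_poly \<iota> (tau x')) y = poly (map_poly \<iota> x') (y ^ CARD('a))" for x' y
    by (simp add: tau_def ih.map_poly_pcompose poly_pcompose poly_monom)
  then show ?case using Suc[of "y ^ CARD('a)"] by (simp add: power_mult)
qed simp

lemma poly_ell: "poly (map_poly \<iota> (ell s z)) (th i) = (\<Prod>j<s. \<iota> z - th (i + j))"
proof -
  have "poly (map_poly \<iota> (ell s z)) (th i) =
      (\<Prod>j<s. poly (map_poly \<iota> ([:z:] - monom 1 (CARD('a) ^ j))) (th i))"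
    unfolding ell_def by (rule comm_ring_hom_prod[OF poly_iota_hom])
  also have "\<dots> = (\<Prod>j<s. \<iota> z - th (i + j))"
    unfolding comm_ring_homD(2)[OF poly_iota_hom]
    by (simp add: map_iota_pCons map_poly_monom poly_monom th_add)
  finally show ?thesis .
qed

text \<open>Evaluating \<open>(tau ^^ s) g\<close> at \<open>th i\<close> evaluates \<open>g\<close>
  at \<open>th (i + s)\<close>, and the \<open>ell\<close> factors together with the power of
  \<open>t\<close> are the quotient of \<open>w (i + s)\<close> by \<open>w i\<close>. Reducing
  \<open>i + s\<close> modulo \<open>d\<close> produces the power of \<open>Z\<close>.\<close>

lemma coord_psi:
  assumes i: "i < d"
  shows "coord i (psi_theta \<phi> n v g) = (\<Sum>j<d. \<Psi> $$ (i, j) * coord j g)"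
proof -
  let ?c = "\<lambda>s. ev (th i) (coeff \<phi> s)"
  have term_eq: "w i * poly (map_poly \<iota> ([:zv 0 ^ s:] * (\<Prod>k = 1..n. ell s (zv k)) *
      emb (coeff \<phi> s) * (tau ^^ s) g)) (th i) = ?c s * \<iota> Z ^ ((i + s) div d) * coord ((i + s) mod d) g" for s
  proof -
    have "w i * (\<iota> (zv 0) ^ s * (\<Prod>k = 1..n. \<Prod>j<s. \<iota> (zv k) - th (i + j))) = w (i + s)"
      unfolding w_add u_def prod.distrib by (simp add: prod.swap[of _ "{..<s}"])
    moreover have "poly (map_poly \<iota> [:zv 0 ^ s:]) (th i) = \<iota> (zv 0) ^ s" by (simp add: map_iota_pCons)
    moreover have "poly (map_poly \<iota> ((tau ^^ s) g)) (th i) = poly (map_poly \<iota> g) (th ((i + s) mod d))"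
      unfolding poly_tau th_add[symmetric] th_mod ..
    ultimately show ?thesis
      unfolding comm_ring_homD(3)[OF poly_iota_hom] comm_ring_hom_prod[OF poly_iota_hom] poly_ell
        poly_emb coord_def
      using w_mod[of "i + s"] by (simp add: mult_ac)
  qed
  have "coord i (psi_theta \<phi> n v g) = (\<Sum>s\<le>degree \<phi>. ?c s * \<iota> Z ^ ((i + s) div d) * coord ((i + s) mod d) g)"
    unfolding coord_def[of i] psi_theta_def comm_ring_homD(4)[OF poly_iota_hom] sum_distrib_left term_eq ..
  also have "\<dots> = (\<Sum>s\<le>r. ?c s * \<iota> Z ^ ((i + s) div d) * coord ((i + s) mod d) g)"
    using r_le r_max by (intro sum.mono_neutral_right) (auto simp: ev_th_eq_0_iff)
  also have "\<dots> = (\<Sum>s\<le>r. \<Sum>j<d. (if (i + s) mod d = j then ?c s * \<iota> Z ^ ((i + s) div d) else 0) * coord j g)"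
    using d_pos by (intro sum.cong refl) (simp add: if_distrib[of "\<lambda>x. x * _"] cong: if_cong)
  also have "\<dots> = (\<Sum>j<d. \<Psi> $$ (i, j) * coord j g)"
    using i by (subst sum.swap) (simp add: \<Psi>_def cyc_mat_def sum_distrib_right)
  finally show ?thesis .
qed

lemma char_poly_Psi: "char_poly \<Psi> = poly (det (cmat \<zeta> \<phi> d r)) [:\<iota> Z:]"
proof -
  have "poly (det (cmat \<zeta> \<phi> d r)) [:\<iota> Z:] = det (map_mat (\<lambda>p. poly p [:\<iota> Z:]) (cmat \<zeta> \<phi> d r))"
    by (rule comm_ring_hom.hom_det[OF poly_hom.comm_ring_hom_axioms, symmetric])
  also have "map_mat (\<lambda>p. poly p [:\<iota> Z:]) (cmat \<zeta> \<phi> d r) = cyc_mat d r (tw \<zeta> \<phi>) [:\<iota> Z:]"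
    unfolding cmat_def comm_ring_hom.map_mat_cyc_mat[OF poly_hom.comm_ring_hom_axioms] by simp
  also have "\<dots> = char_poly_matrix \<Psi>"
  proof (rule eq_matI)
    fix i j assume "i < dim_row (char_poly_matrix \<Psi>)" "j < dim_col (char_poly_matrix \<Psi>)"
    then have ij: "i < d" "j < d" by (auto simp: char_poly_matrix_def \<Psi>_def cyc_mat_def)
    have pw: "[:\<iota> Z:] ^ m = [:\<iota> Z ^ m:]" for m
      by (induction m) (simp_all add: one_pCons)
    have "cyc_mat d r (tw \<zeta> \<phi>) [:\<iota> Z:] $$ (i, j) =
      (\<Sum>s\<le>r. (if s = 0 then if i = j then [:0, 1:] else 0 else 0) -
        [:if (i + s) mod d = j then ev (th i) (coeff \<phi> s) * \<iota> Z ^ ((i + s) div d) else 0:])"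
      using ij by (auto simp: cyc_mat_def tw_def th_def pw algebra_simps intro!: sum.cong)
    also have "\<dots> = (if i = j then [:0, 1:] else 0) - [:\<Psi> $$ (i, j):]"
      using ij unfolding sum_subtractf sum_to_poly by (simp add: \<Psi>_def cyc_mat_def)
    also have "\<dots> = char_poly_matrix \<Psi> $$ (i, j)"
      using ij by (simp add: char_poly_matrix_def \<Psi>_def cyc_mat_def)
    finally show "cyc_mat d r (tw \<zeta> \<phi>) [:\<iota> Z:] $$ (i, j) = char_poly_matrix \<Psi> $$ (i, j)" .
  qed (auto simp: char_poly_matrix_def \<Psi>_def cyc_mat_def)
  finally show ?thesis by (simp add: char_poly_def)
qed

lemma det_psi_quot_eq:
  assumes a: "\<And>m. coeff (det (cmat \<zeta> \<phi> d r)) m = map_poly (\<lambda>a. \<iota> (rf_const a)) (a m)"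
    and bound: "\<And>m. m > b \<Longrightarrow> a m = 0"
  shows "det_psi_quot \<phi> n v f = (\<Sum>m\<le>b. smult (Z ^ m) (emb (a m)))"
proof -
  interpret ih: field_hom \<iota> by (rule field_hom_to_ac)
  have "map_poly \<iota> (det_psi_quot \<phi> n v f) = char_poly \<Psi>"
    unfolding det_psi_quot_def quot_space_eq
  proof (rule module_det_coordinates[OF field_hom_to_ac coord_sum det_coord_nonzero mod_f_polys_below])
    fix i g assume i: "i < d"
    have "coord i (psi_theta \<phi> n v g mod emb f) = coord i (psi_theta \<phi> n v g)"
      by (simp add: coord_def poly_mod_f)
    then show "coord i (psi_theta \<phi> n v g mod emb f) = (\<Sum>j<d. \<Psi> $$ (i, j) * coord j g)"
      using coord_psi[OF i] by simp
  qed (simp add: \<Psi>_def)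
  also have "\<dots> = (\<Sum>m\<le>degree (det (cmat \<zeta> \<phi> d r)). coeff (det (cmat \<zeta> \<phi> d r)) m * [:\<iota> Z:] ^ m)"
    unfolding char_poly_Psi by (rule poly_altdef)
  also have "\<dots> = (\<Sum>m\<le>b. coeff (det (cmat \<zeta> \<phi> d r)) m * [:\<iota> Z:] ^ m)"
  proof (rule sum.mono_neutral_left)
    have "degree (det (cmat \<zeta> \<phi> d r)) \<le> b" by (rule degree_le) (simp add: a bound)
    then show "{..degree (det (cmat \<zeta> \<phi> d r))} \<subseteq> {..b}" by simp
  qed (auto simp: coeff_eq_0)
  also have "\<dots> = (\<Sum>m\<le>b. map_poly \<iota> (smult (Z ^ m) (emb (a m))))"
  proof (rule sum.cong[OF refl])
    fix m
    have pw: "[:\<iota> Z:] ^ m = [:\<iota> Z ^ m:]"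
      by (induction m) (simp_all add: one_pCons)
    show "coeff (det (cmat \<zeta> \<phi> d r)) m * [:\<iota> Z:] ^ m = map_poly \<iota> (smult (Z ^ m) (emb (a m)))"
      by (simp add: a pw ih.map_poly_hom_smult map_iota_emb)
  qed
  also have "\<dots> = map_poly \<iota> (\<Sum>m\<le>b. smult (Z ^ m) (emb (a m)))"
    by (rule comm_ring_homD(4)[OF comm_ring_hom_map_poly[OF ih.comm_ring_hom_axioms], symmetric])
  finally show ?thesis
    by (rule field_hom_map_poly_inj[OF field_hom_to_ac])
qed

end

subsection \<open>Euler products\<close>

text \<open>Valuations are scaled by \<open>R\<close> because the bounds below are multiples of \<open>1/R\<close>.\<close>

definition fls_ge :: "nat \<Rightarrow> int \<Rightarrow> 'k :: field fls \<Rightarrow> bool" where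
  "fls_ge R w x \<longleftrightarrow> x = 0 \<or> w \<le> int R * fls_subdegree x"

lemma fls_ge_0 [simp]: "fls_ge R w 0"
  by (simp add: fls_ge_def)

lemma fls_ge_1 [simp]: "fls_ge R 0 1"
  by (simp add: fls_ge_def)

lemma fls_ge_mono: "fls_ge R w x \<Longrightarrow> w' \<le> w \<Longrightarrow> fls_ge R w' x"
  by (auto simp: fls_ge_def)

lemma fls_ge_add:
  assumes "fls_ge R w x" "fls_ge R w y"
  shows "fls_ge R w (x + y)"
proof (cases "x = 0 \<or> y = 0 \<or> x + y = 0")
  case False
  then have "min (fls_subdegree x) (fls_subdegree y) \<le> fls_subdegree (x + y)"
    by (intro fls_plus_subdegree) auto
  then have "int R * min (fls_subdegree x) (fls_subdegree y) \<le> int R * fls_subdegree (x + y)"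
    by (intro mult_left_mono) auto
  then show ?thesis using assms False by (auto simp: fls_ge_def min_def split: if_splits)
qed (use assms in auto)

lemma fls_ge_uminus: "fls_ge R w x \<Longrightarrow> fls_ge R w (- x)"
  by (simp add: fls_ge_def)

lemma fls_ge_diff: "fls_ge R w x \<Longrightarrow> fls_ge R w y \<Longrightarrow> fls_ge R w (x - y)"
  using fls_ge_add[of R w x "- y"] by (simp add: fls_ge_uminus)

lemma fls_ge_sum: "(\<And>i. i \<in> A \<Longrightarrow> fls_ge R w (g i)) \<Longrightarrow> fls_ge R w (\<Sum>i\<in>A. g i)"
  by (induction A rule: infinite_finite_induct) (auto intro: fls_ge_add)

lemma fls_ge_mult:
  assumes "fls_ge R w x" "fls_ge R w' y"
  shows "fls_ge R (w + w') (x * y)"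
  using assms by (cases "x = 0 \<or> y = 0") (auto simp: fls_ge_def ring_distribs)

lemma fls_ge_power: "fls_ge R w x \<Longrightarrow> fls_ge R (int n * w) (x ^ n)"
proof (induction n)
  case (Suc n)
  then have "fls_ge R (w + int n * w) (x * x ^ n)" by (intro fls_ge_mult) auto
  then show ?case by (simp add: algebra_simps)
qed simp

lemma fls_ge_nth: "fls_ge R w x \<Longrightarrow> int R * i < w \<Longrightarrow> fls_nth x i = 0"
proof (rule ccontr)
  assume a: "fls_ge R w x" "int R * i < w" "fls_nth x i \<noteq> 0"
  then have "fls_subdegree x \<le> i" by (metis fls_eq0_below_subdegree not_le)
  then have "int R * fls_subdegree x \<le> int R * i" by (intro mult_left_mono) auto
  then show False using a by (auto simp: fls_ge_def)
qed

lemma fls_geI: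
  assumes "\<And>i. int R * i < w \<Longrightarrow> fls_nth x i = 0"
  shows "fls_ge R w x"
  using assms[of "fls_subdegree x"] nth_fls_subdegree_nonzero[of x] by (fastforce simp: fls_ge_def)

text \<open>The factors are exchanged one at a time; the bound on the product of the
  \<open>y f\<close> is carried along for the induction.\<close>

lemma fls_ge_prod_diff:
  assumes "finite F" "0 \<le> w" "\<And>f. f \<in> F \<Longrightarrow> fls_ge R 0 (x f)" "\<And>f. f \<in> F \<Longrightarrow> fls_ge R w (x f - y f)"
  shows "fls_ge R w ((\<Prod>f\<in>F. x f) - (\<Prod>f\<in>F. y f)) \<and> fls_ge R 0 (\<Prod>f\<in>F. y f)"
  using assms
proof (induction F rule: finite_induct)
  case (insert f F)
  then have IH: "fls_ge R w ((\<Prod>f\<in>F. x f) - (\<Prod>f\<in>F. y f))" "fls_ge R 0 (\<Prod>f\<in>F. y f)" by auto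
  have x: "fls_ge R 0 (x f)" and xy: "fls_ge R w (x f - y f)" using insert by auto
  have "fls_ge R 0 (x f - (x f - y f))"
    by (rule fls_ge_diff[OF x fls_ge_mono[OF xy \<open>0 \<le> w\<close>]])
  then have y: "fls_ge R 0 (y f)" by simp
  have eq: "(\<Prod>f\<in>insert f F. x f) - (\<Prod>f\<in>insert f F. y f) =
      x f * ((\<Prod>f\<in>F. x f) - (\<Prod>f\<in>F. y f)) + (x f - y f) * (\<Prod>f\<in>F. y f)"
    using insert(1,2) by (simp add: algebra_simps)
  have "fls_ge R w (x f * ((\<Prod>f\<in>F. x f) - (\<Prod>f\<in>F. y f)) + (x f - y f) * (\<Prod>f\<in>F. y f))"
    using fls_ge_mult[OF x IH(1)] fls_ge_mult[OF xy IH(2)] by (intro fls_ge_add) simp_all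
  moreover have "fls_ge R 0 (\<Prod>f\<in>insert f F. y f)"
    using fls_ge_mult[OF y IH(2)] insert(1,2) by simp
  ultimately show ?case unfolding eq by blast
qed simp

lemma tendsto_fls_ge:
  fixes g :: "'b \<Rightarrow> 'k :: field fls"
  assumes R: "R > 0" and ev: "\<And>N :: nat. eventually (\<lambda>x. fls_ge R (int R * int N) (g x - l)) F"
  shows "(g \<longlongrightarrow> l) F"
  unfolding tendsto_iff
proof (intro allI impI)
  fix \<epsilon> :: real assume "\<epsilon> > 0"
  then obtain N where N: "(1 / 2) ^ N < \<epsilon>" using real_arch_pow_inv[of \<epsilon> "1 / 2"] by auto
  show "eventually (\<lambda>x. dist (g x) l < \<epsilon>) F"
    using ev[of N]
  proof eventually_elim
    case (elim x)
    show ?case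
    proof (cases "g x = l")
      case False
      then have "int R * int N \<le> int R * fls_subdegree (g x - l)" using elim by (simp add: fls_ge_def)
      then have sd: "int N \<le> fls_subdegree (g x - l)" using R by simp
      then have "dist (g x) l = inverse (2 ^ nat (fls_subdegree (g x - l)))"
        using False by (simp add: dist_fls_def)
      also have "\<dots> \<le> inverse (2 ^ N)"
        using sd by (intro le_imp_inverse_le power_increasing) auto
      also have "\<dots> = (1 / 2) ^ N" by (simp add: power_one_over inverse_eq_divide)
      finally show ?thesis using N by simp
    qed (use \<open>\<epsilon> > 0\<close> in simp)
  qed
qed

section \<open>Factorisation of monic polynomials\<close>

lemma irreducible_imp_prime_elem_field_poly:
  fixes f :: "'a :: field poly"
  assumes "irreducible f"
  shows "prime_elem f"
proof (rule prime_elemI)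
  fix a b assume ab: "f dvd a * b"
  show "f dvd a \<or> f dvd b"
  proof (rule disjCI)
    assume "\<not> f dvd b"
    then obtain u v where "u * f + v * b = 1" using poly_bezout_irreducible[OF assms] by blast
    then have "a = f * (u * a) + v * (a * b)" by (metis (no_types) distrib_left mult.left_commute mult.commute mult.right_neutral)
    then show "f dvd a" using ab by (metis dvd_add dvd_mult dvd_triv_left)
  qed
qed (use assms in \<open>auto simp: irreducible_def\<close>)

lemma monics_mult: "a \<in> monics \<Longrightarrow> b \<in> monics \<Longrightarrow> a * b \<in> monics"
  by (simp add: monics_def lead_coeff_mult)

lemma monics_power: "a \<in> monics \<Longrightarrow> a ^ n \<in> monics"
  by (simp add: monics_def lead_coeff_power)

lemma monic_primes_monics: "f \<in> monic_primes \<Longrightarrow> f \<in> monics"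
  by (simp add: monics_def monic_primes_def)

lemma monics_nonzero: "a \<in> monics \<Longrightarrow> a \<noteq> 0"
  by (auto simp: monics_def)

lemma monics_factor: "a * b \<in> monics \<Longrightarrow> a \<in> monics \<Longrightarrow> b \<in> monics"
  by (simp add: monics_def lead_coeff_mult)

lemma monic_prime_divisor:
  fixes a :: "'a :: field poly"
  assumes "degree a > 0"
  obtains f where "f \<in> monic_primes" "f dvd a"
proof -
  define P where "P g \<longleftrightarrow> degree g > 0 \<and> g dvd a" for g
  have "P a" using assms by (simp add: P_def)
  then obtain g where g: "P g" "\<And>g'. P g' \<Longrightarrow> degree g \<le> degree g'"
    using exists_least_iff[of "\<lambda>n. \<exists>g. P g \<and> degree g = n"] by (metis not_less)
  define f where "f = smult (inverse (lead_coeff g)) g"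
  have gnz: "lead_coeff g \<noteq> 0" using g by (auto simp: P_def)
  have fdvd: "f dvd g" "degree f = degree g" using gnz by (auto simp: f_def smult_dvd_iff)
  have fa: "f dvd a" using fdvd g dvd_trans by (auto simp: P_def)
  have "irreducible f"
  proof (rule irreducibleI)
    show "f \<noteq> 0" using gnz by (auto simp: f_def)
    then show "\<not> f dvd 1" using g fdvd by (simp add: P_def is_unit_iff_degree)
    fix b c assume bc: "f = b * c"
    have nz: "b \<noteq> 0" "c \<noteq> 0" using bc \<open>f \<noteq> 0\<close> by auto
    show "b dvd 1 \<or> c dvd 1"
    proof (rule disjCI)
      assume "\<not> c dvd 1"
      then have "degree c > 0" using nz by (auto simp: is_unit_iff_degree)
      moreover have "c dvd a" using fa bc dvd_mult_right by blast
      ultimately have "degree g \<le> degree c" by (intro g) (simp add: P_def)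
      moreover have "degree g = degree b + degree c" using bc nz fdvd by (simp add: degree_mult_eq)
      ultimately show "b dvd 1" using nz by (simp add: is_unit_iff_degree)
    qed
  qed
  moreover have "lead_coeff f = 1" using gnz by (simp add: f_def)
  ultimately show ?thesis using that fa by (simp add: monic_primes_def)
qed

lemma monic_split_prime_power:
  fixes a :: "'a :: field poly"
  assumes a: "a \<in> monics" and f: "f \<in> monic_primes"
  obtains i b where "a = f ^ i * b" "b \<in> monics" "\<not> f dvd b"
proof -
  have "\<exists>i b. a = f ^ i * b \<and> b \<in> monics \<and> \<not> f dvd b" using a
  proof (induction "degree a" arbitrary: a rule: less_induct)
    case less
    show ?case
    proof (cases "f dvd a")
      case False
      then show ?thesis using less by (intro exI[of _ 0] exI[of _ a]) simp
    next
      case True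
      then obtain a' where a': "a = f * a'" by (elim dvdE)
      have m: "a' \<in> monics" using less(2) a' monics_factor monic_primes_monics[OF f] by blast
      have "degree a = degree f + degree a'"
        using a' monics_nonzero[OF m] monics_nonzero[OF monic_primes_monics[OF f]]
        by (simp add: degree_mult_eq)
      then have "degree a' < degree a" using monic_primes_degree[OF f] by simp
      then obtain i b where "a' = f ^ i * b" "b \<in> monics" "\<not> f dvd b" using less(1)[OF _ m] by blast
      then show ?thesis using a' by (intro exI[of _ "Suc i"] exI[of _ b]) (simp add: mult_ac)
    qed
  qed
  then show ?thesis using that by blast
qed

lemma coprime_prime_power:
  fixes f b :: "'a :: field poly"
  assumes "f \<in> monic_primes" "\<not> f dvd b"
  shows "coprime (f ^ i) b"
proof -
  have "irreducible f" using assms by (simp add: monic_primes_def)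
  then obtain u v where uv: "u * f + v * b = 1" using poly_bezout_irreducible assms(2) by blast
  have "\<exists>u' v'. u' * f ^ i + v' * b = 1"
  proof (induction i)
    case (Suc i)
    then obtain u' v' where "u' * f ^ i + v' * b = 1" by blast
    then have "(u * f + v * b) * (u' * f ^ i + v' * b) = 1" using uv by simp
    then have "(u * u') * f ^ Suc i + (u * f * v' + v * (u' * f ^ i + v' * b)) * b = 1"
      by (simp add: algebra_simps)
    then show ?case by blast
  qed (auto intro: exI[of _ 1] exI[of _ 0])
  then obtain u' v' where eq: "u' * f ^ i + v' * b = 1" by blast
  show ?thesis
  proof (rule coprimeI)
    fix c assume "c dvd f ^ i" "c dvd b"
    then have "c dvd u' * f ^ i + v' * b" by simp
    then show "c dvd 1" by (simp only: eq)
  qed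
qed

lemma finite_monics_degree: "finite {a :: 'a :: {field, finite} poly. degree a \<le> n}"
  by (rule finite_subset[OF _ finite_polys_below[of "Suc n"]])
     (auto simp: polys_below_def intro!: coeff_eq_0)

text \<open>\<open>B\<close> is the set of products of powers of primes of \<open>F\<close> with
  exponents at most \<open>M\<close>. That no prime outside \<open>F\<close> divides an element of
  \<open>B\<close> keeps the products distinct when a prime is added;
  \<open>degree a \<le> M\<close> bounds all exponents in \<open>a\<close> by
  \<open>M\<close>.\<close>

lemma finite_euler_product:
  fixes T :: "'a :: field poly \<Rightarrow> 'c :: comm_ring_1"
  assumes T1: "T 1 = 1"
    and Tmult: "\<And>a b. a \<in> monics \<Longrightarrow> b \<in> monics \<Longrightarrow> coprime a b \<Longrightarrow> T (a * b) = T a * T b"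
    and F: "finite F" "F \<subseteq> monic_primes"
  shows "\<exists>B. finite B \<and> B \<subseteq> monics \<and> (\<Prod>f\<in>F. \<Sum>i\<le>M. T (f ^ i)) = (\<Sum>a\<in>B. T a) \<and>
      (\<forall>b\<in>B. \<forall>g\<in>monic_primes - F. \<not> g dvd b) \<and>
      (\<forall>a\<in>monics. degree a \<le> M \<longrightarrow> (\<forall>g\<in>monic_primes. g dvd a \<longrightarrow> g \<in> F) \<longrightarrow> a \<in> B)"
  using F
proof (induction F rule: finite_induct)
  case empty
  have "a = 1" if "a \<in> monics" "\<forall>g\<in>monic_primes. \<not> g dvd a" for a :: "'a poly"
  proof -
    have "\<not> degree a > 0" using that(2) monic_prime_divisor by metis
    then obtain c where "a = [:c:]" by (metis degree_eq_zeroE gr0I)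
    then show ?thesis using that(1) by (simp add: monics_def one_pCons)
  qed
  moreover have "\<not> g dvd 1" if "g \<in> monic_primes" for g :: "'a poly"
    using that by (auto simp: monic_primes_def irreducible_def)
  ultimately show ?case
    by (intro exI[of _ "{1}"]) (auto simp: T1 monics_def)
next
  case (insert f F)
  then obtain B where B: "finite B" "B \<subseteq> monics" "(\<Prod>f\<in>F. \<Sum>i\<le>M. T (f ^ i)) = (\<Sum>a\<in>B. T a)"
    "\<And>b g. b \<in> B \<Longrightarrow> g \<in> monic_primes \<Longrightarrow> g \<notin> F \<Longrightarrow> \<not> g dvd b"
    "\<And>a. a \<in> monics \<Longrightarrow> degree a \<le> M \<Longrightarrow> (\<And>g. g \<in> monic_primes \<Longrightarrow> g dvd a \<Longrightarrow> g \<in> F) \<Longrightarrow> a \<in> B"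
    by auto
  have f: "f \<in> monic_primes" "f \<notin> F" using insert by auto
  have fnz: "f \<noteq> 0" using monics_nonzero[OF monic_primes_monics[OF f(1)]] .
  let ?m = "\<lambda>(i, b). f ^ i * b"
  have fB: "\<not> f dvd b" if "b \<in> B" for b using B(4)[OF that f] .
  have inj: "inj_on ?m ({..M} \<times> B)"
  proof (rule inj_onI, clarify)
    fix i b j c assume ib: "b \<in> B" "c \<in> B" "f ^ i * b = f ^ j * c"
    have le: "j \<le> i" if "f ^ i * b = f ^ j * c" "b \<in> B" for i j b c
    proof (rule ccontr)
      assume "\<not> j \<le> i"
      then have j: "j = i + Suc (j - Suc i)" by simp
      have "f ^ i * b = f ^ i * (f * f ^ (j - Suc i) * c)"
        using that(1) by (subst (asm) j) (simp add: power_add mult_ac)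
      then have "f dvd b" using fnz by (metis dvd_triv_left mult.assoc mult_left_cancel power_not_zero)
      then show False using fB that(2) by blast
    qed
    have "i = j" using le[OF ib(3,1)] le[OF ib(3)[symmetric] ib(2)] by simp
    then show "i = j \<and> b = c" using ib(3) fnz by simp
  qed
  have "(\<Prod>f\<in>insert f F. \<Sum>i\<le>M. T (f ^ i)) = (\<Sum>i\<le>M. \<Sum>b\<in>B. T (f ^ i) * T b)"
    using insert(1,2) B(3) by (simp add: sum_product)
  also have "\<dots> = (\<Sum>(i, b)\<in>{..M} \<times> B. T (f ^ i * b))"
    unfolding sum.cartesian_product
    using B(2) fB f monic_primes_monics[OF f(1)]
    by (intro sum.cong) (auto intro!: Tmult[symmetric] monics_power coprime_prime_power)
  also have "\<dots> = (\<Sum>a\<in>?m ` ({..M} \<times> B). T a)"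
    by (subst sum.reindex[OF inj]) (auto intro!: sum.cong)
  finally have eq: "(\<Prod>f\<in>insert f F. \<Sum>i\<le>M. T (f ^ i)) = (\<Sum>a\<in>?m ` ({..M} \<times> B). T a)" .
  show ?case
  proof (intro exI[of _ "?m ` ({..M} \<times> B)"] conjI ballI impI eq)
    show "?m ` ({..M} \<times> B) \<subseteq> monics"
      using B(2) monic_primes_monics[OF f(1)] by (auto intro!: monics_mult monics_power)
    fix a g assume a: "a \<in> ?m ` ({..M} \<times> B)" and g: "g \<in> monic_primes - insert f F"
    obtain i b where ib: "a = f ^ i * b" "b \<in> B" using a by auto
    show "\<not> g dvd a"
    proof
      assume "g dvd a"
      have pg: "prime_elem g" using g
        by (intro irreducible_imp_prime_elem_field_poly) (simp add: monic_primes_def)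
      have "g dvd f \<or> g dvd b"
        using \<open>g dvd a\<close> pg unfolding ib(1) by (metis prime_elem_dvd_mult_iff prime_elem_dvd_power)
      then show False
        using monic_primes_dvd_imp_eq[of g f] f g B(4)[OF ib(2)] by auto
    qed
  next
    fix a assume a: "a \<in> monics" "degree a \<le> M" "\<forall>g\<in>monic_primes. g dvd a \<longrightarrow> g \<in> insert f F"
    obtain i b where ib: "a = f ^ i * b" "b \<in> monics" "\<not> f dvd b"
      by (rule monic_split_prime_power[OF a(1) f(1)])
    have deg: "degree a = i * degree f + degree b"
      unfolding ib(1) using fnz monics_nonzero[OF ib(2)] by (simp add: degree_mult_eq degree_power_eq)
    have "i \<le> i * degree f" using monic_primes_degree[OF f(1)] by simp
    with deg a(2) have "i \<le> M" "degree b \<le> M" by linarith+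
    moreover have "g \<in> F" if "g \<in> monic_primes" "g dvd b" for g
      using a(3) that ib by (metis dvd_mult insertE)
    ultimately show "a \<in> ?m ` ({..M} \<times> B)"
      using B(5)[OF ib(2)] ib(1) by (intro image_eqI[of _ _ "(i, b)"]) auto
  qed (use B in auto)
qed

text \<open>The sum \<open>S\<close> is built coefficient by coefficient: by \<open>bound\<close>, a
  term \<open>T a\<close> reaches the coefficient of index \<open>i\<close> only if
  \<open>degree a \<le> R * i\<close>, which leaves finitely many. Finite products of local factors
  are compared with truncated ones, which expand into finite sums.\<close>

lemma euler_product:
  fixes T :: "'a :: {field, finite} poly \<Rightarrow> 'k :: field fls" and loc :: "'a poly \<Rightarrow> 'k fls"
  assumes R: "R > 0"
    and T1: "T 1 = 1"
    and Tmult: "\<And>a b. a \<in> monics \<Longrightarrow> b \<in> monics \<Longrightarrow> coprime a b \<Longrightarrow> T (a * b) = T a * T b"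
    and bound: "\<And>a. a \<in> monics \<Longrightarrow> fls_ge R (int (degree a)) (T a)"
    and loc: "\<And>f M. f \<in> monic_primes \<Longrightarrow> fls_ge R (int M) (loc f - (\<Sum>i\<le>M. T (f ^ i)))"
  obtains S where "((\<lambda>F. \<Prod>f\<in>F. loc f) \<longlongrightarrow> S) (finite_subsets_at_top monic_primes)"
    "(T has_sum S) monics"
proof -
  define A where "A N = {a :: 'a poly. a \<in> monics \<and> degree a \<le> R * N}" for N :: nat
  have finA: "finite (A N)" for N
    by (rule finite_subset[OF _ finite_monics_degree[of "R * N"]]) (auto simp: A_def)
  define S where "S = fps_to_fls (Abs_fps (\<lambda>n. \<Sum>a\<in>A n. fls_nth (T a) (int n)))"
  have T_nth: "fls_nth (T a) i = 0" if "a \<in> monics" "int R * i < int (degree a)" for a i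
    by (rule fls_ge_nth[OF bound that(2)]) (use that in auto)
  have sum_nth: "fls_nth (\<Sum>a\<in>B. T a) i = fls_nth S i"
    if "finite B" "B \<subseteq> monics" "A N \<subseteq> B" "i < int N" for B N i
  proof (cases "i < 0")
    case True
    have "int R * i < int (degree a)" for a :: "'a poly"
      using True R by (intro less_le_trans[OF mult_pos_neg[of "int R" i]]) auto
    then have "(\<Sum>a\<in>B. fls_nth (T a) i) = 0" using that(2) by (intro sum.neutral ballI T_nth) auto
    then show ?thesis using True by (simp add: S_def fls_nth_sum)
  next
    case False
    then obtain m where m: "i = int m" by (metis nonneg_int_cases not_less)
    have "A m \<subseteq> A N" using that(4) m by (auto simp: A_def intro: order_trans[OF _ mult_le_mono2])
    then have sub: "A m \<subseteq> B" using that(3) by blast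
    have "(\<Sum>a\<in>B. fls_nth (T a) i) = (\<Sum>a\<in>A m. fls_nth (T a) i)"
    proof (rule sum.mono_neutral_right[OF that(1) sub], intro ballI T_nth)
      fix a assume a: "a \<in> B - A m"
      then show "a \<in> monics" using that(2) by auto
      then have "R * m < degree a" using a by (auto simp: A_def)
      then show "int R * i < int (degree a)" unfolding m by (simp flip: of_nat_mult)
    qed
    then show ?thesis by (simp add: S_def fls_nth_sum m)
  qed
  have sum_ge: "fls_ge R (int R * int N) ((\<Sum>a\<in>B. T a) - S)"
    if "finite B" "B \<subseteq> monics" "A N \<subseteq> B" for B N
  proof (rule fls_geI)
    fix i assume "int R * i < int R * int N"
    then have "i < int N" using R by simp
    then show "fls_nth ((\<Sum>a\<in>B. T a) - S) i = 0" using sum_nth[OF that] by simp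
  qed
  have "(T has_sum S) monics"
    unfolding has_sum_def
  proof (rule tendsto_fls_ge[OF R])
    fix N
    show "\<forall>\<^sub>F B in finite_subsets_at_top monics. fls_ge R (int R * int N) (sum T B - S)"
      unfolding eventually_finite_subsets_at_top
      using finA[of N] sum_ge by (intro exI[of _ "A N"]) (auto simp: A_def)
  qed
  moreover have "((\<lambda>F. \<Prod>f\<in>F. loc f) \<longlongrightarrow> S) (finite_subsets_at_top monic_primes)"
  proof (rule tendsto_fls_ge[OF R])
    fix N
    \<comment> \<open>Every monic prime dividing a monic polynomial of degree at most
      \<open>R * N\<close> is in this set, so any larger \<open>F\<close> produces all terms that
      matter to precision \<open>N\<close>.\<close>
    define F0 where "F0 = monic_primes \<inter> A N"
    show "\<forall>\<^sub>F F in finite_subsets_at_top monic_primes.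
        fls_ge R (int R * int N) ((\<Prod>f\<in>F. loc f) - S)"
      unfolding eventually_finite_subsets_at_top
    proof (intro exI[of _ F0] conjI allI impI)
      show "finite F0" "F0 \<subseteq> monic_primes" using finA[of N] by (auto simp: F0_def)
      fix F assume F: "finite F \<and> F0 \<subseteq> F \<and> F \<subseteq> monic_primes"
      define M where "M = R * N"
      have "\<exists>B. finite B \<and> B \<subseteq> monics \<and> (\<Prod>f\<in>F. \<Sum>i\<le>M. T (f ^ i)) = (\<Sum>a\<in>B. T a) \<and>
          (\<forall>b\<in>B. \<forall>g\<in>monic_primes - F. \<not> g dvd b) \<and>
          (\<forall>a\<in>monics. degree a \<le> M \<longrightarrow> (\<forall>g\<in>monic_primes. g dvd a \<longrightarrow> g \<in> F) \<longrightarrow> a \<in> B)"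
        using F by (intro finite_euler_product T1 Tmult) auto
      then obtain B where B: "finite B" "B \<subseteq> monics"
        "(\<Prod>f\<in>F. \<Sum>i\<le>M. T (f ^ i)) = (\<Sum>a\<in>B. T a)"
        "\<forall>a\<in>monics. degree a \<le> M \<longrightarrow> (\<forall>g\<in>monic_primes. g dvd a \<longrightarrow> g \<in> F) \<longrightarrow> a \<in> B"
        by (elim exE conjE) (rule that)
      have "A N \<subseteq> B"
      proof
        fix a assume a: "a \<in> A N"
        then have am: "a \<in> monics" "degree a \<le> M" by (auto simp: A_def M_def)
        have "g \<in> F" if "g \<in> monic_primes" "g dvd a" for g
        proof -
          have "degree g \<le> degree a" using that(2) monics_nonzero[OF am(1)] by (rule dvd_imp_degree_le)
          then have "g \<in> F0"
            using that(1) am monic_primes_monics[OF that(1)] by (auto simp: F0_def A_def M_def)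
          then show ?thesis using F by blast
        qed
        then show "a \<in> B" using B(4) am by blast
      qed
      then have 1: "fls_ge R (int R * int N) ((\<Sum>a\<in>B. T a) - S)" using B by (intro sum_ge) auto
      have "fls_ge R (int M) ((\<Prod>f\<in>F. loc f) - (\<Prod>f\<in>F. \<Sum>i\<le>M. T (f ^ i)))"
      proof (rule fls_ge_prod_diff[THEN conjunct1])
        fix f assume f: "f \<in> F"
        then have fp: "f \<in> monic_primes" using F by blast
        show "fls_ge R (int M) (loc f - (\<Sum>i\<le>M. T (f ^ i)))" by (rule loc[OF fp])
        have "fls_ge R 0 (\<Sum>i\<le>0. T (f ^ i))" by (simp add: T1)
        then have "fls_ge R 0 ((loc f - (\<Sum>i\<le>0. T (f ^ i))) + (\<Sum>i\<le>0. T (f ^ i)))"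
          using loc[OF fp, of 0] by (intro fls_ge_add) simp_all
        then show "fls_ge R 0 (loc f)" by simp
      qed (use F in auto)
      then have "fls_ge R (int R * int N) ((\<Prod>f\<in>F. loc f) - (\<Sum>a\<in>B. T a))"
        unfolding B(3) by (simp add: M_def)
      from fls_ge_add[OF this 1] show "fls_ge R (int R * int N) ((\<Prod>f\<in>F. loc f) - S)" by simp
    qed
  qed
  ultimately show ?thesis using that by blast
qed

subsection \<open>Convergence of the local factors\<close>

lemma comm_ring_hom_fls_const: "comm_ring_hom (fls_const :: 'k :: field \<Rightarrow> 'k fls)"
  by unfold_locales (simp_all add: fls_plus_const)

lemma comm_ring_hom_theta_emb: "comm_ring_hom (theta_emb :: 'k :: field poly \<Rightarrow> 'k fls)"
proof -
  have "comm_ring_hom (map_poly (fls_const :: 'k \<Rightarrow> 'k fls))"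
    by (rule comm_ring_hom_map_poly[OF comm_ring_hom_fls_const])
  from comm_ring_homD[OF this] show ?thesis
    by unfold_locales (simp_all add: theta_emb_def)
qed

lemma theta_emb_nth: "fls_nth (theta_emb p) n = (if n \<le> 0 then coeff p (nat (- n)) else 0)"
proof -
  have "theta_emb p = (\<Sum>i\<le>degree p. fls_const (coeff p i) * fls_X_inv ^ i)"
    by (simp add: theta_emb_def poly_altdef degree_map_poly coeff_map_poly)
  then have "fls_nth (theta_emb p) n = (\<Sum>i\<le>degree p. if n = - int i then coeff p i else 0)"
    by (simp add: fls_nth_sum if_distrib cong: if_cong)
  also have "\<dots> = (\<Sum>i\<le>degree p. if i = nat (- n) \<and> n \<le> 0 then coeff p i else 0)"
    by (intro sum.cong) auto
  also have "\<dots> = (if n \<le> 0 then coeff p (nat (- n)) else 0)"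
    by (auto simp: sum.delta coeff_eq_0)
  finally show ?thesis .
qed

lemma theta_emb_eq_0_iff [simp]: "theta_emb p = 0 \<longleftrightarrow> p = 0"
proof
  assume "theta_emb p = 0"
  then have "fls_nth (theta_emb p) (- int i) = 0" for i by simp
  then show "p = 0" by (intro poly_eqI) (simp add: theta_emb_nth)
qed (simp add: theta_emb_def)

lemma theta_emb_subdegree: 
  assumes "p \<noteq> 0"
  shows "fls_subdegree (theta_emb p) = - int (degree p)"
  using assms by (intro fls_subdegree_eqI) (auto simp: theta_emb_nth coeff_eq_0)

lemma comm_ring_hom_A_emb: "comm_ring_hom (A_emb :: 'a :: field poly \<Rightarrow> ('a, 'v :: linorder) ratfun poly)"
proof -
  interpret field_hom "rf_const :: 'a \<Rightarrow> ('a, 'v) ratfun" by (rule field_hom_rf_const)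
  show ?thesis unfolding A_emb_def[abs_def] by (rule comm_ring_hom_map_poly[OF comm_ring_hom_axioms])
qed

lemma degree_A_emb [simp]: "degree (A_emb a :: ('a :: field, 'v :: linorder) ratfun poly) = degree a"
proof -
  interpret field_hom "rf_const :: 'a \<Rightarrow> ('a, 'v) ratfun" by (rule field_hom_rf_const)
  show ?thesis by (simp add: A_emb_def)
qed

lemma A_emb_eq_0_iff [simp]: "(A_emb a :: ('a :: field, 'v :: linorder) ratfun poly) = 0 \<longleftrightarrow> a = 0"
proof -
  interpret field_hom "rf_const :: 'a \<Rightarrow> ('a, 'v) ratfun" by (rule field_hom_rf_const)
  show ?thesis using field_hom_map_poly_inj[OF field_hom_rf_const, of a 0] by (auto simp: A_emb_def)
qed

lemma A_eval_mult: "A_eval (a * b) z = A_eval a z * A_eval b z"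
  and A_eval_1: "A_eval 1 z = 1"
  by (simp_all add: A_eval_def comm_ring_homD[OF comm_ring_hom_A_emb])

definition aev :: "'a :: field poly \<Rightarrow> ('a, 'v :: linorder) ratfun fls" where
  "aev a = theta_emb (A_emb a)"

lemma comm_ring_hom_aev: "comm_ring_hom (aev :: 'a :: field poly \<Rightarrow> ('a, 'v :: linorder) ratfun fls)"
  unfolding aev_def[abs_def]
  by unfold_locales
    (simp_all add: comm_ring_homD[OF comm_ring_hom_A_emb] comm_ring_homD[OF comm_ring_hom_theta_emb])

lemmas aev_simps = comm_ring_homD[OF comm_ring_hom_aev]

lemma aev_eq_0_iff [simp]: "aev a = 0 \<longleftrightarrow> a = 0"
  by (simp add: aev_def)

lemma aev_subdegree: "a \<noteq> 0 \<Longrightarrow> fls_subdegree (aev a) = - int (degree a)"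
  by (simp add: aev_def theta_emb_subdegree)

lemma fls_ge_aev: "fls_ge R (- (int R * int (degree a))) (aev a)"
  by (cases "a = 0") (auto simp: fls_ge_def aev_subdegree aev_simps)

lemma aev_power: "aev (a ^ n) = aev a ^ n"
  by (induction n) (simp_all add: aev_simps)

text \<open>At a point of valuation \<open>d\<close>, the term of degree \<open>i\<close> then has valuation at least \<open>d i / R\<close>.\<close>

definition slope_le :: "nat \<Rightarrow> nat \<Rightarrow> 'a :: field poly poly \<Rightarrow> bool" where
  "slope_le R d p \<longleftrightarrow> (\<forall>i. R * degree (coeff p i) \<le> (R - 1) * (d * i))"

lemma scaled_degree_sum_le:
  "(\<And>i. i \<in> A \<Longrightarrow> R * degree (g i) \<le> B) \<Longrightarrow> R * degree (\<Sum>i\<in>A. g i) \<le> B"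
proof (induction A rule: infinite_finite_induct)
  case (insert x A)
  have "R * degree (g x + (\<Sum>i\<in>A. g i)) \<le> R * max (degree (g x)) (degree (\<Sum>i\<in>A. g i))"
    by (intro mult_le_mono2 degree_add_le_max)
  also have "\<dots> \<le> B" using insert by (simp add: max_def)
  finally show ?case using insert by simp
qed simp_all

lemma scaled_degree_mult_le:
  assumes "R * degree p \<le> (R - 1) * (d * i)" "R * degree p' \<le> (R - 1) * (d * (n - i))" "i \<le> n"
  shows "R * degree (p * p') \<le> (R - 1) * (d * n)"
proof -
  have "R * degree (p * p') \<le> R * degree p + R * degree p'"
    unfolding distrib_left[symmetric] by (intro mult_le_mono2 degree_mult_le)
  also have "\<dots> \<le> (R - 1) * (d * i) + (R - 1) * (d * (n - i))" using assms by (intro add_mono)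
  also have "\<dots> = (R - 1) * (d * n)" using assms by (simp flip: distrib_left)
  finally show ?thesis .
qed

lemma slope_le_mult:
  assumes "slope_le R d p" "slope_le R d p'"
  shows "slope_le R d (p * p')"
  unfolding slope_le_def coeff_mult
proof (intro allI scaled_degree_sum_le)
  fix n i :: nat assume "i \<in> {..n}"
  then show "R * degree (coeff p i * coeff p' (n - i)) \<le> (R - 1) * (d * n)"
    using assms unfolding slope_le_def by (intro scaled_degree_mult_le[of R _ d i]) auto
qed

lemma slope_le_diff_1:
  assumes "slope_le R d p"
  shows "slope_le R d (p - 1)"
proof -
  have "degree (coeff p i - coeff 1 i) \<le> degree (coeff p i)" for i
    by (intro degree_diff_le) (auto simp: one_pCons coeff_pCons split: nat.splits)
  then show ?thesis
    using assms unfolding slope_le_def coeff_diff by (meson le_trans mult_le_mono2)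
qed

lemma fls_ge_slope:
  fixes y :: "('a :: field, 'v :: linorder) ratfun fls"
  assumes R: "R > 0" and p: "slope_le R d p" and y: "fls_ge R (int R * int d) y"
    and low: "\<And>i. i < m \<Longrightarrow> coeff p i = 0"
  shows "fls_ge R (int d * int m) (poly (map_poly aev p) y)"
proof -
  let ?p = "map_poly (aev :: 'a poly \<Rightarrow> ('a, 'v) ratfun fls) p"
  have "poly ?p y = (\<Sum>i\<le>degree ?p. aev (coeff p i) * y ^ i)"
    by (simp add: poly_altdef coeff_map_poly aev_simps)
  moreover have "fls_ge R (int d * int m) (aev (coeff p i) * y ^ i)" for i
  proof (cases "i < m")
    case True
    then show ?thesis by (simp add: low aev_simps)
  next
    case False
    have "fls_ge R (- (int R * int (degree (coeff p i))) + int i * (int R * int d)) (aev (coeff p i) * y ^ i)"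
      by (intro fls_ge_mult fls_ge_aev fls_ge_power y)
    moreover have "int d * int m \<le> - (int R * int (degree (coeff p i))) + int i * (int R * int d)"
    proof -
      have "R * degree (coeff p i) + d * i \<le> (R - 1) * (d * i) + d * i"
        using p by (simp add: slope_le_def)
      also have "\<dots> = R * (d * i)" using R by (cases R) auto
      finally have "int R * int (degree (coeff p i)) + int d * int i \<le> int R * (int d * int i)"
        by (simp flip: of_nat_mult of_nat_add)
      moreover have "int d * int m \<le> int d * int i" using False by (intro mult_left_mono) auto
      ultimately show ?thesis by (simp add: mult_ac)
    qed
    ultimately show ?thesis by (rule fls_ge_mono)
  qed
  ultimately show ?thesis by (auto intro: fls_ge_sum)
qed

text \<open>The recursion for the inverse coefficients preserves the slope bound. With
  \<open>C\<close> the truncated inverse, \<open>D * C - 1\<close> starts in degree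
  \<open>m + 1\<close>, so its value at \<open>y\<close> has scaled valuation at least
  \<open>d * (m + 1)\<close>, and dividing by the unit \<open>D(y)\<close> gives the error. The
  slope bound itself later controls the degree of \<open>\<mu>\<close>.\<close>

lemma inverse_series_approx:
  fixes y :: "('a :: field, 'v :: linorder) ratfun fls"
  assumes R: "R > 0" and d: "d > 0" and D: "slope_le R d D" "coeff D 0 = 1"
    and y: "fls_ge R (int R * int d) y"
    and inv: "Abs_fps c * fps_of_poly D = 1"
  shows "slope_le R d (\<Sum>i\<le>m. monom (c i) i) \<and>
    fls_ge R (int m) (1 / poly (map_poly aev D) y - (\<Sum>i\<le>m. aev (c i) * y ^ i))"
proof
  let ?C = "\<Sum>i\<le>m. monom (c i) i"
  have rec: "(\<Sum>i\<le>n. c i * coeff D (n - i)) = (if n = 0 then 1 else 0)" for n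
    using arg_cong[OF inv, of "\<lambda>s. fps_nth s n"] by (simp add: fps_mult_nth atLeast0AtMost)
  have c_deg: "R * degree (c n) \<le> (R - 1) * (d * n)" for n
  proof (induction n rule: less_induct)
    case (less n)
    show ?case
    proof (cases "n = 0")
      case True
      then have "c n = 1" using rec[of 0] D(2) by simp
      then show ?thesis by simp
    next
      case False
      have "(\<Sum>i<n. c i * coeff D (n - i)) + c n = 0"
        using rec[of n] False D(2) by (simp add: lessThan_Suc_atMost[symmetric])
      then have cn: "c n = - (\<Sum>i<n. c i * coeff D (n - i))" by (simp add: eq_neg_iff_add_eq_0 add.commute)
      have "R * degree (\<Sum>i<n. c i * coeff D (n - i)) \<le> (R - 1) * (d * n)"
      proof (rule scaled_degree_sum_le)
        fix i assume "i \<in> {..<n}"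
        then show "R * degree (c i * coeff D (n - i)) \<le> (R - 1) * (d * n)"
          using D(1) less unfolding slope_le_def by (intro scaled_degree_mult_le[of R _ d i]) auto
      qed
      then show ?thesis unfolding cn by simp
    qed
  qed
  have coeff_C: "coeff ?C i = (if i \<le> m then c i else 0)" for i by (simp add: coeff_sum)
  show C: "slope_le R d ?C" using c_deg by (simp add: slope_le_def coeff_C)
  define ev where "ev p = poly (map_poly (aev :: _ \<Rightarrow> ('a, 'v) ratfun fls) p) y" for p
  have ev_hom: "comm_ring_hom ev"
  proof -
    have "comm_ring_hom (map_poly (aev :: 'a poly \<Rightarrow> ('a, 'v) ratfun fls))"
      by (rule comm_ring_hom_map_poly[OF comm_ring_hom_aev])
    from comm_ring_homD[OF this] show ?thesis
      unfolding ev_def[abs_def] by unfold_locales simp_all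
  qed
  have ev_C: "ev ?C = (\<Sum>i\<le>m. aev (c i) * y ^ i)"
    unfolding comm_ring_homD(4)[OF ev_hom]
    by (simp add: ev_def map_poly_monom aev_simps poly_monom)
  have "slope_le R d (D * ?C)" by (rule slope_le_mult[OF D(1) C])
  then have sl: "slope_le R d (D * ?C - 1)"
    by (rule slope_le_diff_1)
  have low: "coeff (D * ?C - 1) n = 0" if "n < Suc m" for n
  proof -
    have "coeff (D * ?C) n = (\<Sum>i\<le>n. coeff ?C i * coeff D (n - i))"
      by (subst mult.commute) (rule coeff_mult)
    also have "\<dots> = (\<Sum>i\<le>n. c i * coeff D (n - i))"
      using that by (intro sum.cong) (auto simp: coeff_C)
    finally show ?thesis by (simp add: rec)
  qed
  have err: "fls_ge R (int d * int (Suc m)) (ev (D * ?C - 1))"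
    unfolding ev_def by (rule fls_ge_slope[OF R sl y low])
  \<comment> \<open>\<open>D(y) - 1\<close> has positive valuation, so \<open>D(y)\<close> has
    subdegree 0 and can be inverted without loss of precision.\<close>
  have "slope_le R d (D - 1)"
    using D(1) by (rule slope_le_diff_1)
  then have "fls_ge R (int d * int 1) (ev (D - 1))"
    unfolding ev_def by (rule fls_ge_slope[OF R _ y]) (simp add: D(2))
  then have D1: "fls_ge R (int d) (ev D - 1)" by (simp add: comm_ring_homD[OF ev_hom])
  have sd: "ev D \<noteq> 0 \<and> fls_subdegree (ev D) = 0"
  proof -
    have "fls_nth (ev D - 1) i = 0" if "i \<le> 0" for i
    proof (rule fls_ge_nth[OF D1])
      have "int R * i \<le> 0" using that R by (simp add: mult_nonneg_nonpos)
      then show "int R * i < int d" using d by simp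
    qed
    then have "fls_nth (ev D) i = fls_nth 1 i" if "i \<le> 0" for i using that by simp
    then have "fls_nth (ev D) 0 = 1" "\<And>i. i < 0 \<Longrightarrow> fls_nth (ev D) i = 0" by simp_all
    then show ?thesis by (auto intro: fls_subdegree_eqI)
  qed
  have "fls_ge R 0 (- inverse (ev D))"
    using sd by (simp add: fls_ge_def)
  then have ge: "fls_ge R (0 + int d * int (Suc m)) (- inverse (ev D) * ev (D * ?C - 1))"
    using err by (rule fls_ge_mult)
  have ev_eq: "- inverse (ev D) * ev (D * ?C - 1) = 1 / ev D - ev ?C"
    using sd by (simp add: comm_ring_homD[OF ev_hom] field_simps)
  have m_le: "int m \<le> 0 + int d * int (Suc m)"
  proof -
    have "m \<le> d * Suc m" using d by (cases d) auto
    then have "int m \<le> int (d * Suc m)" by (rule of_nat_mono)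
    then show ?thesis by (simp only: of_nat_mult add_0)
  qed
  have "fls_ge R (int m) (1 / ev D - ev ?C)"
    by (rule fls_ge_mono[OF ge[unfolded ev_eq] m_le])
  then show "fls_ge R (int m) (1 / poly (map_poly aev D) y - (\<Sum>i\<le>m. aev (c i) * y ^ i))"
    unfolding ev_C by (simp add: ev_def)
qed

text \<open>In positive reduced rank the \<open>a m\<close> are \<open>c(f)\<close> times the
  coefficients of the Frobenius polynomial; in rank zero the determinant is just \<open>f\<close>.
  Joining the two cases lets the local factors be computed uniformly.\<close>

lemma frobenius_data:
  fixes \<phi> :: "'a :: {field, finite} poly poly"
  assumes phi_0: "coeff \<phi> 0 = [:0, 1:]" and f: "f \<in> monic_primes" and R: "degree \<phi> \<le> R" "R > 0"
  defines "\<rho> \<equiv> reduction_rank \<phi> f"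
  obtains a where "a 0 = f" "\<And>m. m > \<rho> \<Longrightarrow> a m = 0"
    "\<And>m. m > 0 \<Longrightarrow> coeff (D_poly \<phi> f) m = a m * f ^ (m - 1)" "coeff (D_poly \<phi> f) 0 = 1"
    "slope_le R (degree f) (D_poly \<phi> f)"
    "\<And>m. coeff (det (fq_ext.cmat to_ac (red_root f) \<phi> (degree f) \<rho>)) m = map_poly to_ac (a m)"
proof -
  interpret fq_ext_root "to_ac :: 'a \<Rightarrow> 'a alg_closure" f "red_root f"
  proof -
    interpret fq_ext "to_ac :: 'a \<Rightarrow> 'a alg_closure"
      by (intro fq_ext.intro field_hom_to_ac)
    show "fq_ext_root (to_ac :: 'a \<Rightarrow> 'a alg_closure) f (red_root f)"
      by unfold_locales (simp_all add: f ev_def red_root)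
  qed
  let ?G = "det (cmat (red_root f) \<phi> d \<rho>)"
  \<comment> \<open>Serves twice: with \<open>R' = \<rho>\<close> it kills the coefficients beyond
    \<open>\<rho>\<close>, with \<open>R' = R\<close> it gives the slope.\<close>
  have wt: "R' * degree (coeff ?G m) + d * m \<le> R' * d" if "coeff ?G m \<noteq> 0" "\<rho> \<le> R'" for R' m
  proof -
    have "coeff (coeff ?G m) (degree (coeff ?G m)) \<noteq> 0" using that by simp
    then have "int R' * int (degree (coeff ?G m)) + int d * int m \<le> int R' * int d"
      using wt_le_det_cmat[OF that(2), of d "red_root f" \<phi>] unfolding wt_le_def by blast
    then show ?thesis by (simp flip: of_nat_mult of_nat_add)
  qed
  have G_high: "coeff ?G m = 0" if "m > \<rho>" for m
  proof (rule ccontr)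
    assume "coeff ?G m \<noteq> 0"
    from wt[OF this order_refl] have "d * m \<le> \<rho> * d" by linarith
    then have "d * m \<le> d * \<rho>" by (simp only: mult.commute)
    then show False using that d_pos by simp
  qed
  have "\<exists>a. (\<forall>m. coeff ?G m = map_poly to_ac (a m)) \<and>
      (\<forall>m>0. coeff (D_poly \<phi> f) m = a m * f ^ (m - 1)) \<and> coeff (D_poly \<phi> f) 0 = 1"
  proof (cases "\<rho> = 0")
    case True
    have "coeff ?G m = map_poly to_ac (if m = 0 then f else 0)" for m
      using poly_det_cmat_0[OF phi_0, of \<rho>] G_high[of m] True by auto
    moreover have "D_poly \<phi> f = 1" using True by (simp add: D_poly_def \<rho>_def)
    ultimately show ?thesis
      by (intro exI[of _ "\<lambda>m. if m = 0 then f else 0"]) (auto simp: one_pCons coeff_pCons split: nat.splits)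
  next
    case False
    interpret drinfeld_red f \<phi>
      using False phi_0 by unfold_locales (simp_all add: \<rho>_def)
    let ?a = "\<lambda>m. smult (frob_const \<phi> f) (coeff (frob_charpoly \<phi> f) m)"
    have G: "coeff ?G m = map_poly to_ac (?a m)" for m
      using coeff_det_cmat[of m] by (simp add: r_def \<rho>_def)
    have a_high: "?a m = 0" if "m > \<rho>" for m
      using G_high[OF that] unfolding G by simp
    have D: "coeff (D_poly \<phi> f) m = (if m = 0 then 1 else 0) +
        (if m \<in> {1..\<rho>} then ?a m * f ^ (m - 1) else 0)" for m
      by (auto simp: D_poly_def \<rho>_def coeff_sum one_pCons coeff_pCons split: nat.splits)
    have "coeff (D_poly \<phi> f) m = ?a m * f ^ (m - 1)" if "m > 0" for m
      using that a_high[of m] by (auto simp: D not_le)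
    moreover have "coeff (D_poly \<phi> f) 0 = 1" by (simp add: D)
    ultimately show ?thesis using G by (intro exI[of _ ?a]) auto
  qed
  then obtain a where a: "\<And>m. coeff ?G m = map_poly to_ac (a m)"
    "\<And>m. m > 0 \<Longrightarrow> coeff (D_poly \<phi> f) m = a m * f ^ (m - 1)" "coeff (D_poly \<phi> f) 0 = 1" by blast
  have a0: "a 0 = f"
    using poly_det_cmat_0[OF phi_0, of \<rho>] a(1)[of 0] by simp
  have a_high: "a m = 0" if "m > \<rho>" for m
    using G_high[OF that] unfolding a(1) by simp
  have "slope_le R (degree f) (D_poly \<phi> f)"
    unfolding slope_le_def
  proof
    fix m
    show "R * degree (coeff (D_poly \<phi> f) m) \<le> (R - 1) * (degree f * m)"
    proof (cases "m = 0 \<or> a m = 0")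
      case True
      then show ?thesis using a(2)[of m] a(3) by (cases "m = 0") auto
    next
      case False
      then have nz: "coeff ?G m \<noteq> 0" by (simp add: a(1))
      \<comment> \<open>The factor \<open>f ^ (m - 1)\<close> turns a bound that decreases in
        \<open>m\<close> into one proportional to \<open>m\<close>:
        \<open>R d - d m + R (m - 1) d = (R - 1) d m\<close>.\<close>
      have "R * degree (coeff ?G m) + d * m \<le> R * d"
        using wt[OF nz, of R] reduction_rank_le_degree[of \<phi> f] R by (simp add: \<rho>_def)
      then have w: "R * degree (a m) + d * m \<le> R * d" by (simp add: a(1))
      have "degree (coeff (D_poly \<phi> f) m) = degree (a m) + (m - 1) * d"
        using False a(2)[of m] f_nz by (simp add: degree_mult_eq degree_power_eq d_def)
      then have "R * degree (coeff (D_poly \<phi> f) m) + d * m = R * degree (a m) + d * m + R * ((m - 1) * d)"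
        by (simp add: distrib_left)
      also have "\<dots> \<le> R * d + R * ((m - 1) * d)" using w by simp
      also have "\<dots> = R * (d * m)"
        using False by (cases m) (simp_all add: distrib_left mult.commute)
      also have "\<dots> = (R - 1) * (d * m) + d * m"
        using R(2) by (cases R) auto
      finally show ?thesis by (simp add: d_def)
    qed
  qed
  then show ?thesis using that[of a] a a0 a_high by (simp add: d_def)
qed

section \<open>Local factors and the terms of the series\<close>

lemma theta_emb_smult: "theta_emb (smult k p) = fls_const k * theta_emb p"
  by (rule fls_eqI) (simp add: theta_emb_nth)

definition zt :: "nat \<Rightarrow> (nat \<Rightarrow> 'v :: linorder) \<Rightarrow> 'a :: field poly \<Rightarrow> ('a, 'v) ratfun" where
  "zt n v a = (\<Prod>k = 1..n. A_eval a (rf_var (v k))) * rf_var (v 0) ^ degree a"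

lemma zt_1: "zt n v 1 = 1"
  by (simp add: zt_def A_eval_1)

lemma zt_mult: "a \<noteq> 0 \<Longrightarrow> b \<noteq> 0 \<Longrightarrow> zt n v (a * b) = zt n v a * zt n v b"
  by (simp add: zt_def A_eval_mult prod.distrib degree_mult_eq power_add mult_ac)

lemma zt_power: "a \<noteq> 0 \<Longrightarrow> zt n v (a ^ i) = zt n v a ^ i"
  by (induction i) (simp_all add: zt_1 zt_mult)

lemma zt_nonzero: "a \<noteq> 0 \<Longrightarrow> zt n v a \<noteq> 0"
  by (auto simp: zt_def A_eval_nonzero rf_var_nonzero)

text \<open>For \<open>a = f\<close> this is the point \<open>Z / f\<close> at which
  \<open>D_poly\<close> is evaluated; for general monic \<open>a\<close>, multiplying it by
  \<open>\<mu> a\<close> gives the term of the series.\<close>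

definition yf :: "nat \<Rightarrow> (nat \<Rightarrow> 'v :: linorder) \<Rightarrow> 'a :: field poly \<Rightarrow> ('a, 'v) ratfun fls" where
  "yf n v a = fls_const (zt n v a) / aev a"

lemma fls_subdegree_yf:
  assumes "a \<noteq> 0"
  shows "fls_subdegree (yf n v a) = int (degree a)" "yf n v a \<noteq> 0"
proof -
  show nz: "yf n v a \<noteq> 0" using assms zt_nonzero[OF assms, of n v] by (simp add: yf_def)
  have "yf n v a * aev a = fls_const (zt n v a)" using assms by (simp add: yf_def)
  then have "fls_subdegree (yf n v a * aev a) = 0" by simp
  then show "fls_subdegree (yf n v a) = int (degree a)"
    using nz assms by (simp add: aev_subdegree)
qed

lemma fls_ge_yf: "a \<noteq> 0 \<Longrightarrow> fls_ge R (int R * int (degree a)) (yf n v a)"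
  by (simp add: fls_ge_def fls_subdegree_yf)

lemma yf_power: "a \<noteq> 0 \<Longrightarrow> yf n v (a ^ i) = yf n v a ^ i"
  by (simp add: yf_def zt_power aev_power power_divide fls_const_power)

lemma yf_mult: "a \<noteq> 0 \<Longrightarrow> b \<noteq> 0 \<Longrightarrow> yf n v (a * b) = yf n v a * yf n v b"
  by (simp add: yf_def zt_mult aev_simps flip: fls_const_mult_const)

text \<open>Since \<open>a 0 = f\<close> and \<open>D_poly\<close> has coefficients
  \<open>a m * f ^ (m - 1)\<close> for \<open>m > 0\<close>, the sum of the
  \<open>a m * Z ^ m\<close> is \<open>f\<close> times the value of \<open>D_poly\<close> at
  \<open>Z / f\<close>. The factor \<open>f\<close> cancels against
  \<open>det_quot f\<close>.\<close>

lemma local_factor_eq: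
  fixes \<phi> :: "'a :: {field, finite} poly poly" and v :: "nat \<Rightarrow> 'v :: linorder"
  assumes phi_0: "coeff \<phi> 0 = [:0, 1:]" and f: "f \<in> monic_primes" and R: "degree \<phi> \<le> R" "R > 0"
  shows "local_factor \<phi> n v f = 1 / poly (map_poly aev (D_poly \<phi> f)) (yf n v f)"
proof -
  let ?e = "\<lambda>a. to_ac (rf_const a :: ('a, 'v) ratfun)"
  define \<rho> where "\<rho> = reduction_rank \<phi> f"
  obtain a where a: "a 0 = f" "\<And>m. m > \<rho> \<Longrightarrow> a m = 0"
    "\<And>m. m > 0 \<Longrightarrow> coeff (D_poly \<phi> f) m = a m * f ^ (m - 1)" "coeff (D_poly \<phi> f) 0 = 1"
    "\<And>m. coeff (det (fq_ext.cmat to_ac (red_root f) \<phi> (degree f) \<rho>)) m = map_poly to_ac (a m)"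
    unfolding \<rho>_def by (rule frobenius_data[OF phi_0 f R]) blast
  have fnz: "f \<noteq> 0" using f by (auto simp: monic_primes_def)
  have "field_hom ?e"
  proof -
    interpret rc: field_hom "rf_const :: 'a \<Rightarrow> ('a, 'v) ratfun" by (rule field_hom_rf_const)
    show ?thesis by unfold_locales (simp_all add: hom_distribs)
  qed
  then interpret E: fq_ext ?e by (rule fq_ext.intro)
  have "degree (map_poly ?e f) > 0" using monic_primes_degree[OF f] by simp
  \<comment> \<open>This root lies in the closure of the rational function field and has no relation
    to \<open>red_root f\<close>; \<open>det_cmat_transfer\<close> bridges the two.\<close>
  then obtain \<zeta> where \<zeta>: "poly (map_poly ?e f) \<zeta> = 0" using alg_closed_imp_poly_has_root by blast
  interpret psi_root f \<zeta> \<phi> n v \<rho>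
    using reduction_rank_le_degree[of \<phi> f] reduction_rank_max[of \<phi> f]
    by unfold_locales (simp_all add: f E.ev_def \<zeta> \<rho>_def)
  have base: "fq_ext_root (to_ac :: 'a \<Rightarrow> 'a alg_closure) f (red_root f)"
  proof -
    interpret C: fq_ext "to_ac :: 'a \<Rightarrow> 'a alg_closure" by (intro fq_ext.intro field_hom_to_ac)
    show ?thesis by unfold_locales (simp_all add: f C.ev_def red_root)
  qed
  have cm: "coeff (det (E.cmat \<zeta> \<phi> (degree f) \<rho>)) m = map_poly ?e (a m)" for m
    by (rule det_cmat_transfer[OF base fq_ext_root_axioms a(5)])
  then have det_psi: "det_psi_quot \<phi> n v f = (\<Sum>m\<le>\<rho>. smult (Z ^ m) (emb (a m)))"
    by (intro det_psi_quot_eq a(2)) (simp_all only: d_def)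
  have Z: "Z = zt n v f" by (simp add: Z_def zt_def d_def)
  let ?y = "yf n v f"
  have "theta_emb (det_psi_quot \<phi> n v f) = (\<Sum>m\<le>\<rho>. fls_const (Z ^ m) * aev (a m))"
    unfolding det_psi comm_ring_homD(4)[OF comm_ring_hom_theta_emb] by (simp add: theta_emb_smult aev_def)
  also have "\<dots> = (\<Sum>m\<le>\<rho>. aev f * (aev (coeff (D_poly \<phi> f) m) * ?y ^ m))"
  proof (rule sum.cong[OF refl])
    fix m
    show "fls_const (Z ^ m) * aev (a m) = aev f * (aev (coeff (D_poly \<phi> f) m) * ?y ^ m)"
    proof (cases m)
      case 0
      then show ?thesis by (simp add: a aev_simps)
    next
      case (Suc k)
      have "aev f * (aev (coeff (D_poly \<phi> f) m) * ?y ^ m) = aev (a m) * (aev f * aev f ^ k * ?y ^ m)"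
        using a(3)[of m] Suc by (simp add: aev_simps aev_power mult_ac)
      also have "aev f * aev f ^ k * ?y ^ m = fls_const (Z ^ m)"
        using fnz Suc by (simp add: yf_def power_divide Z flip: fls_const_power)
      finally show ?thesis by (simp add: mult.commute)
    qed
  qed
  also have "\<dots> = aev f * poly (map_poly aev (D_poly \<phi> f)) ?y"
  proof -
    let ?p = "map_poly (aev :: 'a poly \<Rightarrow> ('a, 'v) ratfun fls) (D_poly \<phi> f)"
    have "coeff ?p m = 0" if "m > \<rho>" for m
      using a(2)[OF that] a(3)[of m] that by (simp add: coeff_map_poly aev_simps)
    then have "degree ?p \<le> \<rho>" by (intro degree_le) auto
    then have "poly ?p ?y = (\<Sum>m\<le>\<rho>. coeff ?p m * ?y ^ m)"
      unfolding poly_altdef by (intro sum.mono_neutral_left) (auto simp: coeff_eq_0)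
    then show ?thesis by (simp add: sum_distrib_left coeff_map_poly aev_simps)
  qed
  finally have "theta_emb (det_psi_quot \<phi> n v f) = aev f * poly (map_poly aev (D_poly \<phi> f)) ?y" .
  moreover have "theta_emb (det_quot f :: ('a, 'v) ratfun poly) = aev f"
    by (simp add: det_quot_eq aev_def)
  ultimately show ?thesis using fnz by (simp add: local_factor_def)
qed

text \<open>By multiplicativity it suffices to bound the values at prime powers, which are the
  coefficients of the inverse series of \<open>D_poly\<close>.\<close>

lemma degree_mu:
  fixes \<phi> :: "'a :: {field, finite} poly poly"
  assumes mu: "is_mu \<phi> \<mu>" and R: "R > 0"
    and slope: "\<And>f. f \<in> monic_primes \<Longrightarrow> slope_le R (degree f) (D_poly \<phi> f)"
    and D0: "\<And>f. f \<in> monic_primes \<Longrightarrow> coeff (D_poly \<phi> f) 0 = 1"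
    and a: "a \<in> monics"
  shows "R * degree (\<mu> a) \<le> (R - 1) * degree a"
  using a
proof (induction "degree a" arbitrary: a rule: less_induct)
  case less
  show ?case
  proof (cases "degree a = 0")
    case True
    then obtain c where "a = [:c:]" by (metis degree_eq_zeroE)
    then have "a = 1" using less(2) by (simp add: monics_def one_pCons)
    then show ?thesis using mu by (simp add: is_mu_def)
  next
    case False
    then obtain f where f: "f \<in> monic_primes" "f dvd a" using monic_prime_divisor by blast
    have fm: "f \<in> monics" by (rule monic_primes_monics[OF f(1)])
    obtain i b where ib: "a = f ^ i * b" "b \<in> monics" "\<not> f dvd b"
      by (rule monic_split_prime_power[OF less(2) f(1)])
    have i: "i > 0" using ib f(2) by (cases i) auto
    have deg: "degree a = degree f * i + degree b"
      unfolding ib(1) using monics_nonzero[OF fm] monics_nonzero[OF ib(2)]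
      by (simp add: degree_mult_eq degree_power_eq mult.commute)
    \<comment> \<open>The approximation lemma is taken at the point 0, where the valuation
      hypothesis holds trivially; what is wanted is its bound on the coefficients.\<close>
    have "slope_le R (degree f) (\<Sum>j\<le>i. monom (\<mu> (f ^ j)) j)"
      using mu f(1)
      by (intro inverse_series_approx[OF R monic_primes_degree[OF f(1)] slope[OF f(1)] D0[OF f(1)],
            of 0, THEN conjunct1]) (auto simp: is_mu_def)
    then have "R * degree (coeff (\<Sum>j\<le>i. monom (\<mu> (f ^ j)) j) i) \<le> (R - 1) * (degree f * i)"
      unfolding slope_le_def by blast
    then have mf: "R * degree (\<mu> (f ^ i)) \<le> (R - 1) * (degree f * i)" by (simp add: coeff_sum)
    have "degree b < degree a" using deg i monic_primes_degree[OF f(1)] by simp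
    then have mb: "R * degree (\<mu> b) \<le> (R - 1) * degree b" by (rule less(1)[OF _ ib(2)])
    have "\<mu> a = \<mu> (f ^ i) * \<mu> b"
      using mu monics_power[OF fm] ib coprime_prime_power[OF f(1) ib(3)] by (simp add: is_mu_def)
    then have "R * degree (\<mu> a) \<le> R * (degree (\<mu> (f ^ i)) + degree (\<mu> b))"
      by (simp add: degree_mult_le)
    also have "\<dots> \<le> (R - 1) * (degree f * i) + (R - 1) * degree b"
      using mf mb by (simp add: distrib_left)
    finally show ?thesis unfolding deg by (simp add: distrib_left)
  qed
qed

theorem theorem3p5:
  fixes \<phi> :: "'a :: {field, finite} poly poly"
    and \<mu> :: "'a poly \<Rightarrow> 'a poly"
    and r n :: nat
    and v :: "nat \<Rightarrow> 'v :: linorder"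
  assumes "drinfeld_module r \<phi>"
    and "is_mu \<phi> \<mu>"
    and "bij_betw v {0..n} (UNIV :: 'v set)"
  shows "((\<lambda>F. \<Prod>f\<in>F. local_factor \<phi> n v f) \<longlongrightarrow> L_psi \<phi> n v)
           (finite_subsets_at_top monic_primes) \<and>
         ((\<lambda>a. theta_emb (A_emb (\<mu> a)) *
               fls_const ((\<Prod>k=1..n. A_eval a (rf_var (v k))) * rf_var (v 0) ^ degree a) /
               theta_emb (A_emb a)) has_sum L_psi \<phi> n v) monics"
proof -
  note mu = assms(2)
  have R: "degree \<phi> \<le> r" "r > 0" and phi_0: "coeff \<phi> 0 = [:0, 1:]"
    using assms(1) by (auto simp: drinfeld_module_def)
  have slope: "slope_le r (degree f) (D_poly \<phi> f)" and D0: "coeff (D_poly \<phi> f) 0 = 1"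
    if "f \<in> monic_primes" for f
    by (rule frobenius_data[OF phi_0 that R]; blast)+
  define T where "T a = aev (\<mu> a) * yf n v a" for a
  have T_eq: "T = (\<lambda>a. theta_emb (A_emb (\<mu> a)) *
      fls_const ((\<Prod>k=1..n. A_eval a (rf_var (v k))) * rf_var (v 0) ^ degree a) / theta_emb (A_emb a))"
    by (rule ext) (simp add: T_def yf_def zt_def aev_def)
  obtain S where S: "((\<lambda>F. \<Prod>f\<in>F. local_factor \<phi> n v f) \<longlongrightarrow> S) (finite_subsets_at_top monic_primes)"
    "(T has_sum S) monics"
  proof (rule euler_product[of r T "local_factor \<phi> n v"])
    show "T 1 = 1" using mu by (simp add: T_def yf_def zt_1 aev_simps is_mu_def)
    show "T (a * b) = T a * T b" if "a \<in> monics" "b \<in> monics" "coprime a b" for a b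
      using mu that by (simp add: T_def is_mu_def yf_mult monics_nonzero aev_simps mult_ac)
    show "fls_ge r (int (degree a)) (T a)" if a: "a \<in> monics" for a
    proof -
      \<comment> \<open>Of the scaled valuation \<open>r * degree a\<close> gained from
        \<open>yf\<close>, the numerator \<open>\<mu> a\<close> costs at most
        \<open>(r - 1) * degree a\<close>.\<close>
      have "fls_ge r (- (int r * int (degree (\<mu> a))) + int r * int (degree a)) (T a)"
        unfolding T_def by (intro fls_ge_mult fls_ge_aev fls_ge_yf monics_nonzero a)
      moreover have "int (degree a) \<le> - (int r * int (degree (\<mu> a))) + int r * int (degree a)"
      proof -
        have "r * degree (\<mu> a) + degree a \<le> (r - 1) * degree a + degree a"
          using degree_mu[OF mu R(2) slope D0 a] by simp
        also have "\<dots> = r * degree a" using R(2) by (cases r) auto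
        finally have "int (r * degree (\<mu> a) + degree a) \<le> int (r * degree a)" by (rule of_nat_mono)
        then show ?thesis by simp
      qed
      ultimately show ?thesis by (rule fls_ge_mono)
    qed
    show "fls_ge r (int M) (local_factor \<phi> n v f - (\<Sum>i\<le>M. T (f ^ i)))"
      if f: "f \<in> monic_primes" for f M
    proof -
      have fnz: "f \<noteq> 0" by (rule monics_nonzero[OF monic_primes_monics[OF f]])
      have "Abs_fps (\<lambda>i. \<mu> (f ^ i)) * fps_of_poly (D_poly \<phi> f) = 1"
        using mu f by (simp add: is_mu_def)
      from inverse_series_approx[OF R(2) monic_primes_degree[OF f] slope[OF f] D0[OF f]
          fls_ge_yf[OF fnz] this, THEN conjunct2]
      show ?thesis by (simp add: local_factor_eq[OF phi_0 f R] T_def yf_power[OF fnz])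
    qed
  qed (use R in auto)
  \<comment> \<open>\<open>Lim\<close> takes its intended value because convergence to
    \<open>S\<close> is established and limits are unique.\<close>
  have "L_psi \<phi> n v = S"
    unfolding L_psi_def by (rule tendsto_Lim[OF _ S(1)]) simp
  then show ?thesis using S unfolding T_eq by simp
qed

end
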